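(* Let $\mathcal{O}$ be a Dedekind domain with $1<|\mathrm{Cl}(\mathcal{O})|<\infty$, and let $M$ be a finitely generated projective $\mathcal{O}$-module of rank $n\ge 2$. If $|\mathrm{Cl}(\mathcal{O})|=2$, assume that $M$ is not the unique (up to isomorphism) non-free projective $\mathcal{O}$-module of rank $2$. Then $\mathrm{St}(M)$ is not generated by $M$-integral apartment classes.
   Context: Let $K$ be the fraction field of $\mathcal{O}$ and $\mathrm{rank}(M)=\dim_K(M\otimes_{\mathcal{O}}K)$. Let $\mathcal{T}(M)$ be the poset of proper nonzero $\mathcal{O}$-submodules of $M$ that are direct summands of $M$, ordered by inclusion, regarded as a simplicial complex via its order complex (simplices are chains); set $\mathrm{St}(M)=\widetilde{H}_{n-2}(\mathcal{T}(M);\mathbb{Z})$. An $M$-integral frame is a set $\mathcal{I}=\{I_1,\dots,I_n\}$ of rank-$1$ direct summands of $M$ with $M=I_1\oplus\cdots\oplus I_n$. Its apartment class is $[A_{\mathcal{I}}]=\sum_{\sigma\in S_n}(-1)^\sigma[\mathcal{V}_\sigma]\in\mathrm{St}(M)$, where $\mathcal{V}_\sigma$ is the oriented $(n-2)$-simplex given by the chain $I_{\sigma(1)}\subsetneq I_{\sigma(1)}\oplus I_{\sigma(2)}\subsetneq\cdots\subsetneq I_{\sigma(1)}\oplus\cdots\oplus I_{\sigma(n-1)}$ (this is the fundamental class of a subcomplex homeomorphic to $S^{n-2}$, defined up to sign by the ordering). These classes are the $M$-integral apartment classes. *)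

theory Defs
  imports
    "Jordan_Normal_Form.VS_Connect"
    "HOL-Algebra.Free_Abelian_Groups"
    "HOL-Algebra.Ring_Divisibility"
    "HOL-Computational_Algebra.Polynomial_Factorial"
    "HOL-Combinatorics.Permutations"
begin

section \<open>Dedekind domains and their class groups\<close>

definition integrally_closed_domain :: "'a::idom itself \<Rightarrow> bool" where
  "integrally_closed_domain _ \<longleftrightarrow>
     (\<forall>x::'a fract. (\<exists>p::'a poly. lead_coeff p = 1 \<and> poly (map_poly to_fract p) x = 0)
        \<longrightarrow> x \<in> range to_fract)"

text \<open>Fields are not excluded; they have trivial class group.\<close>

definition dedekind_domain :: "'a::idom itself \<Rightarrow> bool" where
  "dedekind_domain T \<longleftrightarrow>
     noetherian_domain (class_ring :: 'a ring) \<and>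
     integrally_closed_domain T \<and>
     (\<forall>P. primeideal P (class_ring :: 'a ring) \<and> P \<noteq> {0} \<longrightarrow> maximalideal P (class_ring :: 'a ring))"

definition fract_scale :: "'a::idom \<Rightarrow> 'a fract \<Rightarrow> 'a fract" where
  "fract_scale a x = to_fract a * x"

definition fractional_ideals :: "'a::idom fract set set" where
  "fractional_ideals =
     {J. Modules.module.subspace fract_scale J \<and> J \<noteq> {0} \<and>
         (\<exists>d. d \<noteq> 0 \<and> fract_scale d ` J \<subseteq> range to_fract)}"

text \<open>For a Dedekind domain every nonzero fractional ideal is invertible, so this is a group.\<close>

definition fractional_ideal_group :: "'a::idom fract set monoid" where
  "fractional_ideal_group =
     \<lparr>carrier = fractional_ideals,
      monoid.mult = (\<lambda>I J. Modules.module.span fract_scale {x * y | x y. x \<in> I \<and> y \<in> J}),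
      one = range to_fract\<rparr>"

definition principal_fractional_ideals :: "'a::idom fract set set" where
  "principal_fractional_ideals = {range (\<lambda>a. fract_scale a x) | x. x \<noteq> 0}"

definition class_group :: "'a::idom fract set set monoid" where
  "class_group = fractional_ideal_group Mod principal_fractional_ideals"


section \<open>Modules\<close>

text \<open>
  A module is a whole type \<open>'m\<close> with a scalar multiplication \<open>s\<close> satisfying
  \<^const>\<open>Modules.module\<close>; its submodules are subsets of \<open>'m\<close>.
\<close>

definition finitely_generated_module :: "('a::idom \<Rightarrow> 'm::ab_group_add \<Rightarrow> 'm) \<Rightarrow> bool" where
  "finitely_generated_module s \<longleftrightarrow> (\<exists>B. finite B \<and> Modules.module.span s B = UNIV)"

definition free_module :: "('a::idom \<Rightarrow> 'm::ab_group_add \<Rightarrow> 'm) \<Rightarrow> bool" where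
  "free_module s \<longleftrightarrow> (\<exists>B. \<not> Modules.module.dependent s B \<and> Modules.module.span s B = UNIV)"

text \<open>The finitely supported functions \<open>'i \<Rightarrow>\<^sub>0 'a\<close> form the free module on \<open>'i\<close>.\<close>

definition free_scale :: "'a::idom \<Rightarrow> ('i \<Rightarrow>\<^sub>0 'a) \<Rightarrow> ('i \<Rightarrow>\<^sub>0 'a)" where
  "free_scale a = Poly_Mapping.map ((*) a)"

lemma lookup_free_scale: "Poly_Mapping.lookup (free_scale a f) i = a * Poly_Mapping.lookup f i"
  by (simp add: free_scale_def Poly_Mapping.map.rep_eq when_def)

lemma module_free_scale: "Modules.module free_scale"
  by unfold_locales
    (auto intro!: poly_mapping_eqI simp: lookup_free_scale lookup_add algebra_simps)

text \<open>
  Projective means direct summand of a free module, i.e. a retract of one. As \<open>'m\<close> is a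
  quotient of the free module on its own underlying set, it is a summand of some free module
  iff it is a summand of that one, so no quantification over index types is needed.
\<close>

definition projective_module :: "('a::idom \<Rightarrow> 'm::ab_group_add \<Rightarrow> 'm) \<Rightarrow> bool" where
  "projective_module s \<longleftrightarrow>
     (\<exists>(i :: 'm \<Rightarrow> ('m \<Rightarrow>\<^sub>0 'a)) p.
        module_hom s free_scale i \<and> module_hom free_scale s p \<and> p \<circ> i = id)"

definition direct_summand :: "('a::idom \<Rightarrow> 'm::ab_group_add \<Rightarrow> 'm) \<Rightarrow> 'm set \<Rightarrow> bool" where
  "direct_summand s N \<longleftrightarrow>
     Modules.module.subspace s N \<and>
     (\<exists>N'. Modules.module.subspace s N' \<and> N \<inter> N' = {0} \<and> {x + y | x y. x \<in> N \<and> y \<in> N'} = UNIV)"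

definition internal_direct_sum :: "'m::ab_group_add set set \<Rightarrow> bool" where
  "internal_direct_sum F \<longleftrightarrow> (\<forall>x. \<exists>!f. f \<in> (\<Pi>\<^sub>E I\<in>F. I) \<and> x = (\<Sum>I\<in>F. f I))"


section \<open>Rank\<close>

text \<open>
  For a submodule \<open>N\<close>, the tensor product of \<open>N\<close> with the fraction field is the free abelian
  group on pairs \<open>(x, k)\<close> modulo the bilinearity relations.
\<close>

definition tensor_relations ::
  "('a::idom \<Rightarrow> 'm::ab_group_add \<Rightarrow> 'm) \<Rightarrow> 'm set \<Rightarrow> (('m \<times> 'a fract) \<Rightarrow>\<^sub>0 int) set" where
  "tensor_relations s N =
     {frag_of (x + y, k) - frag_of (x, k) - frag_of (y, k) | x y k. x \<in> N \<and> y \<in> N} \<union>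
     {frag_of (x, k + l) - frag_of (x, k) - frag_of (x, l) | x k l. x \<in> N} \<union>
     {frag_of (s a x, k) - frag_of (x, fract_scale a k) | a x k. x \<in> N}"

definition tensor_relation_subgroup ::
  "('a::idom \<Rightarrow> 'm::ab_group_add \<Rightarrow> 'm) \<Rightarrow> 'm set \<Rightarrow> (('m \<times> 'a fract) \<Rightarrow>\<^sub>0 int) set" where
  "tensor_relation_subgroup s N = generate (free_Abelian_group (N \<times> UNIV)) (tensor_relations s N)"

definition tensor_group ::
  "('a::idom \<Rightarrow> 'm::ab_group_add \<Rightarrow> 'm) \<Rightarrow> 'm set \<Rightarrow> (('m \<times> 'a fract) \<Rightarrow>\<^sub>0 int) set monoid" where
  "tensor_group s N = free_Abelian_group (N \<times> UNIV) Mod tensor_relation_subgroup s N"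

text \<open>
  The scalar \<open>c\<close> sends the class of \<open>(x, k)\<close> to that of \<open>(x, c * k)\<close>. The ring fields
  \<open>mult\<close> and \<open>one\<close> of the module record play no role.
\<close>

definition tensor_fract ::
  "('a::idom \<Rightarrow> 'm::ab_group_add \<Rightarrow> 'm) \<Rightarrow> 'm set \<Rightarrow>
     ('a fract, (('m \<times> 'a fract) \<Rightarrow>\<^sub>0 int) set) module" where
  "tensor_fract s N =
     \<lparr>carrier = carrier (tensor_group s N),
      monoid.mult = undefined,
      one = undefined,
      ring.zero = \<one>\<^bsub>tensor_group s N\<^esub>,
      add = (\<lambda>A B. A \<otimes>\<^bsub>tensor_group s N\<^esub> B),
      module.smult = (\<lambda>c A. \<Union>z\<in>A. tensor_relation_subgroup s N #>\<^bsub>free_Abelian_group (N \<times> UNIV)\<^esub>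
                 frag_extend (\<lambda>(x, k). frag_of (x, c * k)) z)\<rparr>"

definition module_rank :: "('a::idom \<Rightarrow> 'm::ab_group_add \<Rightarrow> 'm) \<Rightarrow> 'm set \<Rightarrow> nat" where
  "module_rank s N = vectorspace.dim (class_ring :: 'a fract ring) (tensor_fract s N)"


section \<open>Reduced homology of the order complex of a poset\<close>

text \<open>
  A simplex is a finite chain, oriented by the order and represented by the strictly
  increasing list of its vertices.
\<close>

definition order_simplices :: "'p::order set \<Rightarrow> nat \<Rightarrow> 'p list set" where
  "order_simplices P p = {xs. length xs = Suc p \<and> set xs \<subseteq> P \<and> sorted_wrt (<) xs}"

text \<open>
  On 0-simplices the boundary is the augmentation, its target being the free group on the
  empty list; hence the homology below is reduced.
\<close>

definition order_boundary :: "('p list \<Rightarrow>\<^sub>0 int) \<Rightarrow> ('p list \<Rightarrow>\<^sub>0 int)" where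
  "order_boundary =
     frag_extend (\<lambda>xs. \<Sum>i<length xs. frag_cmul ((-1) ^ i) (frag_of (take i xs @ drop (Suc i) xs)))"

definition order_cycles :: "'p::order set \<Rightarrow> nat \<Rightarrow> ('p list \<Rightarrow>\<^sub>0 int) set" where
  "order_cycles P p = {c \<in> carrier (free_Abelian_group (order_simplices P p)). order_boundary c = 0}"

definition order_boundaries :: "'p::order set \<Rightarrow> nat \<Rightarrow> ('p list \<Rightarrow>\<^sub>0 int) set" where
  "order_boundaries P p = order_boundary ` carrier (free_Abelian_group (order_simplices P (Suc p)))"

definition order_cycle_group :: "'p::order set \<Rightarrow> nat \<Rightarrow> ('p list \<Rightarrow>\<^sub>0 int) monoid" where
  "order_cycle_group P p =
     subgroup_generated (free_Abelian_group (order_simplices P p)) (order_cycles P p)"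

definition order_reduced_homology :: "'p::order set \<Rightarrow> nat \<Rightarrow> ('p list \<Rightarrow>\<^sub>0 int) set monoid" where
  "order_reduced_homology P p = order_cycle_group P p Mod order_boundaries P p"

definition order_homology_class ::
  "'p::order set \<Rightarrow> nat \<Rightarrow> ('p list \<Rightarrow>\<^sub>0 int) \<Rightarrow> ('p list \<Rightarrow>\<^sub>0 int) set" where
  "order_homology_class P p c = order_boundaries P p #>\<^bsub>order_cycle_group P p\<^esub> c"


section \<open>The Steinberg module and integral apartment classes\<close>

definition summand_poset :: "('a::idom \<Rightarrow> 'm::ab_group_add \<Rightarrow> 'm) \<Rightarrow> 'm set set" where
  "summand_poset s = {N. direct_summand s N \<and> N \<noteq> {0} \<and> N \<noteq> UNIV}"

definition steinberg ::
  "('a::idom \<Rightarrow> 'm::ab_group_add \<Rightarrow> 'm) \<Rightarrow> ('m set list \<Rightarrow>\<^sub>0 int) set monoid" where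
  "steinberg s = order_reduced_homology (summand_poset s) (module_rank s UNIV - 2)"

definition integral_frame :: "('a::idom \<Rightarrow> 'm::ab_group_add \<Rightarrow> 'm) \<Rightarrow> 'm set set \<Rightarrow> bool" where
  "integral_frame s F \<longleftrightarrow>
     finite F \<and> card F = module_rank s UNIV \<and>
     (\<forall>I\<in>F. direct_summand s I \<and> module_rank s I = 1) \<and>
     internal_direct_sum F"

text \<open>With 0-based indices, the \<open>k\<close>-th vertex is \<open>I\<^bsub>\<sigma>(0)\<^esub> + \<dots> + I\<^bsub>\<sigma>(k)\<^esub>\<close>, for \<open>k = 0, \<dots>, n - 2\<close>.\<close>

definition apartment_simplex ::
  "('a::idom \<Rightarrow> 'm::ab_group_add \<Rightarrow> 'm) \<Rightarrow> 'm set list \<Rightarrow> (nat \<Rightarrow> nat) \<Rightarrow> 'm set list" where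
  "apartment_simplex s Is \<sigma> =
     map (\<lambda>k. Modules.module.span s (\<Union>j\<le>k. Is ! \<sigma> j)) [0..<length Is - 1]"

definition apartment_class ::
  "('a::idom \<Rightarrow> 'm::ab_group_add \<Rightarrow> 'm) \<Rightarrow> 'm set list \<Rightarrow> ('m set list \<Rightarrow>\<^sub>0 int) set" where
  "apartment_class s Is =
     order_homology_class (summand_poset s) (module_rank s UNIV - 2)
       (\<Sum>\<sigma> | \<sigma> permutes {..<length Is}. frag_cmul (sign \<sigma>) (frag_of (apartment_simplex s Is \<sigma>)))"

text \<open>The list \<open>Is\<close> runs over all orderings of all frames, so both signs of each class occur.\<close>

definition integral_apartment_classes ::
  "('a::idom \<Rightarrow> 'm::ab_group_add \<Rightarrow> 'm) \<Rightarrow> ('m set list \<Rightarrow>\<^sub>0 int) set set" where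
  "integral_apartment_classes s =
     {apartment_class s Is | Is. distinct Is \<and> integral_frame s (set Is)}"

end

theory Submission
  imports Defs
begin

text \<open>
  There are no chains of \<open>n\<close> proper nonzero summands, so \<open>St(M)\<close> is the group of \<open>(n - 2)\<close>-cycles, and any
  function on flags defines a functional on it. Write \<open>M = A\<^sub>0 \<oplus> \<dots> \<oplus> A\<^bsub>n-1\<^esub>\<close> with ideals \<open>A\<^sub>i\<close> and let
  \<open>F\<^sub>k = A\<^sub>0 \<oplus> \<dots> \<oplus> A\<^bsub>k-1\<^esub>\<close>. Let \<open>\<phi>\<close> be the functional that counts the flags \<open>V\<^sub>1 \<subset> F\<^sub>2 \<subset> \<dots> \<subset> F\<^bsub>n-1\<^esub>\<close> for which
  \<open>V\<^sub>1\<close> is isomorphic to \<open>A\<^sub>0\<close> or \<open>A\<^sub>1\<close>.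

  If \<open>I\<^sub>1, \<dots>, I\<^sub>n\<close> is an integral frame and \<open>I\<^bsub>\<sigma>(1)\<^esub> \<oplus> I\<^bsub>\<sigma>(2)\<^esub> = F\<^sub>2\<close>, comparing determinants gives
  \<open>I\<^bsub>\<sigma>(1)\<^esub> I\<^bsub>\<sigma>(2)\<^esub> \<cong> A\<^sub>0 A\<^sub>1\<close>; so \<open>I\<^bsub>\<sigma>(1)\<^esub>\<close> is isomorphic to \<open>A\<^sub>0\<close> or \<open>A\<^sub>1\<close> iff \<open>I\<^bsub>\<sigma>(2)\<^esub>\<close> is, and
  exchanging the two cancels the terms of \<open>\<phi>\<close> on the apartment class in pairs.

  On the other hand, for every ideal class there is \<open>t\<close> such that \<open>D = A\<^sub>0 + t A\<^sub>1\<close> belongs to it. The map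
  \<open>(x, y) \<mapsto> x + t y\<close> from \<open>F\<^sub>2\<close> onto \<open>D\<close> splits, so \<open>F\<^sub>2\<close> has a summand \<open>L \<cong> D\<close>. The (non-integral) apartment
  spanned by \<open>A\<^sub>0, L, A\<^sub>2, \<dots>, A\<^bsub>n-1\<^esub>\<close> is a cycle on which \<open>\<phi>\<close> is \<open>1\<close> as soon as \<open>D\<close> is isomorphic to neither
  \<open>A\<^sub>0\<close> nor \<open>A\<^sub>1\<close>. Such a \<open>D\<close> exists if there are three classes; if there are only two, the
  decomposition of \<open>M\<close> can be chosen with \<open>A\<^sub>0 \<cong> A\<^sub>1\<close>, by the pigeonhole principle if \<open>n \<ge> 3\<close> and because
  \<open>M\<close> is free if \<open>n = 2\<close>.
\<close>

section \<open>Submodules of the fraction field\<close>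

text \<open>Replacing a line of F_2 by a complement acts on ideal classes by the involution c
  \<mapsto> [A_0 A_1] / c, and {[A_0], [A_1]} is one of its orbits. This is why \<phi> counts the
  two classes together and why D must lie outside both. In the excluded case the orbit is the whole
  class group: there are two classes, n = 2, and A_0 A_1 is not principal. The rest of the flag only
  singles out the summand F_2, so all the arithmetic takes place in rank 2.

  The lines of an integral frame are constrained because two of them add up to all of F_2. In
  contrast, A_0 + L is a proper submodule of F_2, as otherwise D would be isomorphic to A_1. The
  vertices of that apartment are therefore not sums of lines but summands, cut out by the vanishing
  of coordinates.

  Modules are handled through functionals into the fraction field: a line becomes a submodule of
  that field, isomorphism of lines becomes proportionality, and the determinant becomes the module
  of 2 x 2 minors.\<close>

interpretation fract: Modules.module "fract_scale :: 'a::idom \<Rightarrow> 'a fract \<Rightarrow> 'a fract"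
  by unfold_locales (simp_all add: fract_scale_def algebra_simps)

abbreviation fract_ring :: "'a::idom fract set" (\<open>\<O>\<close>) where
  "\<O> \<equiv> range to_fract"

text \<open>This is the multiplication of \<open>fractional_ideal_group\<close>, taken for arbitrary
  subsets of the fraction field. Being a span, it is compared with submodules by testing products
  only.\<close>

definition ideal_prod :: "'a::idom fract set \<Rightarrow> 'a fract set \<Rightarrow> 'a fract set" (infixl \<open>\<star>\<close> 70) where
  "A \<star> B = fract.span {x * y | x y. x \<in> A \<and> y \<in> B}"

lemma fract_subspace_mult:
  assumes "fract.subspace A" "x \<in> A" "c \<in> \<O>" shows "c * x \<in> A"
  using fract.subspace_scale[OF assms(1,2)] assms(3) by (auto simp: fract_scale_def)

lemma fract_subspaceI:
  assumes "0 \<in> A" "\<And>x y. x \<in> A \<Longrightarrow> y \<in> A \<Longrightarrow> x + y \<in> A"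
    and "\<And>c x. x \<in> A \<Longrightarrow> c \<in> \<O> \<Longrightarrow> c * x \<in> A"
  shows "fract.subspace A"
  using assms by (auto simp: fract.subspace_def fract_scale_def)

lemma fract_ring_0: "0 \<in> \<O>" and fract_ring_1: "1 \<in> \<O>"
  by (metis rangeI to_fract_0, metis rangeI to_fract_1)

lemma fract_ring_add: "x \<in> \<O> \<Longrightarrow> y \<in> \<O> \<Longrightarrow> x + y \<in> \<O>"
  by (auto simp flip: to_fract_add)

lemma fract_ring_mult: "x \<in> \<O> \<Longrightarrow> y \<in> \<O> \<Longrightarrow> x * y \<in> \<O>"
  by (auto simp flip: to_fract_mult)

lemma subspace_fract_ring: "fract.subspace \<O>"
  by (intro fract_subspaceI fract_ring_0 fract_ring_add fract_ring_mult)

lemma fract_quotient: obtains a b where "x = to_fract a / to_fract b" "b \<noteq> 0"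
  by (cases x) (auto simp: Fract_conv_to_fract)

lemma ideal_prod_memI: "x \<in> A \<Longrightarrow> y \<in> B \<Longrightarrow> x * y \<in> A \<star> B"
  unfolding ideal_prod_def by (intro fract.span_base) auto

lemma ideal_prod_subset:
  assumes "fract.subspace C" "\<And>x y. x \<in> A \<Longrightarrow> y \<in> B \<Longrightarrow> x * y \<in> C"
  shows "A \<star> B \<subseteq> C"
  unfolding ideal_prod_def by (rule fract.span_minimal) (use assms in auto)

lemma subspace_ideal_prod: "fract.subspace (A \<star> B)"
  unfolding ideal_prod_def by (rule fract.subspace_span)

lemma ideal_prod_commute: "A \<star> B = B \<star> A"
  by (intro equalityI ideal_prod_subset subspace_ideal_prod)
     (metis ideal_prod_memI mult.commute)+

lemma ideal_prod_mono: "A \<subseteq> A' \<Longrightarrow> B \<subseteq> B' \<Longrightarrow> A \<star> B \<subseteq> A' \<star> B'"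
  by (intro ideal_prod_subset subspace_ideal_prod) (auto intro: ideal_prod_memI)

lemma subspace_vimage_mult:
  assumes "fract.subspace A" shows "fract.subspace {x. x * c \<in> A}"
  using assms
  by (intro fract_subspaceI) (auto simp: fract.subspace_0 distrib_right fract.subspace_add mult.assoc
      intro: fract_subspace_mult)

lemma subspace_image_mult:
  assumes "fract.subspace A" shows "fract.subspace ((*) c ` A)"
proof (rule fract_subspaceI)
  show "0 \<in> (*) c ` A"
    using fract.subspace_0[OF assms] by (intro image_eqI[of _ _ 0]) auto
  show "x + y \<in> (*) c ` A" if "x \<in> (*) c ` A" "y \<in> (*) c ` A" for x y
    using that fract.subspace_add[OF assms] by (auto simp flip: distrib_left)
  show "d * x \<in> (*) c ` A" if xd: "x \<in> (*) c ` A" "d \<in> \<O>" for d x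
  proof -
    obtain z where "z \<in> A" "x = c * z" using xd by auto
    then show ?thesis
      using fract_subspace_mult[OF assms _ xd(2)] by (intro image_eqI[of _ _ "d * z"]) auto
  qed
qed

text \<open>For a fixed third factor c, the x for which x c lies in the target form a submodule, so
  that x need only run through products.\<close>

lemma ideal_prod_assoc_subset: "A \<star> B \<star> C \<subseteq> A \<star> (B \<star> C)"
proof (rule ideal_prod_subset[OF subspace_ideal_prod])
  fix x c assume "x \<in> A \<star> B" "c \<in> C"
  have "A \<star> B \<subseteq> {x. x * c \<in> A \<star> (B \<star> C)}"
    using \<open>c \<in> C\<close>
    by (intro ideal_prod_subset subspace_vimage_mult subspace_ideal_prod)
       (auto simp: mult.assoc intro: ideal_prod_memI)
  then show "x * c \<in> A \<star> (B \<star> C)" using \<open>x \<in> A \<star> B\<close> by auto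
qed

text \<open>By commutativity, the missing inclusion is the known one for the factors in opposite
  order.\<close>

lemma ideal_prod_assoc: "A \<star> B \<star> C = A \<star> (B \<star> C)"
proof
  have "A \<star> (B \<star> C) = C \<star> B \<star> A" by (simp add: ideal_prod_commute)
  also have "\<dots> \<subseteq> C \<star> (B \<star> A)" by (rule ideal_prod_assoc_subset)
  also have "\<dots> = A \<star> B \<star> C" by (simp add: ideal_prod_commute)
  finally show "A \<star> (B \<star> C) \<subseteq> A \<star> B \<star> C" .
qed (rule ideal_prod_assoc_subset)

lemma fract_ring_ideal_prod: assumes "fract.subspace A" shows "\<O> \<star> A = A"
proof
  show "\<O> \<star> A \<subseteq> A" by (intro ideal_prod_subset assms fract_subspace_mult)
  show "A \<subseteq> \<O> \<star> A" using ideal_prod_memI[OF fract_ring_1, of _ A] by auto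
qed

lemma image_mult_ideal_prod: "((*) c ` A) \<star> B = (*) c ` (A \<star> B)"
proof
  show "((*) c ` A) \<star> B \<subseteq> (*) c ` (A \<star> B)"
    by (intro ideal_prod_subset subspace_image_mult subspace_ideal_prod)
       (auto simp: mult.assoc intro: ideal_prod_memI)
  have "A \<star> B \<subseteq> {x. x * c \<in> ((*) c ` A) \<star> B}"
  proof (intro ideal_prod_subset subspace_vimage_mult subspace_ideal_prod)
    fix x y assume "x \<in> A" "y \<in> B"
    then have "(c * x) * y \<in> ((*) c ` A) \<star> B" by (intro ideal_prod_memI) auto
    then show "x * y \<in> {x. x * c \<in> ((*) c ` A) \<star> B}" by (simp add: mult_ac)
  qed
  then show "(*) c ` (A \<star> B) \<subseteq> ((*) c ` A) \<star> B" by (auto simp: mult.commute)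
qed

text \<open>Invertibility serves two purposes later on: cancelling an ideal in a product, and
  splitting a surjection onto it.\<close>

definition invertible_ideal :: "'a::idom fract set \<Rightarrow> bool" where
  "invertible_ideal A \<longleftrightarrow> fract.subspace A \<and> (\<exists>B. fract.subspace B \<and> A \<star> B = \<O>)"

lemma ideal_prod_cancel:
  assumes "fract.subspace C" "A \<star> B = \<O>"
  shows "C \<star> A \<star> B = C" "C \<star> B \<star> A = C"
proof -
  have "C \<star> A \<star> B = C \<star> (A \<star> B)" by (rule ideal_prod_assoc)
  also have "\<dots> = \<O> \<star> C" unfolding assms(2) by (rule ideal_prod_commute)
  finally show "C \<star> A \<star> B = C" using fract_ring_ideal_prod[OF assms(1)] by simp
  have "C \<star> B \<star> A = C \<star> (B \<star> A)" by (rule ideal_prod_assoc)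
  also have "\<dots> = C \<star> (A \<star> B)" by (simp only: ideal_prod_commute)
  also have "\<dots> = \<O> \<star> C" unfolding assms(2) by (rule ideal_prod_commute)
  finally show "C \<star> B \<star> A = C" using fract_ring_ideal_prod[OF assms(1)] by simp
qed

lemma sums_memI: "x \<in> A \<Longrightarrow> y \<in> B \<Longrightarrow> z = x + y \<Longrightarrow> z \<in> {x + y | x y. x \<in> A \<and> y \<in> B}"
  by blast

lemma subset_sums:
  fixes A B :: "'b::monoid_add set"
  shows "0 \<in> B \<Longrightarrow> A \<subseteq> {x + y | x y. x \<in> A \<and> y \<in> B}"
    and "0 \<in> A \<Longrightarrow> B \<subseteq> {x + y | x y. x \<in> A \<and> y \<in> B}"
  using sums_memI[of _ A 0 B] sums_memI[of 0 A _ B] by (simp_all add: subset_iff)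

lemma fract_subspace_sums:
  assumes A: "fract.subspace A" and B: "fract.subspace B"
  shows "fract.subspace {x + y | x y. x \<in> A \<and> y \<in> B}"
proof (rule fract_subspaceI)
  show "0 \<in> {x + y | x y. x \<in> A \<and> y \<in> B}"
    by (rule sums_memI[OF fract.subspace_0[OF A] fract.subspace_0[OF B]]) simp
  show "u + v \<in> {x + y | x y. x \<in> A \<and> y \<in> B}"
    if uv: "u \<in> {x + y | x y. x \<in> A \<and> y \<in> B}" "v \<in> {x + y | x y. x \<in> A \<and> y \<in> B}" for u v
  proof -
    obtain x y x' y' where "u = x + y" "v = x' + y'" "x \<in> A" "y \<in> B" "x' \<in> A" "y' \<in> B"
      using uv by auto
    then have "u + v = (x + x') + (y + y')" "x + x' \<in> A" "y + y' \<in> B"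
      using fract.subspace_add[OF A] fract.subspace_add[OF B] by auto
    then show ?thesis by blast
  qed
  show "c * u \<in> {x + y | x y. x \<in> A \<and> y \<in> B}"
    if uc: "u \<in> {x + y | x y. x \<in> A \<and> y \<in> B}" "c \<in> \<O>" for c u
  proof -
    obtain x y where "u = x + y" "x \<in> A" "y \<in> B" using uc by auto
    then have "c * u = c * x + c * y" "c * x \<in> A" "c * y \<in> B"
      using fract_subspace_mult[OF A _ uc(2)] fract_subspace_mult[OF B _ uc(2)]
      by (auto simp: distrib_left)
    then show ?thesis by blast
  qed
qed

section \<open>Ideals of Dedekind domains\<close>

lemma ideal_vimage_to_fract:
  assumes "fract.subspace A"
  shows "ideal (to_fract -` A) (class_ring :: 'a::idom ring)"
proof (rule idealI)
  show "ring (class_ring :: 'a ring)" by (rule class_ring.ring_axioms)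
  have neg: "- x \<in> A" if "x \<in> A" for x using fract.subspace_neg[OF assms that] .
  have "inv\<^bsub>add_monoid (class_ring :: 'a ring)\<^esub> x = - x" for x
    using fun_cong[OF class_ring_simps(8), of x] by (simp add: a_inv_def)
  then show "subgroup (to_fract -` A) (add_monoid (class_ring :: 'a ring))"
    by (intro subgroup.intro)
       (use neg in \<open>auto simp: fract.subspace_0[OF assms] fract.subspace_add[OF assms]\<close>)
qed (use fract_subspace_mult[OF assms] in \<open>auto simp: mult.commute\<close>)

text \<open>The ascending chain condition, carried over from ideals of \<open>class_ring\<close> to
  submodules of the fraction field. As the members lie in \<O>, nothing is lost by passing to
  preimages under \<open>to_fract\<close>.\<close>

lemma noetherian_maximal:
  fixes C :: "'a::idom fract set set"
  assumes "noetherian_domain (class_ring :: 'a ring)" and "C \<noteq> {}"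
    and sub: "\<And>A. A \<in> C \<Longrightarrow> fract.subspace A" and int: "\<And>A. A \<in> C \<Longrightarrow> A \<subseteq> \<O>"
  shows "\<exists>A\<in>C. \<forall>B\<in>C. A \<subseteq> B \<longrightarrow> B = A"
proof (rule subset_Zorn)
  interpret N: noetherian_domain "class_ring :: 'a ring" by fact
  fix D assume D: "subset.chain C D"
  show "\<exists>U\<in>C. \<forall>X\<in>D. X \<subseteq> U"
  proof (cases "D = {}")
    case False
    let ?D = "(\<lambda>A. to_fract -` A) ` D"
    \<comment> \<open>In a noetherian ring the union of a nonempty chain of ideals is a member of
      the chain. This member is the upper bound that Zorn's lemma asks for.\<close>
    have "\<Union> ?D \<in> ?D"
    proof (rule N.ideal_chain_is_trivial)
      show "?D \<noteq> {}" using False by auto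
      show "subset.chain {I. ideal I (class_ring :: 'a ring)} ?D"
        unfolding pred_on.chain_def
      proof (intro conjI ballI)
        show "?D \<subseteq> {I. ideal I (class_ring :: 'a ring)}"
          using D sub ideal_vimage_to_fract unfolding pred_on.chain_def by auto
        fix X Y assume "X \<in> ?D" "Y \<in> ?D"
        then obtain X' Y' where XY: "X' \<in> D" "Y' \<in> D" "X = to_fract -` X'" "Y = to_fract -` Y'"
          by auto
        then have "X' \<subseteq> Y' \<or> Y' \<subseteq> X'" using D unfolding pred_on.chain_def by blast
        then show "(\<subset>)\<^sup>=\<^sup>= X Y \<or> (\<subset>)\<^sup>=\<^sup>= Y X" unfolding XY by auto
      qed
    qed
    then obtain U where U: "U \<in> D" "\<Union> ?D = to_fract -` U" by auto
    have "X \<subseteq> U" if "X \<in> D" for X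
    proof
      fix y assume "y \<in> X"
      have "X \<subseteq> \<O>" using D int that unfolding pred_on.chain_def by auto
      then obtain a where "y = to_fract a" using \<open>y \<in> X\<close> by auto
      then have "a \<in> \<Union> ?D" using \<open>y \<in> X\<close> that by auto
      then show "y \<in> U" using U \<open>y = to_fract a\<close> by auto
    qed
    moreover have "U \<in> C" using U D unfolding pred_on.chain_def by auto
    ultimately show ?thesis by blast
  qed (use assms in auto)
qed

lemma noetherian_ideal_induct:
  fixes A :: "'a::idom fract set"
  assumes noeth: "noetherian_domain (class_ring :: 'a ring)" and A: "fract.subspace A" "A \<subseteq> \<O>"
    and step: "\<And>A. fract.subspace A \<Longrightarrow> A \<subseteq> \<O> \<Longrightarrow>
      (\<And>B. fract.subspace B \<Longrightarrow> B \<subseteq> \<O> \<Longrightarrow> A \<subset> B \<Longrightarrow> P B) \<Longrightarrow> P A"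
  shows "P A"
proof (rule ccontr)
  assume "\<not> P A"
  define C where "C = {A. fract.subspace A \<and> A \<subseteq> \<O> \<and> \<not> P A}"
  have "\<exists>A\<in>C. \<forall>B\<in>C. A \<subseteq> B \<longrightarrow> B = A"
    by (rule noetherian_maximal[OF noeth]) (use \<open>\<not> P A\<close> A in \<open>auto simp: C_def\<close>)
  then obtain A' where "A' \<in> C" "\<And>B. B \<in> C \<Longrightarrow> A' \<subseteq> B \<Longrightarrow> B = A'" by auto
  then show False using step[of A'] unfolding C_def by blast
qed

text \<open>The modules J n = a (\<O> + \<O> x + ... + \<O> x^n) form an ascending chain of ideals,
  which stops. Then a x^(n+1) lies in J n, and cancelling a leaves a monic equation for x.\<close>

lemma almost_integral_imp_fract_ring:
  fixes x :: "'a::idom fract"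
  assumes noeth: "noetherian_domain (class_ring :: 'a ring)"
    and closed: "integrally_closed_domain TYPE('a)"
    and a: "a \<noteq> 0" "\<And>n. a * x ^ n \<in> \<O>"
  shows "x \<in> \<O>"
proof -
  define J where "J n = {a * poly (fract_poly q) x | q. degree q \<le> n}" for n
  have J_sub: "fract.subspace (J n)" for n
  proof (rule fract_subspaceI)
    show "0 \<in> J n" unfolding J_def by (auto intro!: exI[of _ 0])
    show "y + z \<in> J n" if "y \<in> J n" "z \<in> J n" for y z
    proof -
      obtain p q where "y = a * poly (fract_poly p) x" "degree p \<le> n"
        "z = a * poly (fract_poly q) x" "degree q \<le> n" using \<open>y \<in> J n\<close> \<open>z \<in> J n\<close> by (auto simp: J_def)
      then show ?thesis unfolding J_def
        by (auto intro!: exI[of _ "p + q"] degree_add_le simp: algebra_simps)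
    qed
    show "c * y \<in> J n" if yc: "y \<in> J n" "c \<in> \<O>" for c y
    proof -
      obtain p r where "y = a * poly (fract_poly p) x" "degree p \<le> n" "c = to_fract r"
        using yc by (auto simp: J_def)
      then show ?thesis unfolding J_def
        by (auto intro!: exI[of _ "Polynomial.smult r p"] order.trans[OF degree_smult_le] simp: algebra_simps)
    qed
  qed
  have J_int: "J n \<subseteq> \<O>" for n
  proof
    fix y assume "y \<in> J n"
    then obtain q where "y = a * poly (fract_poly q) x" by (auto simp: J_def)
    then have "y = (\<Sum>i\<le>degree (fract_poly q). poly.coeff (fract_poly q) i * (a * x ^ i))"
      by (simp add: poly_altdef sum_distrib_left mult_ac)
    also have "\<dots> \<in> \<O>"
      by (intro fract.subspace_sum[OF subspace_fract_ring] fract_ring_mult a)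
         (simp add: coeff_map_poly)
    finally show "y \<in> \<O>" .
  qed
  have "\<exists>A\<in>range J. \<forall>B\<in>range J. A \<subseteq> B \<longrightarrow> B = A"
    by (rule noetherian_maximal[OF noeth]) (use J_sub J_int in auto)
  then obtain n where n: "\<And>m. J n \<subseteq> J m \<Longrightarrow> J m = J n" by auto
  have "J n \<subseteq> J (Suc n)" unfolding J_def by fastforce
  then have "J (Suc n) = J n" by (rule n)
  moreover have "a * x ^ Suc n \<in> J (Suc n)" unfolding J_def
    by (auto intro!: exI[of _ "Polynomial.monom 1 (Suc n)"] simp: degree_monom_eq map_poly_monom poly_monom)
  ultimately obtain q where q: "a * x ^ Suc n = a * poly (fract_poly q) x" "degree q \<le> n"
    by (auto simp: J_def)
  define p where "p = Polynomial.monom 1 (Suc n) - q"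
  have "poly (fract_poly p) x = 0"
    using q a by (simp add: p_def map_poly_monom poly_monom)
  moreover have "lead_coeff p = 1"
  proof -
    have "degree p = Suc n" unfolding p_def
      using q(2) by (subst diff_conv_add_uminus, subst degree_add_eq_left) (auto simp: degree_monom_eq)
    then show ?thesis using q(2) by (simp add: p_def coeff_eq_0)
  qed
  ultimately show ?thesis using closed unfolding integrally_closed_domain_def by blast
qed

text \<open>Phrased for submodules of the fraction field, because that is where inverses live. The
  zero ideal qualifies when the domain is a field.\<close>

definition maximal_ideal :: "'a::idom fract set \<Rightarrow> bool" where
  "maximal_ideal P \<longleftrightarrow> fract.subspace P \<and> P \<subset> \<O> \<and>
     (\<forall>J. fract.subspace J \<longrightarrow> P \<subseteq> J \<longrightarrow> J \<subseteq> \<O> \<longrightarrow> J = P \<or> J = \<O>)"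

lemma subspace_nonzero:
  assumes "fract.subspace A" "A \<noteq> {0}" obtains a where "a \<in> A" "a \<noteq> 0"
  using assms fract.subspace_0 by blast

lemma fract_ring_mult_subset:
  assumes "fract.subspace A" "a \<in> A" shows "(*) a ` \<O> \<subseteq> A"
  using fract_subspace_mult[OF assms] by (auto simp: mult.commute)

lemma eq_fract_ringI:
  assumes "fract.subspace A" "A \<subseteq> \<O>" "1 \<in> A" shows "A = \<O>"
  using fract_subspace_mult[OF assms(1,3)] assms(2) by auto

text \<open>If s is not in P, then P + s \<O> is all of \<O>, and multiplying 1 = p + s t by r shows
  that r is in P.\<close>

lemma maximal_ideal_prime:
  assumes P: "maximal_ideal P" and rs: "r \<in> \<O>" "s \<in> \<O>" "r * s \<in> P" "s \<notin> P"
  shows "r \<in> P"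
proof -
  have sub: "fract.subspace P" and proper: "P \<subset> \<O>"
    and max: "\<And>J. fract.subspace J \<Longrightarrow> P \<subseteq> J \<Longrightarrow> J \<subseteq> \<O> \<Longrightarrow> J = P \<or> J = \<O>"
    using P unfolding maximal_ideal_def by auto
  define J where "J = {y + z | y z. y \<in> P \<and> z \<in> (*) s ` \<O>}"
  have "0 \<in> (*) s ` \<O>" using fract_ring_0 by (intro image_eqI[of _ _ 0]) auto
  then have "P \<subseteq> J" unfolding J_def by (rule subset_sums)
  have "s \<in> (*) s ` \<O>" using fract_ring_1 by (intro image_eqI[of _ _ 1]) auto
  then have "s \<in> J" unfolding J_def using subset_sums(2)[OF fract.subspace_0[OF sub]] by blast
  have "fract.subspace J" unfolding J_def
    by (intro fract_subspace_sums sub subspace_image_mult subspace_fract_ring)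
  moreover have "J \<subseteq> \<O>" unfolding J_def using proper rs(2) by (auto intro!: fract_ring_add fract_ring_mult)
  ultimately have "J = \<O>" using max[of J] \<open>P \<subseteq> J\<close> \<open>s \<in> J\<close> rs(4) by auto
  then have "1 \<in> J" using fract_ring_1 by auto
  then obtain p t where pt: "1 = p + s * t" "p \<in> P" "t \<in> \<O>" unfolding J_def by auto
  have "r = r * p + t * (r * s)" using arg_cong[OF pt(1), of "(*) r"] by (simp add: algebra_simps)
  also have "\<dots> \<in> P"
    by (intro fract.subspace_add[OF sub] fract_subspace_mult[OF sub] pt rs)
  finally show ?thesis .
qed

lemma invertible_ideal_nonzero: "invertible_ideal (A :: 'a::idom fract set) \<Longrightarrow> A \<noteq> {0}"
proof
  assume "invertible_ideal A" "A = {0}"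
  then obtain B :: "'a fract set" where "{0} \<star> B = \<O>" unfolding invertible_ideal_def by auto
  moreover have "{0} \<star> B \<subseteq> {0}" by (rule ideal_prod_subset) (auto simp: fract.subspace_single_0)
  ultimately show False using fract_ring_1 by auto
qed

section \<open>Inverses of ideals and generators modulo ideals in a Dedekind domain\<close>

context
  assumes dedekind: "dedekind_domain TYPE('a::idom)"
begin

lemma noetherian: "noetherian_domain (class_ring :: 'a ring)"
  using dedekind unfolding dedekind_domain_def by auto

text \<open>Here the maximality of nonzero primes enters, transported from the ring to its image in
  the fraction field.\<close>

lemma prime_ideal_maximal:
  fixes Q :: "'a fract set"
  assumes Q: "fract.subspace Q" "Q \<subset> \<O>" "Q \<noteq> {0}"
    and prime: "\<And>c d. c \<in> \<O> \<Longrightarrow> d \<in> \<O> \<Longrightarrow> c * d \<in> Q \<Longrightarrow> c \<in> Q \<or> d \<in> Q"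
  shows "maximal_ideal Q"
proof -
  let ?Q = "to_fract -` Q" and ?R = "class_ring :: 'a ring"
  have "primeideal ?Q ?R"
    by (rule primeidealI[OF ideal_vimage_to_fract[OF Q(1)] class_cring.cring_axioms])
       (use Q(2) prime in auto)
  moreover obtain q where "q \<in> Q" "q \<noteq> 0" using subspace_nonzero[OF Q(1,3)] .
  then have "?Q \<noteq> {0}" using Q(2) by force
  ultimately have max: "maximalideal ?Q ?R"
    using dedekind unfolding dedekind_domain_def by auto
  have "J = Q \<or> J = \<O>" if J: "fract.subspace J" "Q \<subseteq> J" "J \<subseteq> \<O>" for J
  proof -
    have "to_fract -` J = ?Q \<or> to_fract -` J = carrier ?R"
      using J by (intro maximalideal.I_maximal[OF max] ideal_vimage_to_fract) auto
    then have "to_fract ` (to_fract -` J) = to_fract ` ?Q \<or> to_fract ` (to_fract -` J) = \<O>" by auto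
    then show ?thesis using J Q(2) by (auto simp: image_vimage_eq)
  qed
  then show ?thesis using Q unfolding maximal_ideal_def by auto
qed

lemma exists_maximal_ideal:
  fixes A :: "'a fract set"
  assumes "fract.subspace A" "A \<subset> \<O>"
  obtains P where "maximal_ideal P" "A \<subseteq> P"
proof -
  define C where "C = {J. fract.subspace J \<and> A \<subseteq> J \<and> J \<subset> \<O>}"
  have "\<exists>P\<in>C. \<forall>B\<in>C. P \<subseteq> B \<longrightarrow> B = P"
    by (rule noetherian_maximal[OF noetherian]) (use assms in \<open>auto simp: C_def\<close>)
  then obtain P where "P \<in> C" "\<And>B. B \<in> C \<Longrightarrow> P \<subseteq> B \<Longrightarrow> B = P" by auto
  then show ?thesis by (intro that[of P]) (auto simp: C_def maximal_ideal_def)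
qed

text \<open>
  For a nonzero \<open>a \<in> P\<close>, a colon ideal \<open>(a) : b\<close> that is maximal among those contained in \<open>P\<close> is
  prime, hence equal to \<open>P\<close>.
\<close>

lemma maximal_ideal_multiplier:
  fixes P :: "'a fract set"
  assumes P: "maximal_ideal P" "P \<noteq> {0}"
  obtains x where "x \<notin> \<O>" "\<And>p. p \<in> P \<Longrightarrow> x * p \<in> \<O>"
proof -
  have sub: "fract.subspace P" and proper: "P \<subset> \<O>"
    using P unfolding maximal_ideal_def by auto
  obtain a where a: "a \<in> P" "a \<noteq> 0" using subspace_nonzero[OF sub P(2)] .
  have aO: "fract.subspace ((*) a ` \<O>)" by (intro subspace_image_mult subspace_fract_ring)
  define col where "col b = \<O> \<inter> {c. c * b \<in> (*) a ` \<O>}" for b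
  have col_sub: "fract.subspace (col b)" for b
    unfolding col_def by (intro fract.subspace_inter subspace_fract_ring subspace_vimage_mult aO)
  have a_col: "a \<in> col b" if "b \<in> \<O>" for b using that a proper unfolding col_def by auto
  have col_mono: "col b \<subseteq> col (b * c)" if "c \<in> \<O>" for b c
  proof
    fix z assume "z \<in> col b"
    then have "z \<in> \<O>" "c * (z * b) \<in> (*) a ` \<O>"
      using fract_subspace_mult[OF aO _ that] unfolding col_def by blast+
    then show "z \<in> col (b * c)" unfolding col_def by (simp add: mult_ac)
  qed
  define C where "C = {col b | b. b \<in> \<O> \<and> col b \<subseteq> P}"
  \<comment> \<open>The family is not empty: (a) : 1 is (a), which lies in P because a does.\<close>
  have "col 1 \<subseteq> P" unfolding col_def using fract_ring_mult_subset[OF sub a(1)] by auto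
  then have "C \<noteq> {}" unfolding C_def using fract_ring_1 by blast
  then have "\<exists>Q\<in>C. \<forall>B\<in>C. Q \<subseteq> B \<longrightarrow> B = Q"
  proof (rule noetherian_maximal[OF noetherian])
    fix J assume "J \<in> C"
    then obtain b where "J = col b" unfolding C_def by auto
    then show "fract.subspace J" "J \<subseteq> \<O>" using col_sub by (auto simp: col_def)
  qed
  then obtain Q where Q: "Q \<in> C" "\<And>B. B \<in> C \<Longrightarrow> Q \<subseteq> B \<Longrightarrow> B = Q" by auto
  then obtain b where b: "b \<in> \<O>" "col b \<subseteq> P" "Q = col b" unfolding C_def by auto
  have bmax: "col b' = col b" if "b' \<in> \<O>" "col b' \<subseteq> P" "col b \<subseteq> col b'" for b'
    using Q(2)[of "col b'"] that unfolding b(3) C_def by auto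
  have "maximal_ideal (col b)"
  proof (rule prime_ideal_maximal)
    show "fract.subspace (col b)" "col b \<subset> \<O>" "col b \<noteq> {0}"
      using col_sub b proper a_col[OF b(1)] a(2) by auto
    fix c d assume cd: "c \<in> \<O>" "d \<in> \<O>" "c * d \<in> col b"
    \<comment> \<open>If (a) : bc stays inside P, maximality makes it equal to (a) : b, and it
      contains d. Otherwise some s in (a) : bc lies outside P. Then (a) : bs is contained in P
      because P is prime, so it equals (a) : b by maximality, and it contains c.\<close>
    show "c \<in> col b \<or> d \<in> col b"
    proof (cases "col (b * c) \<subseteq> P")
      case True
      then have "col (b * c) = col b"
        by (intro bmax fract_ring_mult b cd col_mono)
      moreover have "d \<in> col (b * c)" using cd unfolding col_def by (auto simp: mult_ac)
      ultimately show ?thesis by auto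
    next
      case False
      then obtain s where s: "s \<in> col (b * c)" "s \<notin> P" by auto
      then have sO: "s \<in> \<O>" by (auto simp: col_def)
      have "col (b * s) \<subseteq> P"
      proof
        fix r assume r: "r \<in> col (b * s)"
        then have rO: "r \<in> \<O>" by (auto simp: col_def)
        have "r * s \<in> col b" using r fract_ring_mult[OF rO sO] unfolding col_def by (auto simp: mult_ac)
        then show "r \<in> P" using maximal_ideal_prime[OF P(1) rO sO] b(2) s(2) by auto
      qed
      then have "col (b * s) = col b" by (intro bmax fract_ring_mult b sO col_mono)
      moreover have "c \<in> col (b * s)" using s(1) cd unfolding col_def by (auto simp: mult_ac)
      ultimately show ?thesis by auto
    qed
  qed
  then have "col b = P" using b(2) sub proper unfolding maximal_ideal_def by blast
  \<comment> \<open>P = (a) : b says that b / a multiplies P into \<O>. If b / a itself were in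
    \<O>, the colon ideal would contain 1.\<close>
  show ?thesis
  proof (rule that[of "b / a"])
    show "b / a \<notin> \<O>"
    proof
      assume "b / a \<in> \<O>"
      then have "1 * b \<in> (*) a ` \<O>" using a(2) by (intro image_eqI[of _ _ "b / a"]) auto
      then have "1 \<in> P" using fract_ring_1 unfolding \<open>col b = P\<close>[symmetric] col_def by auto
      then show False using eq_fract_ringI[OF sub] proper by auto
    qed
    fix p assume "p \<in> P"
    then have "p * b \<in> (*) a ` \<O>" unfolding \<open>col b = P\<close>[symmetric] col_def by auto
    then obtain z where "p * b = a * z" "z \<in> \<O>" by auto
    then show "b / a * p \<in> \<O>" using a(2) by (metis mult.commute nonzero_mult_div_cancel_left times_divide_eq_left)
  qed
qed

text \<open>For a nonzero a in A all a x^n stay in A, so x is almost integral; this is where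
  integral closedness enters.\<close>

lemma fract_ring_if_stabilizes:
  fixes A :: "'a fract set"
  assumes A: "fract.subspace A" "A \<subseteq> \<O>" "A \<noteq> {0}" and x: "\<And>y. y \<in> A \<Longrightarrow> x * y \<in> A"
  shows "x \<in> \<O>"
proof -
  obtain a where a: "a \<in> A" "a \<noteq> 0" using subspace_nonzero[OF A(1,3)] .
  have "a * x ^ n \<in> A" for n
  proof (induction n)
    case (Suc n)
    then show ?case using x[of "a * x ^ n"] by (simp add: mult_ac)
  qed (use a in auto)
  then have "a * x ^ n \<in> \<O>" for n using A(2) by blast
  then show ?thesis
    using almost_integral_imp_fract_ring[OF noetherian _ a(2)] dedekind
    unfolding dedekind_domain_def by blast
qed

text \<open>Take U = \<O> + x \<O> with x outside \<O> multiplying P into \<O>. A nonzero ideal A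
  inside P cannot equal A U, since x would then stabilize A and be in \<O>. This strict growth makes
  P U all of \<O>, and it drives both noetherian inductions below.\<close>

lemma maximal_ideal_inverse:
  fixes P :: "'a fract set"
  assumes P: "maximal_ideal P" "P \<noteq> {0}"
  obtains U where "fract.subspace U" "P \<star> U = \<O>"
    "\<And>A. fract.subspace A \<Longrightarrow> A \<noteq> {0} \<Longrightarrow> A \<subseteq> P \<Longrightarrow> A \<subset> A \<star> U \<and> A \<star> U \<subseteq> \<O>"
proof -
  have sub: "fract.subspace P" and proper: "P \<subset> \<O>"
    and max: "\<And>J. fract.subspace J \<Longrightarrow> P \<subseteq> J \<Longrightarrow> J \<subseteq> \<O> \<Longrightarrow> J = P \<or> J = \<O>"
    using P unfolding maximal_ideal_def by auto
  obtain x where x: "x \<notin> \<O>" "\<And>p. p \<in> P \<Longrightarrow> x * p \<in> \<O>" using maximal_ideal_multiplier[OF P] by blast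
  define U where "U = {y + z | y z. y \<in> \<O> \<and> z \<in> (*) x ` \<O>}"
  have U: "fract.subspace U" unfolding U_def
    by (intro fract_subspace_sums subspace_image_mult subspace_fract_ring)
  have "0 \<in> (*) x ` \<O>" using fract_ring_0 by (intro image_eqI[of _ _ 0]) auto
  then have U1: "1 \<in> U" unfolding U_def using subset_sums(1) fract_ring_1 by blast
  have "x \<in> (*) x ` \<O>" using fract_ring_1 by (intro image_eqI[of _ _ 1]) auto
  then have Ux: "x \<in> U" unfolding U_def using subset_sums(2)[OF fract_ring_0] by blast
  have grow: "A \<subset> A \<star> U" if A: "fract.subspace A" "A \<noteq> {0}" "A \<subseteq> P" for A
  proof -
    have "A \<subseteq> A \<star> U" using ideal_prod_memI[OF _ U1, of _ A] by auto
    moreover have "\<exists>y\<in>A. x * y \<notin> A"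
      using fract_ring_if_stabilizes[OF A(1) _ A(2), of x] A(3) proper x(1) by blast
    then have "A \<noteq> A \<star> U" using ideal_prod_memI[OF _ Ux, of _ A] by (metis mult.commute)
    ultimately show ?thesis by auto
  qed
  have "P \<star> U \<subseteq> \<O>"
  proof (rule ideal_prod_subset[OF subspace_fract_ring])
    fix p u assume "p \<in> P" "u \<in> U"
    then obtain y z where "u = y + x * z" "y \<in> \<O>" "z \<in> \<O>" unfolding U_def by auto
    then have "p * u = p * y + (x * p) * z" by (simp add: algebra_simps)
    also have "\<dots> \<in> \<O>"
      using \<open>p \<in> P\<close> proper \<open>y \<in> \<O>\<close> \<open>z \<in> \<O>\<close> by (intro fract_ring_add fract_ring_mult x) auto
    finally show "p * u \<in> \<O>" .
  qed
  then have PU: "P \<star> U = \<O>" using max[OF subspace_ideal_prod, of P U] grow[OF sub P(2)] by auto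
  have "A \<star> U \<subseteq> \<O>" if "A \<subseteq> P" for A using ideal_prod_mono[OF that order_refl, of U] PU by auto
  then show ?thesis using that[OF U PU] grow by blast
qed

text \<open>If P is a maximal ideal over A, then A P^-1 is a strictly larger integral ideal. Its
  inverse, which exists by induction, multiplied by P^-1 is an inverse of A.\<close>

lemma integral_ideal_invertible:
  fixes A :: "'a fract set"
  assumes "fract.subspace A" "A \<subseteq> \<O>" "A \<noteq> {0}"
  shows "invertible_ideal A"
proof -
  have "A \<noteq> {0} \<longrightarrow> invertible_ideal A"
  proof (rule noetherian_ideal_induct[OF noetherian assms(1,2)], intro impI)
    fix A :: "'a fract set" assume A: "fract.subspace A" "A \<subseteq> \<O>" "A \<noteq> {0}"
      and IH: "\<And>B. fract.subspace B \<Longrightarrow> B \<subseteq> \<O> \<Longrightarrow> A \<subset> B \<Longrightarrow> B \<noteq> {0} \<longrightarrow> invertible_ideal B"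
    show "invertible_ideal A"
    proof (cases "A = \<O>")
      case True
      then show ?thesis
        unfolding invertible_ideal_def using subspace_fract_ring fract_ring_ideal_prod by blast
    next
      case False
      then obtain P where P: "maximal_ideal P" "A \<subseteq> P"
        using exists_maximal_ideal[OF A(1)] A(2) by blast
      then have "P \<noteq> {0}" using A(3) fract.subspace_0[OF A(1)] by auto
      then obtain U where U: "fract.subspace U" "A \<subset> A \<star> U" "A \<star> U \<subseteq> \<O>"
        using maximal_ideal_inverse[OF P(1)] A P(2) by metis
      then have "A \<star> U \<noteq> {0}" using A(3) fract.subspace_0[OF A(1)] by auto
      then have "invertible_ideal (A \<star> U)" using IH[OF subspace_ideal_prod U(3,2)] by auto
      then obtain B where "fract.subspace B" "A \<star> U \<star> B = \<O>" unfolding invertible_ideal_def by auto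
      then show ?thesis unfolding invertible_ideal_def ideal_prod_assoc
        using A(1) subspace_ideal_prod by blast
    qed
  qed
  then show ?thesis using assms by auto
qed

lemma fractional_ideal_invertible:
  fixes A :: "'a fract set"
  assumes "A \<in> fractional_ideals" shows "invertible_ideal A"
proof -
  have A: "fract.subspace A" "A \<noteq> {0}" using assms unfolding fractional_ideals_def by auto
  obtain d where d: "d \<noteq> 0" "fract_scale d ` A \<subseteq> \<O>" using assms unfolding fractional_ideals_def by auto
  let ?d = "to_fract d"
  have "(*) ?d ` A \<subseteq> \<O>" using d(2) by (simp add: fract_scale_def image_subset_iff)
  moreover obtain a where "a \<in> A" "a \<noteq> 0" using subspace_nonzero[OF A] .
  then have "?d * a \<in> (*) ?d ` A" "?d * a \<noteq> 0" using d(1) by auto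
  then have "(*) ?d ` A \<noteq> {0}" by blast
  ultimately obtain B where B: "fract.subspace B" "((*) ?d ` A) \<star> B = \<O>"
    using integral_ideal_invertible[OF subspace_image_mult[OF A(1)]] unfolding invertible_ideal_def by blast
  have "A \<star> ((*) ?d ` B) = \<O>"
    using B(2) by (metis ideal_prod_commute image_mult_ideal_prod)
  then show ?thesis unfolding invertible_ideal_def using A(1) B(1) subspace_image_mult by blast
qed

text \<open>
  Noetherian induction on \<open>B\<close>: a generator modulo \<open>A D\<close>, where \<open>A = B P\<^sup>-\<^sup>1\<close> for a maximal ideal \<open>P \<supseteq> B\<close>, is
  also one modulo \<open>B D\<close> if \<open>A \<subseteq> P\<close>; otherwise it has to be moved out of \<open>P D\<close> by an element of \<open>A D\<close>.
\<close>

lemma generator_modulo_ideal: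
  fixes D B :: "'a fract set"
  assumes D: "fract.subspace D" "fract.subspace D'" "D \<star> D' = \<O>"
    and B: "fract.subspace B" "B \<subseteq> \<O>" "B \<noteq> {0}"
  shows "\<exists>t\<in>D. \<forall>d\<in>D. \<exists>y\<in>B \<star> D. \<exists>r\<in>\<O>. d = y + t * r"
proof -
  have "B \<noteq> {0} \<longrightarrow> (\<exists>t\<in>D. \<forall>d\<in>D. \<exists>y\<in>B \<star> D. \<exists>r\<in>\<O>. d = y + t * r)"
  proof (rule noetherian_ideal_induct[OF noetherian B(1,2)], intro impI)
    fix B :: "'a fract set" assume B: "fract.subspace B" "B \<subseteq> \<O>" "B \<noteq> {0}"
      and IH: "\<And>A. fract.subspace A \<Longrightarrow> A \<subseteq> \<O> \<Longrightarrow> B \<subset> A \<Longrightarrow>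
        A \<noteq> {0} \<longrightarrow> (\<exists>t\<in>D. \<forall>d\<in>D. \<exists>y\<in>A \<star> D. \<exists>r\<in>\<O>. d = y + t * r)"
    show "\<exists>t\<in>D. \<forall>d\<in>D. \<exists>y\<in>B \<star> D. \<exists>r\<in>\<O>. d = y + t * r"
    proof (cases "B = \<O>")
      case True
      have "\<exists>y\<in>B \<star> D. \<exists>r\<in>\<O>. d = y + 0 * r" if "d \<in> D" for d
        using that fract_ring_0 unfolding True fract_ring_ideal_prod[OF D(1)] by auto
      then show ?thesis using fract.subspace_0[OF D(1)] by blast
    next
      case False
      then obtain P where P: "maximal_ideal P" "B \<subseteq> P"
        using exists_maximal_ideal[OF B(1)] B(2) by blast
      then have Psub: "fract.subspace P" and PO: "P \<subset> \<O>" unfolding maximal_ideal_def by auto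
      have "P \<noteq> {0}" using P B(3) fract.subspace_0[OF B(1)] by auto
      then obtain U where U: "fract.subspace U" "P \<star> U = \<O>" "B \<subset> B \<star> U" "B \<star> U \<subseteq> \<O>"
        using maximal_ideal_inverse[OF P(1)] B P(2) by metis
      define A where "A = B \<star> U"
      have A: "fract.subspace A" "A \<subseteq> \<O>" "B \<subset> A" unfolding A_def using U subspace_ideal_prod by auto
      have AP: "A \<star> P = B" unfolding A_def
        using ideal_prod_cancel(2)[OF B(1) U(2)] .
      have "A \<noteq> {0}" using A B(3) fract.subspace_0[OF B(1)] by auto
      then obtain t where t: "t \<in> D" "\<And>d. d \<in> D \<Longrightarrow> \<exists>y\<in>A \<star> D. \<exists>r\<in>\<O>. d = y + t * r"
        using IH[OF A] by auto
      \<comment> \<open>An s that generates D modulo A D and modulo P D also does so modulo A P D =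
        B D: the second property, multiplied by A, expresses the error term in A D left by the first
        one.\<close>
      have absorb: "\<exists>y\<in>B \<star> D. \<exists>r\<in>\<O>. d = y + s * r"
        if s: "s \<in> D" and sA: "\<And>d. d \<in> D \<Longrightarrow> \<exists>y\<in>A \<star> D. \<exists>r\<in>\<O>. d = y + s * r"
          and sP: "\<And>d. d \<in> D \<Longrightarrow> \<exists>y\<in>P \<star> D. \<exists>r\<in>\<O>. d = y + s * r" and d: "d \<in> D" for s d
      proof -
        let ?S = "{y + z | y z. y \<in> B \<star> D \<and> z \<in> (*) s ` \<O>}"
        have S: "fract.subspace ?S"
          by (intro fract_subspace_sums subspace_ideal_prod subspace_image_mult subspace_fract_ring)
        have sS: "s * r \<in> ?S" if "r \<in> \<O>" for r
          using that subset_sums(2)[OF fract.subspace_0[OF subspace_ideal_prod]] by blast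
        have "A \<star> D \<subseteq> ?S"
        proof (rule ideal_prod_subset[OF S])
          fix b e assume be: "b \<in> A" "e \<in> D"
          then obtain y r where yr: "y \<in> P \<star> D" "r \<in> \<O>" "e = y + s * r" using sP by blast
          have "b * y \<in> A \<star> (P \<star> D)" using be yr by (intro ideal_prod_memI)
          then have "b * y \<in> B \<star> D" by (simp add: AP flip: ideal_prod_assoc)
          moreover have "b * r \<in> \<O>" using be yr A by (auto intro: fract_ring_mult)
          moreover have "b * e = b * y + s * (b * r)" using yr(3) by (simp add: algebra_simps)
          ultimately show "b * e \<in> ?S" by blast
        qed
        moreover obtain y r where "y \<in> A \<star> D" "r \<in> \<O>" "d = y + s * r" using sA[OF d] by blast
        ultimately have "y \<in> ?S" "s * r \<in> ?S" using sS[of r] by auto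
        from fract.subspace_add[OF S this] show ?thesis using \<open>d = y + s * r\<close> by blast
      qed
      show ?thesis
      proof (cases "A \<subseteq> P")
        case True
        then have "A \<star> D \<subseteq> P \<star> D" by (intro ideal_prod_mono) auto
        then have "\<exists>y\<in>P \<star> D. \<exists>r\<in>\<O>. d = y + t * r" if "d \<in> D" for d using t(2)[OF that] by blast
        then have "\<forall>d\<in>D. \<exists>y\<in>B \<star> D. \<exists>r\<in>\<O>. d = y + t * r" using absorb[OF t(1) t(2)] by blast
        then show ?thesis using t(1) by blast
      next
        case False
        have PD: "fract.subspace (P \<star> D)" by (rule subspace_ideal_prod)
        have "\<not> A \<star> D \<subseteq> P \<star> D"
        proof
          assume "A \<star> D \<subseteq> P \<star> D"
          then have "A \<star> D \<star> D' \<subseteq> P \<star> D \<star> D'" by (rule ideal_prod_mono) simp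
          then have "A \<subseteq> P"
            by (simp only: ideal_prod_cancel(1)[OF A(1) D(3)] ideal_prod_cancel(1)[OF Psub D(3)])
          then show False using False by simp
        qed
        then obtain u where u: "u \<in> A \<star> D" "u \<notin> P \<star> D" by auto
        have AD_D: "A \<star> D \<subseteq> D"
          using A(2) fract_ring_ideal_prod[OF D(1)] ideal_prod_mono[OF A(2) order_refl, of D] by auto
        \<comment> \<open>As u lies in A D, the change does not affect generation modulo A D. As u
          is not in P D, the elements t and t + u are not both in P D.\<close>
        define s where "s = (if t \<in> P \<star> D then t + u else t)"
        have sP: "s \<notin> P \<star> D"
        proof
          assume "s \<in> P \<star> D"
          moreover from this have "t \<in> P \<star> D" unfolding s_def by (auto split: if_splits)
          ultimately have "u \<in> P \<star> D" using fract.subspace_diff[OF PD, of s t] by (simp add: s_def)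
          then show False using u by simp
        qed
        have sD: "s \<in> D" using t(1) u(1) AD_D fract.subspace_add[OF D(1)] by (auto simp: s_def)
        have st: "\<exists>v\<in>A \<star> D. t = v + s"
        proof (cases "t \<in> P \<star> D")
          case True
          then show ?thesis using fract.subspace_neg[OF subspace_ideal_prod u(1)]
            by (intro bexI[of _ "- u"]) (auto simp: s_def)
        next
          case False
          then show ?thesis using fract.subspace_0[OF subspace_ideal_prod]
            by (intro bexI[of _ 0]) (auto simp: s_def)
        qed
        then obtain v where v: "v \<in> A \<star> D" "t = v + s" by auto
        have 1: "\<exists>y\<in>A \<star> D. \<exists>r\<in>\<O>. d = y + s * r" if d: "d \<in> D" for d
        proof -
          obtain y r where yr: "y \<in> A \<star> D" "r \<in> \<O>" "d = y + t * r" using t(2)[OF d] by auto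
          then have "d = (y + r * v) + s * r" by (simp add: v(2) algebra_simps)
          moreover have "y + r * v \<in> A \<star> D"
            by (intro fract.subspace_add[OF subspace_ideal_prod] fract_subspace_mult[OF subspace_ideal_prod] yr v)
          ultimately show ?thesis using yr by blast
        qed
        let ?X = "{y + z | y z. y \<in> P \<star> D \<and> z \<in> (*) s ` \<O>}"
        have X: "fract.subspace ?X"
          by (intro fract_subspace_sums PD subspace_image_mult subspace_fract_ring)
        have "s \<in> (*) s ` \<O>" using fract_ring_1 by (intro image_eqI[of _ _ 1]) auto
        then have sX: "s \<in> ?X" using subset_sums(2)[OF fract.subspace_0[OF PD]] by blast
        have "0 \<in> (*) s ` \<O>" using fract_ring_0 by (intro image_eqI[of _ _ 0]) auto
        then have PDX: "P \<star> D \<subseteq> ?X" by (rule subset_sums)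
        have "P \<star> D \<subseteq> D"
          using PO fract_ring_ideal_prod[OF D(1)] ideal_prod_mono[of P \<O> D D] by auto
        then have "?X \<subseteq> D" using fract_ring_mult_subset[OF D(1) sD]
          by (auto intro!: fract.subspace_add[OF D(1)])
        then have XO: "?X \<star> D' \<subseteq> \<O>" using ideal_prod_mono[of ?X D D' D'] D(3) by auto
        have "P = P \<star> D \<star> D'" using ideal_prod_cancel(1)[OF Psub D(3)] by simp
        then have "P \<subseteq> ?X \<star> D'" using ideal_prod_mono[OF PDX order_refl, of D'] by auto
        \<comment> \<open>With X = P D + s \<O>, the product X D^-1 lies between P and \<O>. If it
          were P, then X would be P D, which does not contain s. Hence X = D.\<close>
        then have "?X \<star> D' = P \<or> ?X \<star> D' = \<O>"
          using P(1) XO subspace_ideal_prod unfolding maximal_ideal_def by blast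
        moreover have "?X \<star> D' \<star> D = ?X" using ideal_prod_cancel(2)[OF X D(3)] .
        moreover have "P \<star> D \<noteq> ?X" using sP sX by metis
        moreover have "Y = \<O> \<star> D"
          if "Y \<star> D' = P \<or> Y \<star> D' = \<O>" "Y \<star> D' \<star> D = Y" "P \<star> D \<noteq> Y" for Y
          using that by auto
        ultimately have "?X = \<O> \<star> D" by blast
        then have "?X = D" using fract_ring_ideal_prod[OF D(1)] by simp
        then have 2: "\<exists>y\<in>P \<star> D. \<exists>r\<in>\<O>. d = y + s * r" if d: "d \<in> D" for d using d by blast
        have "\<forall>d\<in>D. \<exists>y\<in>B \<star> D. \<exists>r\<in>\<O>. d = y + s * r" using absorb[OF sD 1 2] by blast
        then show ?thesis using sD by blast
      qed
    qed
  qed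
  then show ?thesis using B by auto
qed

text \<open>This is \<open>generator_modulo_ideal\<close> for the integral ideal E D^-1, whose
  product with D is E.\<close>

lemma ideal_eq_subideal_plus_principal:
  fixes D E :: "'a fract set"
  assumes D: "invertible_ideal D" and E: "invertible_ideal E" "E \<subseteq> D"
  shows "\<exists>t\<in>D. \<forall>d\<in>D. \<exists>y\<in>E. \<exists>r\<in>\<O>. d = y + t * r"
proof -
  obtain D' where D': "fract.subspace D" "fract.subspace D'" "D \<star> D' = \<O>"
    using D unfolding invertible_ideal_def by auto
  have Esub: "fract.subspace E" using E unfolding invertible_ideal_def by auto
  have EE: "E \<star> D' \<star> D = E" using ideal_prod_cancel(2)[OF Esub D'(3)] .
  have "E \<star> D' \<subseteq> \<O>" using ideal_prod_mono[OF E(2) order_refl, of D'] D'(3) by auto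
  moreover have "E \<star> D' \<noteq> {0}"
  proof
    assume "E \<star> D' = {0}"
    then have "E \<star> D' \<star> D \<subseteq> {0}" by (intro ideal_prod_subset) (auto simp: fract.subspace_single_0)
    then show False using EE invertible_ideal_nonzero[OF E(1)] fract.subspace_0[OF Esub] by auto
  qed
  ultimately show ?thesis
    using generator_modulo_ideal[OF D' subspace_ideal_prod, of E D'] unfolding EE by blast
qed

end

section \<open>Ideal classes\<close>

text \<open>For nonzero submodules of the fraction field this amounts to being isomorphic, since
  every isomorphism between them is multiplication by a scalar.\<close>

definition similar_ideals :: "'a::idom fract set \<Rightarrow> 'a fract set \<Rightarrow> bool" where
  "similar_ideals A B \<longleftrightarrow> (\<exists>x. x \<noteq> 0 \<and> B = (*) x ` A)"

lemma image_mult_image_mult: "(*) x ` (*) y ` A = (*) (x * y) ` (A :: 'a::idom fract set)"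
  by (auto simp: image_image mult.assoc)

lemma similar_ideals_refl: "similar_ideals A A"
  unfolding similar_ideals_def by (intro exI[of _ 1]) auto

lemma image_mult_eq_imp:
  fixes A B :: "'a::idom fract set"
  assumes "(*) c ` A = (*) d ` B" "c \<noteq> 0"
  shows "A = (*) (d / c) ` B"
proof -
  have "A = (*) (inverse c * c) ` A" using assms(2) by simp
  also have "\<dots> = (*) (inverse c) ` (*) d ` B" unfolding assms(1)[symmetric] image_mult_image_mult ..
  finally show ?thesis unfolding image_mult_image_mult by (simp only: divide_inverse mult.commute)
qed

lemma similar_ideals_sym: "similar_ideals A B \<Longrightarrow> similar_ideals B A"
proof -
  assume "similar_ideals A B"
  then obtain x where x: "x \<noteq> 0" "B = (*) x ` A" unfolding similar_ideals_def by auto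
  then have "A = (*) (1 / x) ` B" using image_mult_eq_imp[of x A 1 B] by simp
  then show ?thesis unfolding similar_ideals_def using x(1) by (intro exI[of _ "1 / x"]) auto
qed

lemma similar_ideals_trans: "similar_ideals A B \<Longrightarrow> similar_ideals B C \<Longrightarrow> similar_ideals A C"
  unfolding similar_ideals_def using image_mult_image_mult by (metis mult_eq_0_iff)

text \<open>Multiplication by the inverse of A cancels A on one side and, up to a scalar, C on the
  other.\<close>

lemma similar_ideals_cofactor:
  fixes A B C D :: "'a::idom fract set"
  assumes A: "invertible_ideal A" and BD: "fract.subspace B" "fract.subspace D"
    and eq: "(*) c ` (A \<star> B) = (*) d ` (C \<star> D)" "c \<noteq> 0" "d \<noteq> 0" and AC: "similar_ideals A C"
  shows "similar_ideals B D"
proof -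
  obtain x where x: "x \<noteq> 0" "C = (*) x ` A" using AC unfolding similar_ideals_def by auto
  obtain A' where A': "A \<star> A' = \<O>" using A unfolding invertible_ideal_def by auto
  have cancel: "A \<star> X \<star> A' = X" if "fract.subspace X" for X
    using ideal_prod_cancel(1)[OF that A'] unfolding ideal_prod_commute[of X A] .
  have "((*) c ` (A \<star> B)) \<star> A' = (*) c ` B"
    by (simp add: image_mult_ideal_prod cancel[OF BD(1)])
  moreover have "((*) d ` (C \<star> D)) \<star> A' = (*) (d * x) ` D"
    by (simp add: x(2) image_mult_ideal_prod image_mult_image_mult cancel[OF BD(2)])
  ultimately have "(*) (d * x) ` D = (*) c ` B" using eq(1) by simp
  then have "D = (*) (c / (d * x)) ` B" using eq(3) x(1) by (intro image_mult_eq_imp) auto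
  then show ?thesis unfolding similar_ideals_def using eq(2,3) x(1) by (intro exI[of _ "c / (d * x)"]) auto
qed

text \<open>Multiplying by the principal ideal x \<O> is scaling by x. The cosets that make up the
  class group are thus similarity classes, and statements about its cardinality become statements
  about similarity.\<close>

lemma principal_coset:
  fixes A :: "'a::idom fract set"
  assumes "fract.subspace A"
  shows "principal_fractional_ideals #>\<^bsub>fractional_ideal_group\<^esub> A = {B. similar_ideals A B}"
proof -
  have "range (\<lambda>a. fract_scale a x) \<star> A = (*) x ` A" for x
  proof -
    have "range (\<lambda>a. fract_scale a x) = (*) x ` \<O>"
      by (auto simp: fract_scale_def image_image mult.commute)
    then show ?thesis using fract_ring_ideal_prod[OF assms] by (simp add: image_mult_ideal_prod)
  qed
  then show ?thesis
    unfolding r_coset_def fractional_ideal_group_def principal_fractional_ideals_def similar_ideals_def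
    by (auto simp: ideal_prod_def[symmetric])
qed

lemma class_group_carrier:
  "carrier (class_group :: 'a::idom fract set set monoid) = (\<lambda>A. {B. similar_ideals A B}) ` fractional_ideals"
proof -
  have "carrier (class_group :: 'a fract set set monoid) =
      (\<lambda>A. principal_fractional_ideals #>\<^bsub>fractional_ideal_group\<^esub> A) ` fractional_ideals"
    unfolding class_group_def FactGroup_def RCOSETS_def by (auto simp: fractional_ideal_group_def)
  also have "\<dots> = (\<lambda>A. {B. similar_ideals A B}) ` fractional_ideals"
    by (rule image_cong[OF refl], rule principal_coset) (simp add: fractional_ideals_def)
  finally show ?thesis .
qed

lemma similar_class_eq:
  "{C. similar_ideals A C} = {C. similar_ideals B C} \<longleftrightarrow> similar_ideals A B"
  using similar_ideals_refl similar_ideals_sym similar_ideals_trans by blast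

text \<open>The classes of A and B, which are a single class when A and B are similar, are too few
  to exhaust the class group.\<close>

lemma exists_dissimilar_ideal:
  fixes A B :: "'a::idom fract set"
  assumes "2 < card (carrier (class_group :: 'a fract set set monoid)) \<or>
      1 < card (carrier (class_group :: 'a fract set set monoid)) \<and> similar_ideals A B"
  obtains D where "D \<in> fractional_ideals" "\<not> similar_ideals A D" "\<not> similar_ideals B D"
proof -
  let ?c = "\<lambda>A. {B. similar_ideals A B}"
  have "\<not> carrier (class_group :: 'a fract set set monoid) \<subseteq> {?c A, ?c B}"
  proof
    assume "carrier (class_group :: 'a fract set set monoid) \<subseteq> {?c A, ?c B}"
    then have "card (carrier (class_group :: 'a fract set set monoid)) \<le> card {?c A, ?c B}"
      by (intro card_mono) auto
    then show False using assms similar_class_eq[of A B] by (auto simp: card_insert_if split: if_splits)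
  qed
  then obtain D where "D \<in> fractional_ideals" "?c D \<notin> {?c A, ?c B}" unfolding class_group_carrier by auto
  then show ?thesis using that[of D] similar_class_eq similar_ideals_sym by blast
qed

lemma similar_pair:
  fixes A B C :: "'a::idom fract set"
  assumes "card (carrier (class_group :: 'a fract set set monoid)) = 2"
    and "A \<in> fractional_ideals" "B \<in> fractional_ideals" "C \<in> fractional_ideals"
  shows "similar_ideals A B \<or> similar_ideals A C \<or> similar_ideals B C"
proof (rule ccontr)
  assume no: "\<not> ?thesis"
  let ?c = "\<lambda>A. {B. similar_ideals A B}"
  have "?c A \<noteq> ?c B" "?c A \<noteq> ?c C" "?c B \<noteq> ?c C" using no unfolding similar_class_eq by auto
  then have "card {?c A, ?c B, ?c C} = 3" by simp
  moreover have "{?c A, ?c B, ?c C} \<subseteq> carrier (class_group :: 'a fract set set monoid)"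
    unfolding class_group_carrier using assms by auto
  then have "card {?c A, ?c B, ?c C} \<le> 2"
    using assms(1) by (metis card_mono card.infinite zero_neq_numeral)
  ultimately show False by simp
qed

section \<open>Realizing every ideal class by a sum A + t B\<close>

lemma invertible_ideal_prod:
  assumes "invertible_ideal A" "invertible_ideal B"
  shows "invertible_ideal (A \<star> B)"
proof -
  obtain A' B' where AB: "A \<star> A' = \<O>" "B \<star> B' = \<O>" and sub: "fract.subspace B"
    using assms unfolding invertible_ideal_def by auto
  have "A \<star> B \<star> (A' \<star> B') = B \<star> A \<star> A' \<star> B'"
    by (simp only: ideal_prod_assoc[of "B \<star> A"] ideal_prod_commute[of A B])
  also have "\<dots> = \<O>" unfolding ideal_prod_cancel(1)[OF sub AB(1)] by (rule AB(2))
  finally show ?thesis unfolding invertible_ideal_def using subspace_ideal_prod by blast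
qed

lemma invertible_ideal_scale:
  assumes "invertible_ideal A" "x \<noteq> 0" shows "invertible_ideal ((*) x ` A)"
proof -
  obtain B where B: "fract.subspace A" "fract.subspace B" "A \<star> B = \<O>"
    using assms unfolding invertible_ideal_def by auto
  have "((*) x ` A) \<star> ((*) (1 / x) ` B) = (*) x ` ((*) (1 / x) ` (B \<star> A))"
    by (simp only: image_mult_ideal_prod ideal_prod_commute[of A])
  also have "\<dots> = \<O>" unfolding image_mult_image_mult ideal_prod_commute[of B A] B(3) using assms(2) by simp
  finally show ?thesis unfolding invertible_ideal_def using subspace_image_mult B by blast
qed

text \<open>Steinitz's argument: after multiplication by \<open>B\<^sup>-\<^sup>1\<close>, the claim is that \<open>E\<close> is cyclic modulo \<open>A\<close>.\<close>

lemma exists_sum_in_class: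
  fixes A B D :: "'a::idom fract set"
  assumes dedekind: "dedekind_domain TYPE('a)"
    and A: "invertible_ideal A" "A \<subseteq> \<O>" and B: "invertible_ideal B" and D: "invertible_ideal D"
  obtains E t where "similar_ideals D E" "invertible_ideal E" "E = {x + t * y | x y. x \<in> A \<and> y \<in> B}"
proof -
  have sub: "fract.subspace A" "fract.subspace B" "fract.subspace D"
    using A B D unfolding invertible_ideal_def by auto
  obtain \<delta> where \<delta>: "\<delta> \<in> D" "\<delta> \<noteq> 0"
    using subspace_nonzero[OF sub(3) invertible_ideal_nonzero[OF D]] .
  \<comment> \<open>Scaling by 1 / \<delta> puts 1 into E, so that A \<subseteq> \<O> \<subseteq>
    E.\<close>
  define E where "E = (*) (1 / \<delta>) ` D"
  have E: "invertible_ideal E" unfolding E_def using \<delta>(2) by (intro invertible_ideal_scale D) simp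
  have Esub: "fract.subspace E" using E unfolding invertible_ideal_def by auto
  have "1 \<in> E" unfolding E_def using \<delta> by (intro image_eqI[of _ _ \<delta>]) auto
  then have "\<O> \<subseteq> E" using fract_subspace_mult[OF Esub, of 1] by auto
  then have AE: "A \<subseteq> E" using A(2) by auto
  obtain B' where B': "fract.subspace B'" "B \<star> B' = \<O>" using B unfolding invertible_ideal_def by auto
  have B'_inv: "invertible_ideal B'"
    unfolding invertible_ideal_def using B' sub(2) ideal_prod_commute by blast
  have "\<exists>t\<in>E \<star> B'. \<forall>d\<in>E \<star> B'. \<exists>y\<in>A \<star> B'. \<exists>r\<in>\<O>. d = y + t * r"
    using AE by (intro ideal_eq_subideal_plus_principal[OF dedekind] invertible_ideal_prod E A B'_inv ideal_prod_mono) auto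
  then obtain t where t: "t \<in> E \<star> B'" "\<And>d. d \<in> E \<star> B' \<Longrightarrow> \<exists>y\<in>A \<star> B'. \<exists>r\<in>\<O>. d = y + t * r" by blast
  let ?S = "{x + t * y | x y. x \<in> A \<and> y \<in> B}"
  have S_eq: "?S = {x + z | x z. x \<in> A \<and> z \<in> (*) t ` B}" by blast
  have S: "fract.subspace ?S" unfolding S_eq
    by (intro fract_subspace_sums sub subspace_image_mult)
  have EB: "E \<star> B' \<star> B = E" "A \<star> B' \<star> B = A"
    using ideal_prod_cancel(2)[OF Esub B'(2)] ideal_prod_cancel(2)[OF sub(1) B'(2)] .
  have "E = ?S"
  proof
    \<comment> \<open>Every element of E B^-1 is in A B^-1 + t \<O>; multiplying by B turns this
      into E \<subseteq> A + t B.\<close>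
    have "E \<star> B' \<star> B \<subseteq> ?S"
    proof (rule ideal_prod_subset[OF S])
      fix d b assume "d \<in> E \<star> B'" "b \<in> B"
      then obtain y r where yr: "y \<in> A \<star> B'" "r \<in> \<O>" "d = y + t * r" using t(2) by blast
      have "y * b \<in> A \<star> B' \<star> B" using yr(1) \<open>b \<in> B\<close> by (rule ideal_prod_memI)
      then have "y * b \<in> A" unfolding EB(2) .
      moreover have "r * b \<in> B" using fract_subspace_mult[OF sub(2) \<open>b \<in> B\<close> yr(2)] .
      moreover have "d * b = y * b + t * (r * b)" unfolding yr(3) by (simp add: algebra_simps)
      ultimately show "d * b \<in> ?S" by blast
    qed
    then show "E \<subseteq> ?S" unfolding EB(1) .
    have "t * y \<in> E" if "y \<in> B" for y
      using ideal_prod_memI[OF t(1) that] unfolding EB(1) .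
    then show "?S \<subseteq> E" using AE fract.subspace_add[OF Esub] by blast
  qed
  moreover have "similar_ideals D E"
    unfolding similar_ideals_def E_def using \<delta>(2) by (intro exI[of _ "1 / \<delta>"]) auto
  ultimately show ?thesis using that E by blast
qed

section \<open>Splitting modules into ideals\<close>

locale idom_module = Modules.module scale
  for scale :: "'a::idom \<Rightarrow> 'm::ab_group_add \<Rightarrow> 'm" (infixr \<open>*s\<close> 75)
begin

text \<open>Linearity is required on N only. Coordinates of a submodule are thus functions on the
  whole type with arbitrary values outside of it.\<close>

definition fract_hom :: "'m set \<Rightarrow> ('m \<Rightarrow> 'a fract) \<Rightarrow> bool" where
  "fract_hom N \<theta> \<longleftrightarrow> (\<forall>x\<in>N. \<forall>y\<in>N. \<theta> (x + y) = \<theta> x + \<theta> y) \<and>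
     (\<forall>a. \<forall>x\<in>N. \<theta> (a *s x) = to_fract a * \<theta> x)"

lemma fract_hom_add: "fract_hom N \<theta> \<Longrightarrow> x \<in> N \<Longrightarrow> y \<in> N \<Longrightarrow> \<theta> (x + y) = \<theta> x + \<theta> y"
  and fract_hom_scale: "fract_hom N \<theta> \<Longrightarrow> x \<in> N \<Longrightarrow> \<theta> (a *s x) = to_fract a * \<theta> x"
  unfolding fract_hom_def by auto

lemma fract_hom_zero: "fract_hom N \<theta> \<Longrightarrow> 0 \<in> N \<Longrightarrow> \<theta> 0 = 0"
  using fract_hom_scale[of N \<theta> 0 0] by simp

lemma fract_hom_diff:
  assumes "fract_hom N \<theta>" "subspace N" "x \<in> N" "y \<in> N"
  shows "\<theta> (x - y) = \<theta> x - \<theta> y"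
  using fract_hom_add[OF assms(1) subspace_diff[OF assms(2-4)] assms(4)] by simp

lemma fract_hom_subset: "fract_hom N \<theta> \<Longrightarrow> N' \<subseteq> N \<Longrightarrow> fract_hom N' \<theta>"
  unfolding fract_hom_def by blast

lemma fract_hom_lincomb:
  assumes "fract_hom N \<theta>" "fract_hom N \<eta>"
  shows "fract_hom N (\<lambda>x. c * \<theta> x + d * \<eta> x)"
  using assms unfolding fract_hom_def by (simp add: algebra_simps)

lemma subspace_fract_hom_kernel:
  assumes "subspace N" "fract_hom N \<theta>" shows "subspace {x \<in> N. \<theta> x = 0}"
  using assms
  by (auto simp: subspace_def fract_hom_add fract_hom_scale fract_hom_zero)

lemma subspace_fract_hom_image:
  assumes "subspace N" "fract_hom N \<theta>" shows "fract.subspace (\<theta> ` N)"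
proof (rule fract_subspaceI)
  show "0 \<in> \<theta> ` N"
    using fract_hom_zero[OF assms(2)] subspace_0[OF assms(1)] by (metis image_eqI)
  show "x + y \<in> \<theta> ` N" if "x \<in> \<theta> ` N" "y \<in> \<theta> ` N" for x y
    using that fract_hom_add[OF assms(2)] subspace_add[OF assms(1)] by (smt (verit) image_iff)
  show "c * x \<in> \<theta> ` N" if "x \<in> \<theta> ` N" "c \<in> \<O>" for c x
    using that fract_hom_scale[OF assms(2)] subspace_scale[OF assms(1)] by (smt (verit) image_iff)
qed

text \<open>
  \<open>split_coords N r \<theta>\<close> says that \<open>\<theta> 0, \<dots>, \<theta> (r - 1)\<close> identify \<open>N\<close> with a direct sum
  \<open>A\<^sub>0 \<oplus> \<dots> \<oplus> A\<^bsub>r-1\<^esub>\<close> of nonzero \<open>\<O>\<close>-submodules of the fraction field.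
\<close>

definition split_coords :: "'m set \<Rightarrow> nat \<Rightarrow> (nat \<Rightarrow> 'm \<Rightarrow> 'a fract) \<Rightarrow> bool" where
  "split_coords N r \<theta> \<longleftrightarrow>
     (\<forall>i<r. fract_hom N (\<theta> i)) \<and>
     (\<forall>x\<in>N. (\<forall>i<r. \<theta> i x = 0) \<longrightarrow> x = 0) \<and>
     (\<forall>i<r. \<forall>x\<in>N. \<exists>y\<in>N. \<theta> i y = \<theta> i x \<and> (\<forall>j<r. j \<noteq> i \<longrightarrow> \<theta> j y = 0)) \<and>
     (\<forall>i<r. \<exists>x\<in>N. \<theta> i x \<noteq> 0)"

lemma split_coordsD:
  assumes "split_coords N r \<theta>"
  shows "i < r \<Longrightarrow> fract_hom N (\<theta> i)"
    and "x \<in> N \<Longrightarrow> (\<And>i. i < r \<Longrightarrow> \<theta> i x = 0) \<Longrightarrow> x = 0"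
    and "i < r \<Longrightarrow> x \<in> N \<Longrightarrow> \<exists>y\<in>N. \<theta> i y = \<theta> i x \<and> (\<forall>j<r. j \<noteq> i \<longrightarrow> \<theta> j y = 0)"
    and "i < r \<Longrightarrow> \<exists>x\<in>N. \<theta> i x \<noteq> 0"
  using assms unfolding split_coords_def by auto

text \<open>
  If \<open>1 = \<Sum> \<psi> (u\<^sub>i) e\<^sub>i\<close> with \<open>e\<^sub>i\<close> in the inverse ideal, then \<open>d \<mapsto> \<Sum> (d e\<^sub>i) u\<^sub>i\<close> is a section of \<open>\<psi>\<close>.
\<close>

lemma split_off_invertible:
  assumes N: "subspace N" and \<psi>: "fract_hom N \<psi>" and inv: "invertible_ideal (\<psi> ` N)"
  obtains L where "subspace L" "L \<subseteq> N" "\<And>x. x \<in> L \<Longrightarrow> \<psi> x = 0 \<Longrightarrow> x = 0" "\<psi> ` L = \<psi> ` N"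
proof -
  define D where "D = \<psi> ` N"
  have D: "fract.subspace D" unfolding D_def by (rule subspace_fract_hom_image[OF N \<psi>])
  obtain D' where D': "fract.subspace D'" "D \<star> D' = \<O>"
    using inv unfolding invertible_ideal_def D_def by auto
  define P where "P us \<longleftrightarrow> set us \<subseteq> N \<times> D'" for us
  define ev where "ev us = sum_list (map (\<lambda>(u, e). \<psi> u * e) us)" for us
  \<comment> \<open>Elements of the product ideal are finite sums of products. The list of pairs
    makes the summands of 1 available for building the section.\<close>
  have "D \<star> D' \<subseteq> {ev us | us. P us}"
  proof (rule ideal_prod_subset)
    show "fract.subspace {ev us | us. P us}"
    proof (rule fract_subspaceI)
      show "0 \<in> {ev us | us. P us}" by (auto simp: P_def ev_def intro!: exI[of _ "[]"])
      fix x y assume "x \<in> {ev us | us. P us}" "y \<in> {ev us | us. P us}"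
      then obtain us vs where "x = ev us" "y = ev vs" "P us" "P vs" by auto
      then show "x + y \<in> {ev us | us. P us}"
        by (auto intro!: exI[of _ "us @ vs"] simp: P_def ev_def)
    next
      fix c x :: "'a fract" assume "x \<in> {ev us | us. P us}" "c \<in> \<O>"
      then obtain us a where us: "x = ev us" "P us" "c = to_fract a" by auto
      let ?us = "map (\<lambda>(u, e). (a *s u, e)) us"
      have "c * x = sum_list (map (\<lambda>(u, e). c * (\<psi> u * e)) us)"
        unfolding us(1) ev_def sum_list_const_mult[symmetric] by (simp add: case_prod_unfold)
      also have "\<dots> = ev ?us" unfolding ev_def map_map
        by (rule arg_cong[of _ _ sum_list], rule map_cong)
           (use us in \<open>auto simp: P_def fract_hom_scale[OF \<psi>] subset_iff\<close>)
      finally show "c * x \<in> {ev us | us. P us}"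
        using us(2) by (auto simp: P_def subset_iff intro!: exI[of _ ?us] subspace_scale[OF N])
    qed
    fix x y assume "x \<in> D" "y \<in> D'"
    then obtain u where "u \<in> N" "x = \<psi> u" unfolding D_def by auto
    then show "x * y \<in> {ev us | us. P us}" using \<open>y \<in> D'\<close>
      by (auto intro!: exI[of _ "[(u, y)]"] simp: P_def ev_def)
  qed
  moreover have "1 \<in> D \<star> D'" using D'(2) fract_ring_1 by simp
  ultimately obtain us where us: "ev us = 1" "P us" by auto
  \<comment> \<open>A chosen preimage under \<open>to_fract\<close>. On \<O> it is additive and
    \<O>-linear because \<open>to_fract\<close> is injective, and this makes the section
    linear.\<close>
  define q where "q z = (SOME r. to_fract r = z)" for z :: "'a fract"
  have q: "to_fract (q z) = z" if z: "z \<in> \<O>" for z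
    unfolding q_def by (rule someI_ex) (use z in auto)
  have q_eq: "q z = r" if "z = to_fract r" for z r using q[of z] that by auto
  define sec where "sec d = sum_list (map (\<lambda>(u, e). q (d * e) *s u) us)" for d
  have DO: "d * e \<in> \<O>" if "d \<in> D" "(u, e) \<in> set us" for d e u
    using that us(2) ideal_prod_memI[of d D e D'] D'(2) unfolding P_def by auto
  have sec_N: "sec d \<in> N" for d
  proof -
    have "sum_list (map (\<lambda>(u, e). q (d * e) *s u) vs) \<in> N" if "P vs" for vs
      using that by (induction vs) (auto simp: P_def subspace_0[OF N] subspace_add[OF N] subspace_scale[OF N])
    then show ?thesis using us(2) by (simp add: sec_def)
  qed
  have \<psi>_sec: "\<psi> (sec d) = d" if d: "d \<in> D" for d
  proof -
    have "sum_list (map (\<lambda>(u, e). q (d * e) *s u) vs) \<in> N \<and>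
        \<psi> (sum_list (map (\<lambda>(u, e). q (d * e) *s u) vs)) = d * ev vs" if "set vs \<subseteq> set us" for vs
      using that
    proof (induction vs)
      case (Cons v vs)
      obtain u e where v: "v = (u, e)" by (cases v)
      have "u \<in> N" using Cons.prems us(2) v by (auto simp: P_def)
      moreover have "to_fract (q (d * e)) = d * e" using DO[OF d] Cons.prems v by (intro q) auto
      ultimately show ?case using Cons v subspace_scale[OF N]
        by (auto simp: fract_hom_add[OF \<psi>] fract_hom_scale[OF \<psi>] ev_def subspace_add[OF N] algebra_simps)
    qed (simp add: fract_hom_zero[OF \<psi>] subspace_0[OF N] ev_def)
    from this[of us] show ?thesis using us(1) by (simp add: sec_def)
  qed
  have sec_add: "sec (d + d') = sec d + sec d'" if dd: "d \<in> D" "d' \<in> D" for d d'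
  proof -
    have *: "q ((d + d') * e) *s u = q (d * e) *s u + q (d' * e) *s u" if ue: "(u, e) \<in> set us" for u e
    proof -
      have "q ((d + d') * e) = q (d * e) + q (d' * e)"
        using q[OF DO[OF dd(1) ue]] q[OF DO[OF dd(2) ue]] by (intro q_eq) (simp add: algebra_simps)
      then show ?thesis by (simp add: scale_left_distrib)
    qed
    have "sec (d + d') = sum_list (map (\<lambda>(u, e). q (d * e) *s u + q (d' * e) *s u) us)"
      unfolding sec_def by (rule arg_cong[of _ _ sum_list], rule map_cong) (use * in auto)
    also have "\<dots> = sec d + sec d'"
      unfolding sec_def sum_list_addf[symmetric] by (simp add: case_prod_unfold)
    finally show ?thesis .
  qed
  have sec_scale: "sec (to_fract a * d) = a *s sec d" if dd: "d \<in> D" for a d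
  proof -
    have *: "q (to_fract a * d * e) *s u = a *s (q (d * e) *s u)" if ue: "(u, e) \<in> set us" for u e
    proof -
      have "q (to_fract a * d * e) = a * q (d * e)"
        using q[OF DO[OF dd(1) ue]] by (intro q_eq) (simp add: algebra_simps)
      then show ?thesis by simp
    qed
    have "sec (to_fract a * d) = sum_list (map (\<lambda>(u, e). a *s (q (d * e) *s u)) us)"
      unfolding sec_def by (rule arg_cong[of _ _ sum_list], rule map_cong) (use * in auto)
    also have "\<dots> = a *s sec d"
    proof -
      have "sum_list (map (\<lambda>(u, e). a *s (q (d * e) *s u)) vs) =
          a *s sum_list (map (\<lambda>(u, e). q (d * e) *s u) vs)" for vs
        by (induction vs) (auto simp: scale_right_distrib)
      then show ?thesis unfolding sec_def .
    qed
    finally show ?thesis .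
  qed
  have sec0: "sec 0 = 0" using sec_scale[OF fract.subspace_0[OF D], of 0] by simp
  show ?thesis
  proof (rule that[of "sec ` D"])
    show "subspace (sec ` D)" unfolding subspace_def
    proof (intro conjI ballI allI)
      show "0 \<in> sec ` D" using sec0 fract.subspace_0[OF D] by (metis image_eqI)
      show "x + y \<in> sec ` D" if "x \<in> sec ` D" "y \<in> sec ` D" for x y
        using that sec_add fract.subspace_add[OF D] by (smt (verit) image_iff)
      show "a *s x \<in> sec ` D" if "x \<in> sec ` D" for a x
      proof -
        obtain d where d: "d \<in> D" "x = sec d" using \<open>x \<in> sec ` D\<close> by auto
        then have "to_fract a * d \<in> D" using fract_subspace_mult[OF D] by auto
        then show ?thesis using sec_scale[OF d(1), of a] d(2) by (metis image_eqI)
      qed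
    qed
    show "sec ` D \<subseteq> N" using sec_N by auto
    show "x = 0" if "x \<in> sec ` D" "\<psi> x = 0" for x using that \<psi>_sec sec0 by auto
    show "\<psi> ` sec ` D = \<psi> ` N" using \<psi>_sec by (force simp: D_def[symmetric] image_image)
  qed
qed

text \<open>The coordinates of both summands are composed with the projections, those of W being
  numbered from r on. The images are recorded because the ideals have to stay integral when lines
  are split off one after the other.\<close>

lemma split_coords_sum:
  assumes N: "subspace V" "subspace W" "V \<inter> W = {0}" "N = {v + w | v w. v \<in> V \<and> w \<in> W}"
    and V: "split_coords V r \<theta>" and W: "split_coords W k \<eta>"
  obtains \<zeta> where "split_coords N (r + k) \<zeta>"
    "\<And>i. i < r \<Longrightarrow> \<zeta> i ` N = \<theta> i ` V" "\<And>i. i < k \<Longrightarrow> \<zeta> (r + i) ` N = \<eta> i ` W"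
proof -
  define p where "p x = (THE v. v \<in> V \<and> x - v \<in> W)" for x
  have p_eq: "p (v + w) = v" if "v \<in> V" "w \<in> W" for v w
    unfolding p_def
  proof (rule the_equality)
    show "v \<in> V \<and> v + w - v \<in> W" using that by simp
    fix v' assume v': "v' \<in> V \<and> v + w - v' \<in> W"
    have "v' - v \<in> V" using v' that subspace_diff[OF N(1)] by auto
    moreover have "w - (v + w - v') \<in> W" using subspace_diff[OF N(2), of w "v + w - v'"] v' that by blast
    then have "v' - v \<in> W" by simp
    ultimately have "v' - v \<in> V \<inter> W" by blast
    then show "v' = v" unfolding N(3) by simp
  qed
  define \<zeta> where "\<zeta> i x = (if i < r then \<theta> i (p x) else \<eta> (i - r) (x - p x))" for i x
  have \<zeta>1: "\<zeta> i (v + w) = \<theta> i v" if "i < r" "v \<in> V" "w \<in> W" for i v w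
    using that p_eq by (simp add: \<zeta>_def)
  have \<zeta>2: "\<zeta> i (v + w) = \<eta> (i - r) w" if "\<not> i < r" "v \<in> V" "w \<in> W" for i v w
    using that p_eq by (simp add: \<zeta>_def)
  have V0: "0 \<in> V" and W0: "0 \<in> W" using subspace_0 N by auto
  have zV: "\<theta> i 0 = 0" if "i < r" for i using fract_hom_zero[OF split_coordsD(1)[OF V that] V0] .
  have zW: "\<eta> i 0 = 0" if "i < k" for i using fract_hom_zero[OF split_coordsD(1)[OF W that] W0] .
  have memN: "\<And>v w. v \<in> V \<Longrightarrow> w \<in> W \<Longrightarrow> v + w \<in> N" unfolding N(4) by blast
  have Nmem: "\<exists>v\<in>V. \<exists>w\<in>W. x = v + w" if "x \<in> N" for x using that unfolding N(4) by blast
  show ?thesis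
  proof (rule that[of \<zeta>])
    show "\<zeta> i ` N = \<theta> i ` V" if i: "i < r" for i
    proof
      show "\<zeta> i ` N \<subseteq> \<theta> i ` V" using Nmem \<zeta>1[OF i] by fastforce
      show "\<theta> i ` V \<subseteq> \<zeta> i ` N" using memN[OF _ W0] \<zeta>1[OF i _ W0] by (metis image_eqI image_subsetI)
    qed
    show "\<zeta> (r + i) ` N = \<eta> i ` W" if i: "i < k" for i
    proof
      show "\<zeta> (r + i) ` N \<subseteq> \<eta> i ` W" using Nmem \<zeta>2[of "r + i"] by fastforce
      show "\<eta> i ` W \<subseteq> \<zeta> (r + i) ` N" using memN[OF V0] \<zeta>2[of "r + i", OF _ V0]
        by (smt (verit) add_diff_cancel_left' image_eqI image_subsetI not_add_less1)
    qed
    show "split_coords N (r + k) \<zeta>" unfolding split_coords_def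
    proof (intro conjI allI impI ballI)
      fix i assume i: "i < r + k"
      show "fract_hom N (\<zeta> i)" unfolding fract_hom_def
      proof (intro conjI ballI allI)
        fix x y assume "x \<in> N" "y \<in> N"
        then obtain v w v' w' where vw: "v \<in> V" "w \<in> W" "x = v + w" "v' \<in> V" "w' \<in> W" "y = v' + w'"
          using Nmem by metis
        then have xy: "x + y = (v + v') + (w + w')" "v + v' \<in> V" "w + w' \<in> W"
          using subspace_add N by auto
        show "\<zeta> i (x + y) = \<zeta> i x + \<zeta> i y"
        proof (cases "i < r")
          case True
          have "\<zeta> i (x + y) = \<theta> i (v + v')" using \<zeta>1[OF True xy(2,3)] xy(1) by simp
          then show ?thesis
            using fract_hom_add[OF split_coordsD(1)[OF V True] vw(1,4)] \<zeta>1[OF True vw(1,2)]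
              \<zeta>1[OF True vw(4,5)] vw(3,6) by simp
        next
          case False
          then have k: "i - r < k" using i by auto
          have "\<zeta> i (x + y) = \<eta> (i - r) (w + w')" using \<zeta>2[OF False xy(2,3)] xy(1) by simp
          then show ?thesis
            using fract_hom_add[OF split_coordsD(1)[OF W k] vw(2,5)] \<zeta>2[OF False vw(1,2)]
              \<zeta>2[OF False vw(4,5)] vw(3,6) by simp
        qed
      next
        fix a x assume "x \<in> N"
        then obtain v w where vw: "v \<in> V" "w \<in> W" "x = v + w" using Nmem by metis
        then have x: "a *s x = a *s v + a *s w" "a *s v \<in> V" "a *s w \<in> W"
          using subspace_scale N by (auto simp: scale_right_distrib)
        show "\<zeta> i (a *s x) = to_fract a * \<zeta> i x"
        proof (cases "i < r")
          case True
          have "\<zeta> i (a *s x) = \<theta> i (a *s v)" using \<zeta>1[OF True x(2,3)] x(1) by simp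
          then show ?thesis
            using fract_hom_scale[OF split_coordsD(1)[OF V True] vw(1)] \<zeta>1[OF True vw(1,2)] vw(3) by simp
        next
          case False
          then have k: "i - r < k" using i by auto
          have "\<zeta> i (a *s x) = \<eta> (i - r) (a *s w)" using \<zeta>2[OF False x(2,3)] x(1) by simp
          then show ?thesis
            using fract_hom_scale[OF split_coordsD(1)[OF W k] vw(2)] \<zeta>2[OF False vw(1,2)] vw(3) by simp
        qed
      qed
    next
      fix x assume "x \<in> N" and x0: "\<forall>i<r + k. \<zeta> i x = 0"
      then obtain v w where vw: "v \<in> V" "w \<in> W" "x = v + w" using Nmem by metis
      have "v = 0"
      proof (rule split_coordsD(2)[OF V vw(1)])
        fix i assume "i < r"
        then show "\<theta> i v = 0" using x0[rule_format, of i] \<zeta>1[of i v w] vw by simp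
      qed
      moreover have "w = 0"
      proof (rule split_coordsD(2)[OF W vw(2)])
        fix i assume "i < k"
        then show "\<eta> i w = 0" using x0[rule_format, of "r + i"] \<zeta>2[of "r + i" v w] vw by simp
      qed
      ultimately show "x = 0" using vw by simp
    next
      fix i x assume i: "i < r + k" and "x \<in> N"
      then obtain v w where vw: "v \<in> V" "w \<in> W" "x = v + w" using Nmem by metis
      show "\<exists>y\<in>N. \<zeta> i y = \<zeta> i x \<and> (\<forall>j<r + k. j \<noteq> i \<longrightarrow> \<zeta> j y = 0)"
      proof (cases "i < r")
        case True
        then obtain y where y: "y \<in> V" "\<theta> i y = \<theta> i v" "\<forall>j<r. j \<noteq> i \<longrightarrow> \<theta> j y = 0"
          using split_coordsD(3)[OF V True vw(1)] by auto
        have "\<zeta> j (y + 0) = 0" if "j < r + k" "j \<noteq> i" for j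
          using \<zeta>1[of j y 0] \<zeta>2[of j y 0] y W0 zW that by (cases "j < r") auto
        moreover have "\<zeta> i (y + 0) = \<zeta> i x" using \<zeta>1[OF True y(1) W0] \<zeta>1[OF True vw(1,2)] y(2) vw(3) by simp
        ultimately show ?thesis using memN[OF y(1) W0] by blast
      next
        case False
        then have ik: "i - r < k" using i by auto
        then obtain y where y: "y \<in> W" "\<eta> (i - r) y = \<eta> (i - r) w" "\<forall>j<k. j \<noteq> i - r \<longrightarrow> \<eta> j y = 0"
          using split_coordsD(3)[OF W ik vw(2)] by auto
        have "\<zeta> j (0 + y) = 0" if "j < r + k" "j \<noteq> i" for j
          using \<zeta>1[of j 0 y] \<zeta>2[of j 0 y] y V0 zV that False by (cases "j < r") auto
        moreover have "\<zeta> i (0 + y) = \<zeta> i x" using \<zeta>2[OF False V0 y(1)] \<zeta>2[OF False vw(1,2)] y(2) vw(3) by simp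
        ultimately show ?thesis using memN[OF V0 y(1)] by blast
      qed
    next
      fix i assume i: "i < r + k"
      show "\<exists>x\<in>N. \<zeta> i x \<noteq> 0"
      proof (cases "i < r")
        case True
        then obtain v where "v \<in> V" "\<theta> i v \<noteq> 0" using split_coordsD(4)[OF V] by auto
        then show ?thesis using memN[OF _ W0] \<zeta>1[OF True _ W0] by metis
      next
        case False
        then have "i - r < k" using i by auto
        then obtain w where "w \<in> W" "\<eta> (i - r) w \<noteq> 0" using split_coordsD(4)[OF W] by blast
        then show ?thesis using memN[OF V0] \<zeta>2[OF False V0] by metis
      qed
    qed
  qed
qed

lemma split_coords_line:
  assumes "fract_hom L \<psi>" "\<And>x. x \<in> L \<Longrightarrow> \<psi> x = 0 \<Longrightarrow> x = 0" "x \<in> L" "\<psi> x \<noteq> 0"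
  shows "split_coords L 1 (\<lambda>_. \<psi>)"
  using assms unfolding split_coords_def by auto

lemma split_off_decomposition:
  assumes N: "subspace N" and \<psi>: "fract_hom N \<psi>"
    and L: "subspace L" "L \<subseteq> N" "\<And>x. x \<in> L \<Longrightarrow> \<psi> x = 0 \<Longrightarrow> x = 0" "\<psi> ` L = \<psi> ` N"
  shows "{x \<in> N. \<psi> x = 0} \<inter> L = {0}"
    and "N = {v + w | v w. v \<in> {x \<in> N. \<psi> x = 0} \<and> w \<in> L}"
proof -
  show "{x \<in> N. \<psi> x = 0} \<inter> L = {0}"
    using L(3) subspace_0[OF N] subspace_0[OF L(1)] fract_hom_zero[OF \<psi>] by auto
  show "N = {v + w | v w. v \<in> {x \<in> N. \<psi> x = 0} \<and> w \<in> L}" (is "_ = ?S")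
  proof
    show "?S \<subseteq> N" using subspace_add[OF N] L(2) by auto
    show "N \<subseteq> ?S"
    proof
      fix x assume x: "x \<in> N"
      then obtain l where l: "l \<in> L" "\<psi> l = \<psi> x" using L(4) by (metis imageE image_eqI)
      have "x - l \<in> N" "\<psi> (x - l) = 0"
        using l x L(2) subspace_diff[OF N] fract_hom_diff[OF \<psi> N x, of l] by auto
      then show "x \<in> ?S" using l(1) by (intro sums_memI[of "x - l" _ l]) auto
    qed
  qed
qed

text \<open>The structure theorem for modules whose points are separated by finitely many integral
  functionals. The image of N under the next functional is zero, or it is an invertible ideal and
  splits off as a line. On the kernel the remaining functionals still separate points.\<close>

lemma split_coords_exists:
  assumes dedekind: "dedekind_domain TYPE('a)"
    and "subspace N" "\<And>l. l \<in> set ls \<Longrightarrow> fract_hom N l \<and> l ` N \<subseteq> \<O>"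
    and "\<And>x. x \<in> N \<Longrightarrow> (\<And>l. l \<in> set ls \<Longrightarrow> l x = 0) \<Longrightarrow> x = 0"
  shows "\<exists>r \<theta>. split_coords N r \<theta> \<and> (\<forall>i<r. \<theta> i ` N \<subseteq> \<O>)"
  using assms(2-)
proof (induction ls arbitrary: N)
  case Nil
  then have "split_coords N 0 (\<lambda>_ _. 0)" unfolding split_coords_def by auto
  then show ?case by blast
next
  case (Cons l ls)
  have l: "fract_hom N l" "l ` N \<subseteq> \<O>" using Cons.prems(2)[of l] by auto
  show ?case
  proof (cases "l ` N = {0}")
    case True
    then have "l x = 0" if "x \<in> N" for x using that by auto
    then have "x = 0" if "x \<in> N" "\<And>m. m \<in> set ls \<Longrightarrow> m x = 0" for x
      using that Cons.prems(3)[of x] by (metis set_ConsD)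
    then show ?thesis using Cons.prems(1,2) by (intro Cons.IH) auto
  next
    case False
    have "invertible_ideal (l ` N)"
      by (intro integral_ideal_invertible[OF dedekind] subspace_fract_hom_image Cons.prems l False)
    then obtain L where L: "subspace L" "L \<subseteq> N" "\<And>x. x \<in> L \<Longrightarrow> l x = 0 \<Longrightarrow> x = 0" "l ` L = l ` N"
      using split_off_invertible[OF Cons.prems(1) l(1)] by blast
    let ?K = "{x \<in> N. l x = 0}"
    have K: "subspace ?K" by (rule subspace_fract_hom_kernel[OF Cons.prems(1) l(1)])
    have "\<exists>r \<theta>. split_coords ?K r \<theta> \<and> (\<forall>i<r. \<theta> i ` ?K \<subseteq> \<O>)"
    proof (rule Cons.IH[OF K])
      fix m assume "m \<in> set ls"
      then show "fract_hom ?K m \<and> m ` ?K \<subseteq> \<O>"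
        using Cons.prems(2)[of m] fract_hom_subset[of N m ?K] by auto
    next
      fix x assume "x \<in> ?K" "\<And>m. m \<in> set ls \<Longrightarrow> m x = 0"
      then show "x = 0" using Cons.prems(3)[of x] by auto
    qed
    then obtain r \<theta> where \<theta>: "split_coords ?K r \<theta>" "\<And>i. i < r \<Longrightarrow> \<theta> i ` ?K \<subseteq> \<O>" by auto
    have "0 \<in> l ` N" using subspace_fract_hom_image[OF Cons.prems(1) l(1)] fract.subspace_0 by blast
    then obtain x where "x \<in> L" "l x \<noteq> 0" using False L(4) by force
    then have Lc: "split_coords L 1 (\<lambda>_. l)"
      by (intro split_coords_line L) (use fract_hom_subset[OF l(1) L(2)] in auto)
    obtain \<zeta> where \<zeta>: "split_coords N (r + 1) \<zeta>" "\<And>i. i < r \<Longrightarrow> \<zeta> i ` N = \<theta> i ` ?K"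
      "\<And>i. i < 1 \<Longrightarrow> \<zeta> (r + i) ` N = l ` L"
      using split_coords_sum[OF K L(1) split_off_decomposition[OF Cons.prems(1) l(1) L] \<theta>(1) Lc] by blast
    have "\<zeta> i ` N \<subseteq> \<O>" if "i < r + 1" for i
      using that \<zeta>(2)[of i] \<zeta>(3)[of 0] \<theta>(2)[of i] l(2) L(4) by (cases "i < r") (auto simp: less_Suc_eq)
    then show ?thesis using \<zeta>(1) by blast
  qed
qed

text \<open>These are the coordinates of an embedding into a free module. Finitely many suffice,
  since the images of finitely many generators have finite support.\<close>

lemma fg_projective_coordinates:
  assumes fg: "finitely_generated_module scale" and proj: "projective_module scale"
  obtains ls where "\<And>l. l \<in> set ls \<Longrightarrow> fract_hom UNIV l \<and> range l \<subseteq> \<O>"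
    and "\<And>x. (\<And>l. l \<in> set ls \<Longrightarrow> l x = 0) \<Longrightarrow> x = 0"
proof -
  obtain B where B: "finite B" "span B = UNIV" using fg unfolding finitely_generated_module_def by auto
  obtain i :: "'m \<Rightarrow> ('m \<Rightarrow>\<^sub>0 'a)" and p where i: "Modules.module_hom scale free_scale i"
    and p: "Modules.module_hom free_scale scale p" and pi: "p \<circ> i = id"
    using proj unfolding projective_module_def by auto
  interpret i: Modules.module_hom scale free_scale i by (rule i)
  interpret p: Modules.module_hom free_scale scale p by (rule p)
  define S where "S = (\<Union>b\<in>B. Poly_Mapping.keys (i b))"
  have S: "finite S" unfolding S_def using B(1) by auto
  have "span B \<subseteq> {x. Poly_Mapping.keys (i x) \<subseteq> S}"
  proof (rule span_minimal)
    show "B \<subseteq> {x. Poly_Mapping.keys (i x) \<subseteq> S}" unfolding S_def by auto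
    show "subspace {x. Poly_Mapping.keys (i x) \<subseteq> S}" unfolding subspace_def
    proof (intro conjI ballI allI; clarify)
      fix y assume "y \<in> Poly_Mapping.keys (i 0)" then show "y \<in> S" by simp
    next
      fix x y z assume "Poly_Mapping.keys (i x) \<subseteq> S" "Poly_Mapping.keys (i y) \<subseteq> S"
        "z \<in> Poly_Mapping.keys (i (x + y))"
      then show "z \<in> S" using Poly_Mapping.keys_add[of "i x" "i y"] by (auto simp: i.add)
    next
      fix c x z assume "Poly_Mapping.keys (i x) \<subseteq> S" "z \<in> Poly_Mapping.keys (i (c *s x))"
      then show "z \<in> S" by (auto simp: i.scale in_keys_iff lookup_free_scale)
    qed
  qed
  then have keys: "Poly_Mapping.keys (i x) \<subseteq> S" for x using B(2) by auto
  obtain js where js: "set js = S" using finite_list[OF S] by auto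
  show ?thesis
  proof (rule that[of "map (\<lambda>j x. to_fract (Poly_Mapping.lookup (i x) j)) js"])
    show "fract_hom UNIV l \<and> range l \<subseteq> \<O>"
      if "l \<in> set (map (\<lambda>j x. to_fract (Poly_Mapping.lookup (i x) j)) js)" for l
      using that by (auto simp: fract_hom_def i.add i.scale lookup_add lookup_free_scale)
    fix x assume x: "\<And>l. l \<in> set (map (\<lambda>j x. to_fract (Poly_Mapping.lookup (i x) j)) js) \<Longrightarrow> l x = 0"
    have "i x = 0"
    proof (rule poly_mapping_eqI)
      fix j
      show "Poly_Mapping.lookup (i x) j = Poly_Mapping.lookup 0 j"
      proof (cases "j \<in> S")
        case True
        then show ?thesis using x[of "\<lambda>x. to_fract (Poly_Mapping.lookup (i x) j)"] js by auto
      next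
        case False
        then show ?thesis using keys[of x] by (auto simp: in_keys_iff)
      qed
    qed
    then show "x = 0" using fun_cong[OF pi, of x] by simp
  qed
qed

end

section \<open>Rank\<close>

context idom_module
begin

section \<open>The tensor product with the fraction field\<close>

context
  fixes N :: "'m set"
  assumes N: "subspace N"
begin

private abbreviation "G \<equiv> free_Abelian_group (N \<times> (UNIV :: 'a fract set))"
private abbreviation "R \<equiv> tensor_relation_subgroup scale N"

private definition cls :: "('m \<times> 'a fract \<Rightarrow>\<^sub>0 int) \<Rightarrow> ('m \<times> 'a fract \<Rightarrow>\<^sub>0 int) set" where
  "cls z = R #>\<^bsub>G\<^esub> z"

private definition mulr :: "'a fract \<Rightarrow> ('m \<times> 'a fract \<Rightarrow>\<^sub>0 int) \<Rightarrow> ('m \<times> 'a fract \<Rightarrow>\<^sub>0 int)" where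
  "mulr c = frag_extend (\<lambda>(x, k). frag_of (x, c * k))"

text \<open>On representatives, the map from N \<otimes> K to K induced by \<theta>, which sends x
  \<otimes> k to k \<theta>(x).\<close>

private definition tev :: "('m \<Rightarrow> 'a fract) \<Rightarrow> ('m \<times> 'a fract \<Rightarrow>\<^sub>0 int) \<Rightarrow> 'a fract" where
  "tev \<theta> z = (\<Sum>p\<in>Poly_Mapping.keys z. of_int (Poly_Mapping.lookup z p) * (snd p * \<theta> (fst p)))"

private lemma tev_superset:
  assumes "finite S" "Poly_Mapping.keys z \<subseteq> S"
  shows "tev \<theta> z = (\<Sum>p\<in>S. of_int (Poly_Mapping.lookup z p) * (snd p * \<theta> (fst p)))"
  unfolding tev_def by (rule sum.mono_neutral_left) (use assms in \<open>auto simp: in_keys_iff\<close>)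

private lemma tev_simps:
  "tev \<theta> 0 = 0" "tev \<theta> (z + w) = tev \<theta> z + tev \<theta> w" "tev \<theta> (z - w) = tev \<theta> z - tev \<theta> w"
  "tev \<theta> (- z) = - tev \<theta> z" "tev \<theta> (frag_of (x, k)) = k * \<theta> x"
proof -
  let ?S = "Poly_Mapping.keys z \<union> Poly_Mapping.keys w"
  have S: "finite ?S" by simp
  show "tev \<theta> 0 = 0" by (simp add: tev_def)
  show "tev \<theta> (z + w) = tev \<theta> z + tev \<theta> w"
    by (subst (1 2 3) tev_superset[OF S])
       (use Poly_Mapping.keys_add[of z w] in \<open>auto simp: lookup_add sum.distrib algebra_simps\<close>)
  show "tev \<theta> (z - w) = tev \<theta> z - tev \<theta> w"
    by (subst (1 2 3) tev_superset[OF S])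
       (use Poly_Mapping.keys_diff[of z w] in \<open>auto simp: lookup_minus sum_subtractf algebra_simps\<close>)
  show "tev \<theta> (- z) = - tev \<theta> z"
    by (simp add: tev_def sum_negf keys_minus)
  show "tev \<theta> (frag_of (x, k)) = k * \<theta> x" by (simp add: tev_def keys_frag_of)
qed

private lemma relations_carrier: "tensor_relations scale N \<subseteq> carrier G"
proof -
  have "Poly_Mapping.keys (frag_of p - frag_of q - frag_of r) \<subseteq> N \<times> UNIV"
    if "p \<in> N \<times> UNIV" "q \<in> N \<times> UNIV" "r \<in> N \<times> UNIV" for p q r :: "'m \<times> 'a fract"
    using that Poly_Mapping.keys_diff[of "frag_of p - frag_of q" "frag_of r"]
      Poly_Mapping.keys_diff[of "frag_of p" "frag_of q"] by (auto simp: keys_frag_of)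
  moreover have "Poly_Mapping.keys (frag_of p - frag_of q) \<subseteq> N \<times> UNIV"
    if "p \<in> N \<times> UNIV" "q \<in> N \<times> UNIV" for p q :: "'m \<times> 'a fract"
    using that Poly_Mapping.keys_diff[of "frag_of p" "frag_of q"] by (auto simp: keys_frag_of)
  ultimately show ?thesis
    using subspace_add[OF N] subspace_scale[OF N] unfolding tensor_relations_def by auto
qed

private lemma R_subgroup: "subgroup R G"
  unfolding tensor_relation_subgroup_def
  by (rule group.generate_is_subgroup[OF group_free_Abelian_group relations_carrier])

private lemma R_carrier: "z \<in> R \<Longrightarrow> Poly_Mapping.keys z \<subseteq> N \<times> UNIV"
  using subgroup.mem_carrier[OF R_subgroup] by simp

private lemma R_0: "0 \<in> R" using subgroup.one_closed[OF R_subgroup] by simp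

private lemma R_add: "z \<in> R \<Longrightarrow> w \<in> R \<Longrightarrow> z + w \<in> R"
  using subgroup.m_closed[OF R_subgroup, of z w] by simp

private lemma R_minus: "z \<in> R \<Longrightarrow> - z \<in> R"
  using subgroup.m_inv_closed[OF R_subgroup, of z] R_carrier by simp

private lemma R_diff: "z \<in> R \<Longrightarrow> w \<in> R \<Longrightarrow> z - w \<in> R"
  using R_add[OF _ R_minus, of z w] by simp

private lemma R_sum: "(\<And>i. i \<in> I \<Longrightarrow> f i \<in> R) \<Longrightarrow> sum f I \<in> R"
  by (induction I rule: infinite_finite_induct) (auto intro: R_0 R_add)

private lemma R_relations:
  "x \<in> N \<Longrightarrow> y \<in> N \<Longrightarrow> frag_of (x + y, k) - frag_of (x, k) - frag_of (y, k) \<in> R"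
  "x \<in> N \<Longrightarrow> frag_of (x, k + l) - frag_of (x, k) - frag_of (x, l) \<in> R"
  "x \<in> N \<Longrightarrow> frag_of (a *s x, k) - frag_of (x, to_fract a * k) \<in> R"
  unfolding tensor_relation_subgroup_def tensor_relations_def fract_scale_def
  by (rule generate.incl, blast)+

text \<open>Closure under differences stands for closure under sums and inverses, in the same shape
  as \<open>frag_induction\<close>.\<close>

private lemma R_induct [consumes 1, case_names zero rel diff]:
  assumes "z \<in> R" "P 0" "\<And>z. z \<in> tensor_relations scale N \<Longrightarrow> P z"
    "\<And>z w. z \<in> R \<Longrightarrow> w \<in> R \<Longrightarrow> P z \<Longrightarrow> P w \<Longrightarrow> P (z - w)"
  shows "P z"
proof -
  have neg: "z \<in> R \<Longrightarrow> P z \<Longrightarrow> P (- z)" for z using assms(4)[OF R_0 _ assms(2), of z] by simp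
  have "P z \<and> z \<in> R"
    using assms(1) unfolding tensor_relation_subgroup_def
  proof (induction rule: generate.induct)
    case one
    then show ?case using assms(2) R_0 by (simp add: tensor_relation_subgroup_def)
  next
    case (incl h)
    then show ?case using assms(3) by (auto intro: generate.incl)
  next
    case (inv h)
    then have "h \<in> R" unfolding tensor_relation_subgroup_def by (rule generate.incl)
    then have "P (- h)" "- h \<in> R" using neg assms(3) inv R_minus by auto
    moreover have "inv\<^bsub>G\<^esub> h = - h" using R_carrier[OF \<open>h \<in> R\<close>] by simp
    ultimately show ?case by (simp add: tensor_relation_subgroup_def)
  next
    case (eng h1 h2)
    then have h: "h1 \<in> R" "h2 \<in> R" "P h1" "P h2" by (simp_all add: tensor_relation_subgroup_def)
    then have "P (h1 - (- h2))" using assms(4) neg R_minus by blast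
    then show ?case using R_add[OF h(1,2)] by (simp add: tensor_relation_subgroup_def)
  qed
  then show ?thesis ..
qed

private lemma relation_cases:
  assumes "z \<in> tensor_relations scale N"
  obtains x y k where "x \<in> N" "y \<in> N" "z = frag_of (x + y, k) - frag_of (x, k) - frag_of (y, k)"
    | x k l where "x \<in> N" "z = frag_of (x, k + l) - frag_of (x, k) - frag_of (x, l)"
    | a x k where "x \<in> N" "z = frag_of (a *s x, k) - frag_of (x, to_fract a * k)"
  using assms unfolding tensor_relations_def fract_scale_def by blast

private lemma tev_R:
  assumes "fract_hom N \<theta>" "z \<in> R" shows "tev \<theta> z = 0"
  using assms(2)
proof (induction rule: R_induct)
  case (rel z)
  then show ?case
    by (cases z rule: relation_cases)
       (simp_all add: tev_simps fract_hom_add[OF assms(1)] fract_hom_scale[OF assms(1)] distrib_left distrib_right mult_ac)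
qed (auto simp: tev_simps)

private lemma cls_eq_iff: "cls z = cls w \<longleftrightarrow> z - w \<in> R"
proof
  assume "cls z = cls w"
  moreover have "z \<in> cls z" unfolding cls_def r_coset_def using R_0 by force
  ultimately obtain r where "r \<in> R" "z = r + w" unfolding cls_def r_coset_def by auto
  then show "z - w \<in> R" by simp
next
  assume zw: "z - w \<in> R"
  have "cls z \<subseteq> cls w" if "z - w \<in> R" for z w
  proof
    fix y assume "y \<in> cls z"
    then obtain r where r: "r \<in> R" "y = r + z" unfolding cls_def r_coset_def by auto
    then have "y = (r + (z - w)) + w" by simp
    then show "y \<in> cls w" using R_add[OF r(1) that] unfolding cls_def r_coset_def by force
  qed
  from this[OF zw] this[of w z] show "cls z = cls w" using R_minus[OF zw] by auto
qed

private lemma mulr_simps: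
  "mulr c 0 = 0" "mulr c (z - w) = mulr c z - mulr c w" "mulr c (z + w) = mulr c z + mulr c w"
  "mulr c (frag_of (x, k)) = frag_of (x, c * k)"
  by (simp_all add: mulr_def frag_extend_diff frag_extend_add)

private lemma mulr_carrier: "Poly_Mapping.keys z \<subseteq> N \<times> UNIV \<Longrightarrow> Poly_Mapping.keys (mulr c z) \<subseteq> N \<times> UNIV"
  unfolding mulr_def using keys_frag_extend by (fastforce simp: keys_frag_of split: prod.splits)

private lemma mulr_R: "z \<in> R \<Longrightarrow> mulr c z \<in> R"
proof (induction rule: R_induct)
  case (rel z)
  then show ?case
  proof (cases z rule: relation_cases)
    case 1
    then show ?thesis using R_relations(1) by (simp add: mulr_simps)
  next
    case 2
    then show ?thesis using R_relations(2) by (simp add: mulr_simps distrib_left)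
  next
    case (3 a x k)
    then show ?thesis using R_relations(3)[of x a "c * k"] by (simp add: mulr_simps mult_ac)
  qed
qed (auto simp: mulr_simps R_0 R_diff)

private abbreviation "V \<equiv> tensor_fract scale N"

private lemma tensor_fract_carrier: "carrier V = cls ` carrier G"
  unfolding tensor_fract_def tensor_group_def FactGroup_def RCOSETS_def cls_def by auto

private lemma tensor_fract_zero: "\<zero>\<^bsub>V\<^esub> = cls 0"
  unfolding tensor_fract_def tensor_group_def FactGroup_def cls_def r_coset_def by auto

private lemma tensor_fract_add: "cls z \<oplus>\<^bsub>V\<^esub> cls w = cls (z + w)"
proof -
  have "cls z \<oplus>\<^bsub>V\<^esub> cls w = {h + k | h k. h \<in> cls z \<and> k \<in> cls w}"
    unfolding tensor_fract_def tensor_group_def FactGroup_def set_mult_def by auto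
  also have "\<dots> = cls (z + w)"
  proof (intro equalityI subsetI)
    fix y assume "y \<in> {h + k | h k. h \<in> cls z \<and> k \<in> cls w}"
    then obtain r s where "r \<in> R" "s \<in> R" "y = (r + z) + (s + w)"
      unfolding cls_def r_coset_def by auto
    then have "r + s \<in> R" "y = (r + s) + (z + w)" by (auto intro: R_add)
    then show "y \<in> cls (z + w)" unfolding cls_def r_coset_def by auto
  next
    fix y assume "y \<in> cls (z + w)"
    then obtain r where r: "r \<in> R" "y = r + (z + w)" unfolding cls_def r_coset_def by auto
    then have "y = (r + z) + (0 + w)" by simp
    moreover have "r + z \<in> cls z" "0 + w \<in> cls w"
      unfolding cls_def r_coset_def mult_free_Abelian_group using r(1) R_0 by blast+
    ultimately show "y \<in> {h + k | h k. h \<in> cls z \<and> k \<in> cls w}" by blast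
  qed
  finally show ?thesis .
qed

private lemma tensor_fract_smult: "c \<odot>\<^bsub>V\<^esub> cls z = cls (mulr c z)"
proof -
  have "c \<odot>\<^bsub>V\<^esub> cls z = (\<Union>y\<in>cls z. cls (mulr c y))"
    unfolding tensor_fract_def cls_def mulr_def by simp
  also have "\<dots> = (\<Union>y\<in>cls z. cls (mulr c z))"
  proof (rule SUP_cong[OF refl])
    fix y assume "y \<in> cls z"
    then obtain r where "r \<in> R" "y = r + z" unfolding cls_def r_coset_def by auto
    then have "mulr c y - mulr c z \<in> R" using mulr_R[of r c] by (simp add: mulr_simps)
    then show "cls (mulr c y) = cls (mulr c z)" by (simp add: cls_eq_iff)
  qed
  also have "\<dots> = cls (mulr c z)"
    using R_0 unfolding cls_def r_coset_def by auto
  finally show ?thesis .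
qed

private lemma mulr_add_scalar:
  assumes "Poly_Mapping.keys z \<subseteq> N \<times> UNIV"
  shows "mulr (c + d) z - (mulr c z + mulr d z) \<in> R"
  using assms
proof (induction rule: frag_induction)
  case (one p)
  then obtain x k where "p = (x, k)" "x \<in> N" by auto
  then show ?case using R_relations(2)[of x "c * k" "d * k"]
    by (simp add: mulr_simps algebra_simps)
next
  case (diff z w)
  have "mulr (c + d) (z - w) - (mulr c (z - w) + mulr d (z - w)) =
    (mulr (c + d) z - (mulr c z + mulr d z)) - (mulr (c + d) w - (mulr c w + mulr d w))"
    by (simp add: mulr_simps)
  then show ?case using R_diff[OF diff] by simp
qed (simp add: mulr_simps R_0)

private lemma mulr_mulr: "mulr c (mulr d z) = mulr (c * d) z"
proof -
  have "Poly_Mapping.keys z \<subseteq> UNIV" by simp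
  then show ?thesis
    by (induction rule: frag_induction) (auto simp: mulr_simps mult.assoc)
qed

private lemma mulr_1: "mulr 1 z = z"
proof -
  have "Poly_Mapping.keys z \<subseteq> UNIV" by simp
  then show ?thesis by (induction rule: frag_induction) (auto simp: mulr_simps)
qed

private lemma vectorspace_tensor_fract: "vectorspace class_ring V"
proof (rule vs_criteria)
  show "field (class_ring :: 'a fract ring)" by (rule class_field)
  have V: "\<exists>z. Poly_Mapping.keys z \<subseteq> N \<times> UNIV \<and> v = cls z" if v: "v \<in> carrier V" for v
  proof -
    obtain z where "z \<in> carrier G" "v = cls z" using v unfolding tensor_fract_carrier by (elim imageE)
    then show ?thesis by (intro exI[of _ z]) simp
  qed
  have clsV: "cls z \<in> carrier V" if "Poly_Mapping.keys z \<subseteq> N \<times> UNIV" for z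
    using that unfolding tensor_fract_carrier by auto
  have keys_plus: "Poly_Mapping.keys (z + w) \<subseteq> N \<times> UNIV"
    if "Poly_Mapping.keys z \<subseteq> N \<times> UNIV" "Poly_Mapping.keys w \<subseteq> N \<times> UNIV"
    for z w :: "'m \<times> 'a fract \<Rightarrow>\<^sub>0 int"
    using that Poly_Mapping.keys_add[of z w] by auto
  show "\<zero>\<^bsub>V\<^esub> \<in> carrier V" unfolding tensor_fract_zero by (rule clsV) simp
  show "\<forall>v w. v \<in> carrier V \<and> w \<in> carrier V \<longrightarrow> v \<oplus>\<^bsub>V\<^esub> w \<in> carrier V"
    using V clsV keys_plus tensor_fract_add by metis
  show "\<forall>v\<in>carrier V. \<exists>u\<in>carrier V. v \<oplus>\<^bsub>V\<^esub> u = \<zero>\<^bsub>V\<^esub>"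
  proof
    fix v assume "v \<in> carrier V"
    then obtain z where z: "Poly_Mapping.keys z \<subseteq> N \<times> UNIV" "v = cls z" using V by auto
    then have "v \<oplus>\<^bsub>V\<^esub> cls (- z) = \<zero>\<^bsub>V\<^esub>" by (simp add: tensor_fract_add tensor_fract_zero)
    moreover have "cls (- z) \<in> carrier V" using z(1) by (intro clsV) (simp add: keys_minus)
    ultimately show "\<exists>u\<in>carrier V. v \<oplus>\<^bsub>V\<^esub> u = \<zero>\<^bsub>V\<^esub>" by blast
  qed
  show "\<forall>c v. c \<in> carrier class_ring \<and> v \<in> carrier V \<longrightarrow> c \<odot>\<^bsub>V\<^esub> v \<in> carrier V"
    using V clsV mulr_carrier tensor_fract_smult by metis
  show "\<forall>v w. v \<in> carrier V \<and> w \<in> carrier V \<longrightarrow> v \<oplus>\<^bsub>V\<^esub> w = w \<oplus>\<^bsub>V\<^esub> v"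
    using V tensor_fract_add by (metis add.commute)
  show "\<forall>v w x. v \<in> carrier V \<and> w \<in> carrier V \<and> x \<in> carrier V \<longrightarrow>
      v \<oplus>\<^bsub>V\<^esub> w \<oplus>\<^bsub>V\<^esub> x = v \<oplus>\<^bsub>V\<^esub> (w \<oplus>\<^bsub>V\<^esub> x)"
    using V tensor_fract_add by (metis add.assoc)
  show "\<forall>v\<in>carrier V. v \<oplus>\<^bsub>V\<^esub> \<zero>\<^bsub>V\<^esub> = v"
    using V tensor_fract_add tensor_fract_zero by (metis add_0_right)
  show "\<forall>a b v. a \<in> carrier class_ring \<and> b \<in> carrier class_ring \<and> v \<in> carrier V \<longrightarrow>
      (a \<otimes>\<^bsub>class_ring\<^esub> b) \<odot>\<^bsub>V\<^esub> v = a \<odot>\<^bsub>V\<^esub> (b \<odot>\<^bsub>V\<^esub> v)"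
  proof (intro allI impI, elim conjE)
    fix a b v assume "v \<in> carrier V"
    then obtain z where "v = cls z" using V by auto
    then show "(a \<otimes>\<^bsub>class_ring\<^esub> b) \<odot>\<^bsub>V\<^esub> v = a \<odot>\<^bsub>V\<^esub> (b \<odot>\<^bsub>V\<^esub> v)"
      by (simp add: tensor_fract_smult mulr_mulr)
  qed
  show "\<forall>v\<in>carrier V. \<one>\<^bsub>class_ring\<^esub> \<odot>\<^bsub>V\<^esub> v = v"
  proof
    fix v assume "v \<in> carrier V"
    then obtain z where "v = cls z" using V by auto
    then show "\<one>\<^bsub>class_ring\<^esub> \<odot>\<^bsub>V\<^esub> v = v" by (simp add: tensor_fract_smult mulr_1)
  qed
  show "\<forall>a b v. a \<in> carrier class_ring \<and> b \<in> carrier class_ring \<and> v \<in> carrier V \<longrightarrow>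
      (a \<oplus>\<^bsub>class_ring\<^esub> b) \<odot>\<^bsub>V\<^esub> v = a \<odot>\<^bsub>V\<^esub> v \<oplus>\<^bsub>V\<^esub> b \<odot>\<^bsub>V\<^esub> v"
  proof (intro allI impI, elim conjE)
    fix a b v assume "v \<in> carrier V"
    then obtain z where "Poly_Mapping.keys z \<subseteq> N \<times> UNIV" "v = cls z" using V by auto
    then show "(a \<oplus>\<^bsub>class_ring\<^esub> b) \<odot>\<^bsub>V\<^esub> v = a \<odot>\<^bsub>V\<^esub> v \<oplus>\<^bsub>V\<^esub> b \<odot>\<^bsub>V\<^esub> v"
      by (simp add: tensor_fract_smult tensor_fract_add cls_eq_iff mulr_add_scalar)
  qed
  show "\<forall>a v w. a \<in> carrier class_ring \<and> v \<in> carrier V \<and> w \<in> carrier V \<longrightarrow>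
      a \<odot>\<^bsub>V\<^esub> (v \<oplus>\<^bsub>V\<^esub> w) = a \<odot>\<^bsub>V\<^esub> v \<oplus>\<^bsub>V\<^esub> a \<odot>\<^bsub>V\<^esub> w"
  proof (intro allI impI, elim conjE)
    fix a v w assume "v \<in> carrier V" "w \<in> carrier V"
    then obtain z y where "v = cls z" "w = cls y" using V by metis
    then show "a \<odot>\<^bsub>V\<^esub> (v \<oplus>\<^bsub>V\<^esub> w) = a \<odot>\<^bsub>V\<^esub> v \<oplus>\<^bsub>V\<^esub> a \<odot>\<^bsub>V\<^esub> w"
      by (simp add: tensor_fract_smult tensor_fract_add mulr_simps)
  qed
qed

private lemma frag_of_0_R: "frag_of (0, k) \<in> R"
  using R_minus[OF R_relations(1)[OF subspace_0[OF N] subspace_0[OF N], of k]] by simp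

text \<open>Common denominators: the difference of x \<otimes> 1/d and y \<otimes> 1/e is (e x - d
  y) \<otimes> 1/(d e).\<close>

private lemma tensor_pure:
  assumes "Poly_Mapping.keys z \<subseteq> N \<times> UNIV"
  shows "\<exists>x\<in>N. \<exists>d. d \<noteq> 0 \<and> z - frag_of (x, 1 / to_fract d) \<in> R"
  using assms
proof (induction rule: frag_induction)
  case zero
  show ?case
    using R_minus[OF frag_of_0_R] subspace_0[OF N] by (intro bexI[of _ 0] exI[of _ 1]) auto
next
  case (one p)
  then obtain x k where p: "p = (x, k)" "x \<in> N" by auto
  obtain a b where ab: "k = to_fract a / to_fract b" "b \<noteq> 0" using fract_quotient .
  have "- (frag_of (a *s x, 1 / to_fract b) - frag_of (x, to_fract a * (1 / to_fract b))) \<in> R"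
    using p by (intro R_minus R_relations)
  then have "frag_of p - frag_of (a *s x, 1 / to_fract b) \<in> R" by (simp add: p(1) ab(1))
  then show ?case using ab(2) subspace_scale[OF N p(2)] by blast
next
  case (diff z w)
  then obtain x d y e where x: "x \<in> N" "d \<noteq> 0" "z - frag_of (x, 1 / to_fract d) \<in> R"
    and y: "y \<in> N" "e \<noteq> 0" "w - frag_of (y, 1 / to_fract e) \<in> R" by blast
  let ?q = "1 / to_fract (d * e)" and ?u = "e *s x - d *s y"
  have u: "?u \<in> N" using x y by (intro subspace_diff[OF N] subspace_scale[OF N])
  have "frag_of (e *s x, ?q) - frag_of (x, to_fract e * ?q) \<in> R" using x by (intro R_relations)
  then have 1: "frag_of (e *s x, ?q) - frag_of (x, 1 / to_fract d) \<in> R" using y(2) by simp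
  have "frag_of (d *s y, ?q) - frag_of (y, to_fract d * ?q) \<in> R" using y by (intro R_relations)
  then have 2: "frag_of (d *s y, ?q) - frag_of (y, 1 / to_fract e) \<in> R" using x(2) by simp
  have 3: "frag_of (?u + d *s y, ?q) - frag_of (?u, ?q) - frag_of (d *s y, ?q) \<in> R"
    by (intro R_relations u subspace_scale[OF N y(1)])
  have "(z - frag_of (x, 1 / to_fract d)) - (w - frag_of (y, 1 / to_fract e))
      - (frag_of (e *s x, ?q) - frag_of (x, 1 / to_fract d))
      + (frag_of (d *s y, ?q) - frag_of (y, 1 / to_fract e))
      + (frag_of (?u + d *s y, ?q) - frag_of (?u, ?q) - frag_of (d *s y, ?q)) \<in> R"
    by (intro R_add R_diff x y 1 2 3)
  then have "z - w - frag_of (?u, ?q) \<in> R" by (simp add: algebra_simps)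
  then show ?case using u x(2) y(2) by (intro bexI[OF _ u] exI[of _ "d * e"]) auto
qed

text \<open>This is the injectivity of the map N \<otimes> K \<rightarrow> K^r given by the
  coordinates. On a pure tensor x \<otimes> 1/d it reduces to the injectivity of the coordinates on
  N.\<close>

private lemma tev_eq_0_imp_R:
  assumes "split_coords N r \<theta>" "Poly_Mapping.keys z \<subseteq> N \<times> UNIV" "\<And>j. j < r \<Longrightarrow> tev (\<theta> j) z = 0"
  shows "z \<in> R"
proof -
  obtain x d where x: "x \<in> N" "d \<noteq> 0" "z - frag_of (x, 1 / to_fract d) \<in> R"
    using tensor_pure[OF assms(2)] by auto
  have "\<theta> j x = 0" if j: "j < r" for j
    using tev_R[OF split_coordsD(1)[OF assms(1) j] x(3)] assms(3)[OF j] x(2) by (simp add: tev_simps)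
  then have "x = 0" using split_coordsD(2)[OF assms(1) x(1)] by auto
  then show ?thesis using R_add[OF x(3) frag_of_0_R[of "1 / to_fract d"]] by simp
qed

text \<open>Elements y_j of N, each with only the jth coordinate nonzero, define a linear bijection
  from K^r to N \<otimes> K. From here on ranks are read off from coordinates, without tensor
  products.\<close>

lemma module_rank_split_coords:
  assumes \<theta>: "split_coords N r \<theta>"
  shows "module_rank scale N = r"
proof -
  have "\<exists>y\<in>N. \<theta> j y \<noteq> 0 \<and> (\<forall>i<r. i \<noteq> j \<longrightarrow> \<theta> i y = 0)" if "j < r" for j
    using split_coordsD(3,4)[OF \<theta> that] by metis
  then obtain y where y: "\<And>j. j < r \<Longrightarrow> y j \<in> N" "\<And>j. j < r \<Longrightarrow> \<theta> j (y j) \<noteq> 0"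
    "\<And>i j. i < r \<Longrightarrow> j < r \<Longrightarrow> i \<noteq> j \<Longrightarrow> \<theta> i (y j) = 0" by metis
  define W where "W = (module_vec TYPE('a fract) r :: ('a fract, 'a fract vec) module)"
  interpret vec: vec_space "TYPE('a fract)" r .
  have W_vs: "vectorspace class_ring W" unfolding W_def by (rule vec.vectorspace_axioms)
  define g where "g v = (\<Sum>j<r. frag_of (y j, v $ j))" for v :: "'a fract vec"
  define T where "T v = cls (g v)" for v
  have g_keys: "Poly_Mapping.keys (g v) \<subseteq> N \<times> UNIV" for v
  proof -
    have "Poly_Mapping.keys (g v) \<subseteq> (\<Union>j<r. Poly_Mapping.keys (frag_of (y j, v $ j)))"
      unfolding g_def by (rule Poly_Mapping.keys_sum)
    then show ?thesis using y(1) by (auto simp: keys_frag_of)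
  qed
  have tev_sum: "tev \<eta> (sum f I) = (\<Sum>i\<in>I. tev \<eta> (f i))" for \<eta> f and I :: "nat set"
    by (induction I rule: infinite_finite_induct) (auto simp: tev_simps)
  have tev_g: "tev (\<theta> j) (g v) = v $ j * \<theta> j (y j)" if j: "j < r" for j v
  proof -
    have "tev (\<theta> j) (g v) = (\<Sum>i<r. v $ i * \<theta> j (y i))" by (simp add: g_def tev_sum tev_simps)
    also have "\<dots> = (\<Sum>i\<in>{j}. v $ i * \<theta> j (y i))"
      by (rule sum.mono_neutral_right) (use j y(3) in auto)
    finally show ?thesis by simp
  qed
  have "linear_map class_ring W V T"
  proof (intro linear_map.intro mod_hom.intro mod_hom_axioms.intro W_vs vectorspace_tensor_fract)
    show "Module.module class_ring W" "Module.module class_ring V"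
      using W_vs vectorspace_tensor_fract by (auto simp: vectorspace_def)
    show "T \<in> LinearCombinations.module_hom class_ring W V"
      unfolding LinearCombinations.module_hom_def
    proof (intro CollectI conjI allI impI)
      show "T \<in> carrier W \<rightarrow> carrier V"
        unfolding T_def tensor_fract_carrier using g_keys by auto
      fix v w assume vw: "v \<in> carrier W \<and> w \<in> carrier W"
      then have d: "v \<in> carrier_vec r" "w \<in> carrier_vec r" by (auto simp: W_def module_vec_def)
      have "g (v + w) - (g v + g w) = (\<Sum>j<r. frag_of (y j, v $ j + w $ j) - frag_of (y j, v $ j) - frag_of (y j, w $ j))"
        using d by (simp add: g_def sum_subtractf)
      also have "\<dots> \<in> R" using y(1) by (intro R_sum R_relations) auto
      finally show "T (v \<oplus>\<^bsub>W\<^esub> w) = T v \<oplus>\<^bsub>V\<^esub> T w"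
        by (simp add: T_def W_def module_vec_def tensor_fract_add cls_eq_iff)
    next
      fix c v assume "c \<in> carrier (class_ring :: 'a fract ring) \<and> v \<in> carrier W"
      then have d: "v \<in> carrier_vec r" by (auto simp: W_def module_vec_def)
      have "mulr c (sum f I) = (\<Sum>i\<in>I. mulr c (f i))" for f and I :: "nat set"
        by (induction I rule: infinite_finite_induct) (auto simp: mulr_simps)
      then have "g (c \<cdot>\<^sub>v v) = mulr c (g v)" using d by (simp add: g_def mulr_simps)
      then show "T (c \<odot>\<^bsub>W\<^esub> v) = c \<odot>\<^bsub>V\<^esub> T v"
        by (simp add: T_def W_def module_vec_def tensor_fract_smult)
    qed
  qed
  then interpret T: linear_map class_ring W V T .
  have "vectorspace.dim class_ring W = vectorspace.dim class_ring V"
  proof (rule T.dim_eq)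
    show "vectorspace.fin_dim class_ring W" unfolding W_def by (rule vec.fin_dim)
    show "inj_on T (carrier W)"
    proof (rule inj_onI)
      fix v w assume "v \<in> carrier W" "w \<in> carrier W" "T v = T w"
      then have d: "v \<in> carrier_vec r" "w \<in> carrier_vec r" and "g v - g w \<in> R"
        by (auto simp: W_def module_vec_def T_def cls_eq_iff)
      then have "v $ j * \<theta> j (y j) - w $ j * \<theta> j (y j) = 0" if j: "j < r" for j
        using tev_R[OF split_coordsD(1)[OF \<theta> j], of "g v - g w"] by (simp add: tev_simps tev_g[OF j])
      then show "v = w" using d y(2) by (intro eq_vecI) (auto simp flip: left_diff_distrib)
    qed
    show "T ` carrier W = carrier V"
    proof
      show "T ` carrier W \<subseteq> carrier V" unfolding T_def tensor_fract_carrier using g_keys by auto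
      show "carrier V \<subseteq> T ` carrier W"
      proof
        fix A assume "A \<in> carrier V"
        then obtain z where z: "Poly_Mapping.keys z \<subseteq> N \<times> UNIV" "A = cls z"
          unfolding tensor_fract_carrier by auto
        \<comment> \<open>The jth coordinate of g v is v_j \<theta>_j(y_j), so this v matches all
          coordinates of z.\<close>
        define v where "v = Matrix.vec r (\<lambda>j. tev (\<theta> j) z / \<theta> j (y j))"
        have "z - g v \<in> R"
        proof (rule tev_eq_0_imp_R[OF \<theta>])
          show "Poly_Mapping.keys (z - g v) \<subseteq> N \<times> UNIV"
            using z(1) g_keys[of v] Poly_Mapping.keys_diff[of z "g v"] by blast
          show "tev (\<theta> j) (z - g v) = 0" if j: "j < r" for j
            using y(2)[OF j] j by (simp add: tev_simps tev_g v_def)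
        qed
        then have "A = T v" by (simp add: T_def z(2) cls_eq_iff)
        moreover have "v \<in> carrier W" by (simp add: v_def W_def module_vec_def)
        ultimately show "A \<in> T ` carrier W" by blast
      qed
    qed
  qed
  moreover have "vectorspace.dim class_ring W = r" unfolding W_def by (rule vec.dim_is_n)
  ultimately show ?thesis by (simp add: module_rank_def)
qed

end

end

section \<open>Ranks of submodules of a finitely generated projective module\<close>

locale fg_projective = idom_module scale
  for scale :: "'a::idom \<Rightarrow> 'm::ab_group_add \<Rightarrow> 'm" (infixr \<open>*s\<close> 75) +
  assumes dedekind: "dedekind_domain TYPE('a)"
    and fg: "finitely_generated_module scale"
    and proj: "projective_module scale"
begin

abbreviation rank :: "'m set \<Rightarrow> nat" where "rank \<equiv> module_rank scale"

text \<open>Functionals that separate the points of M also separate those of any submodule, summand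
  or not.\<close>

lemma subspace_coords:
  assumes "subspace N"
  obtains \<theta> where "split_coords N (rank N) \<theta>" "\<And>i. i < rank N \<Longrightarrow> \<theta> i ` N \<subseteq> \<O>"
proof -
  obtain ls where ls: "\<And>l. l \<in> set ls \<Longrightarrow> fract_hom UNIV l \<and> range l \<subseteq> \<O>"
    "\<And>x. (\<And>l. l \<in> set ls \<Longrightarrow> l x = 0) \<Longrightarrow> x = 0"
    using fg_projective_coordinates[OF fg proj] by blast
  have "\<exists>r \<theta>. split_coords N r \<theta> \<and> (\<forall>i<r. \<theta> i ` N \<subseteq> \<O>)"
  proof (rule split_coords_exists[OF dedekind assms, of ls])
    fix l assume "l \<in> set ls"
    then show "fract_hom N l \<and> l ` N \<subseteq> \<O>" using ls(1)[of l] fract_hom_subset[of UNIV l N] by auto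
  qed (rule ls(2))
  then obtain r \<theta> where "split_coords N r \<theta>" "\<forall>i<r. \<theta> i ` N \<subseteq> \<O>" by auto
  then show ?thesis using that[of \<theta>] module_rank_split_coords[OF assms] by auto
qed

lemma rank_sum:
  assumes "subspace V" "subspace W" "V \<inter> W = {0}" "subspace N" "N = {v + w | v w. v \<in> V \<and> w \<in> W}"
  shows "rank N = rank V + rank W"
proof -
  obtain \<theta> \<eta> where "split_coords V (rank V) \<theta>" "split_coords W (rank W) \<eta>"
    using subspace_coords assms(1,2) by metis
  then obtain \<zeta> where "split_coords N (rank V + rank W) \<zeta>"
    using split_coords_sum[OF assms(1-3,5)] by metis
  then show ?thesis using module_rank_split_coords[OF assms(4)] by simp
qed

lemma rank_0_imp: assumes "subspace N" "rank N = 0" shows "N = {0}"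
proof -
  obtain \<theta> where "split_coords N 0 \<theta>" using subspace_coords[OF assms(1)] assms(2) by metis
  then show ?thesis using split_coordsD(2) subspace_0[OF assms(1)] by blast
qed

text \<open>If V' is a complement of V, the modular law gives W = V \<oplus> (W \<inter> V'), and
  the second part has positive rank. A proper submodule that is not a summand can have full
  rank.\<close>

lemma rank_less:
  assumes V: "direct_summand scale V" and W: "subspace W" "V \<subset> W"
  shows "rank V < rank W"
proof -
  obtain V' where V': "subspace V" "subspace V'" "V \<inter> V' = {0}" "{x + y | x y. x \<in> V \<and> y \<in> V'} = UNIV"
    using V unfolding direct_summand_def by auto
  have WV: "W = {v + w | v w. v \<in> V \<and> w \<in> W \<inter> V'}"
  proof
    show "{v + w | v w. v \<in> V \<and> w \<in> W \<inter> V'} \<subseteq> W" using W subspace_add[OF W(1)] by auto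
    show "W \<subseteq> {v + w | v w. v \<in> V \<and> w \<in> W \<inter> V'}"
    proof
      fix x assume x: "x \<in> W"
      obtain v v' where v: "v \<in> V" "v' \<in> V'" "x = v + v'" using V'(4) by blast
      then have "x - v \<in> W" using subspace_diff[OF W(1) x, of v] W(2) by blast
      then have "v' \<in> W" using v(3) by simp
      then show "x \<in> {v + w | v w. v \<in> V \<and> w \<in> W \<inter> V'}" using v by blast
    qed
  qed
  have sub: "subspace (W \<inter> V')" using subspace_inter W(1) V'(2) by auto
  have "rank W = rank V + rank (W \<inter> V')"
    by (rule rank_sum[OF V'(1) sub _ W(1) WV]) (use V'(3) W subspace_0[OF sub] in auto)
  moreover have "rank (W \<inter> V') \<noteq> 0"
  proof
    assume "rank (W \<inter> V') = 0"
    then have "W \<inter> V' = {0}" by (rule rank_0_imp[OF sub])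
    then have "W \<subseteq> V" using WV by auto
    then show False using W(2) by auto
  qed
  ultimately show ?thesis by simp
qed

text \<open>Ranks grow strictly along a chain of summands and stay strictly between 0 and n. A chain
  thus has at most n - 1 members, while the simplices one dimension up have n vertices.\<close>

lemma order_boundaries_summand_poset:
  assumes "2 \<le> rank UNIV"
  shows "order_boundaries (summand_poset scale) (rank UNIV - 2) = {0}"
proof -
  have "order_simplices (summand_poset scale) (Suc (rank UNIV - 2)) = {}"
  proof (rule ccontr)
    assume "order_simplices (summand_poset scale) (Suc (rank UNIV - 2)) \<noteq> {}"
    then obtain xs where xs': "xs \<in> order_simplices (summand_poset scale) (Suc (rank UNIV - 2))"
      by blast
    then have xs: "length xs = rank UNIV" "set xs \<subseteq> summand_poset scale" "sorted_wrt (<) xs"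
      using assms by (simp_all add: order_simplices_def)
    have summand: "direct_summand scale (xs ! i)" "subspace (xs ! i)" "xs ! i \<noteq> {0}" "xs ! i \<noteq> UNIV"
      if "i < rank UNIV" for i
    proof -
      have "xs ! i \<in> summand_poset scale" using that xs(1,2) nth_mem[of i xs] by auto
      then show "direct_summand scale (xs ! i)" "subspace (xs ! i)" "xs ! i \<noteq> {0}" "xs ! i \<noteq> UNIV"
        by (auto simp: summand_poset_def direct_summand_def)
    qed
    have "Suc i \<le> rank (xs ! i)" if "i < rank UNIV" for i
      using that
    proof (induction i)
      case 0
      then show ?case using summand[of 0] rank_0_imp[of "xs ! 0"] by (auto simp: Suc_le_eq)
    next
      case (Suc i)
      then have "xs ! i < xs ! Suc i" using xs by (auto simp: sorted_wrt_iff_nth_less)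
      then have "rank (xs ! i) < rank (xs ! Suc i)" using Suc.prems summand by (intro rank_less) auto
      then show ?case using Suc by simp
    qed
    from this[of "rank UNIV - 1"] have "rank UNIV \<le> rank (xs ! (rank UNIV - 1))" using assms by auto
    moreover have "rank (xs ! (rank UNIV - 1)) < rank UNIV"
      using summand[of "rank UNIV - 1"] assms by (intro rank_less) (auto simp: subspace_UNIV)
    ultimately show False by simp
  qed
  then show ?thesis
    unfolding order_boundaries_def by (auto simp: order_boundary_def)
qed

end

section \<open>Cycles of the order complex\<close>

text \<open>Reindexing by the transposition shows X = - X, and a free abelian group has no
  2-torsion. This cancellation is used both for the boundary of an apartment and for the functional
  on integral apartments.\<close>

lemma sum_permutes_sign_eq_0:
  fixes F :: "('b \<Rightarrow> 'b) \<Rightarrow> ('c \<Rightarrow>\<^sub>0 int)"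
  assumes "finite S" "a \<in> S" "b \<in> S" "a \<noteq> b"
    and inv: "\<And>\<sigma>. \<sigma> permutes S \<Longrightarrow> F (\<sigma> \<circ> transpose a b) = F \<sigma>"
  shows "(\<Sum>\<sigma> | \<sigma> permutes S. frag_cmul (sign \<sigma>) (F \<sigma>)) = 0" (is "?X = 0")
proof -
  have \<tau>: "transpose a b permutes S" using assms by (intro permutes_swap_id)
  have "?X = (\<Sum>\<sigma> | \<sigma> permutes S. frag_cmul (sign (\<sigma> \<circ> transpose a b)) (F (\<sigma> \<circ> transpose a b)))"
    by (rule sum_permutations_compose_right[OF \<tau>])
  also have "\<dots> = (\<Sum>\<sigma> | \<sigma> permutes S. - frag_cmul (sign \<sigma>) (F \<sigma>))"
  proof (rule sum.cong[OF refl])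
    fix \<sigma> assume "\<sigma> \<in> {\<sigma>. \<sigma> permutes S}"
    then have \<sigma>: "\<sigma> permutes S" by simp
    then have "sign (\<sigma> \<circ> transpose a b) = - sign \<sigma>"
      using sign_compose[OF permutation_permutes[THEN iffD2] permutation_swap_id, of \<sigma> a b]
        assms(1,4) by (auto simp: sign_swap_id)
    then show "frag_cmul (sign (\<sigma> \<circ> transpose a b)) (F (\<sigma> \<circ> transpose a b)) = - frag_cmul (sign \<sigma>) (F \<sigma>)"
      using inv[OF \<sigma>] by simp
  qed
  also have "\<dots> = - ?X" by (simp only: sum_negf)
  finally have X: "?X = - ?X" .
  show ?thesis
  proof (rule poly_mapping_eqI)
    fix k
    have "Poly_Mapping.lookup ?X k = - Poly_Mapping.lookup ?X k"
      by (subst (1) X) (simp only: lookup_uminus)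
    then show "Poly_Mapping.lookup ?X k = Poly_Mapping.lookup 0 k" by simp
  qed
qed

text \<open>The vertices of an apartment are indexed by the nonempty proper subsets of {0, ..., n -
  1}. They are arbitrary poset elements, so W S need not be the sum of the lines with index in
  S.\<close>

definition flag_simplex :: "(nat set \<Rightarrow> 'p) \<Rightarrow> nat \<Rightarrow> (nat \<Rightarrow> nat) \<Rightarrow> 'p list" where
  "flag_simplex W n \<sigma> = map (\<lambda>k. W (\<sigma> ` {..k})) [0..<n - 1]"

lemma transpose_Suc_image_atMost:
  assumes "k \<noteq> i" shows "transpose i (Suc i) ` {..k} = {..k::nat}"
proof (cases "k < i")
  case True
  then have "transpose i (Suc i) j = id j" if "j \<in> {..k}" for j
    using that by (auto simp: transpose_def)
  then have "transpose i (Suc i) ` {..k} = id ` {..k}" by (rule image_cong[OF refl])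
  then show ?thesis by simp
next
  case False
  then show ?thesis using assms
    by (intro permutes_image permutes_swap_id) auto
qed

text \<open>Exchanging the ith and the next entry of \<sigma> changes the initial segment {..i}
  only. The face that omits vertex i is therefore the same for both permutations, and their signs
  are opposite.\<close>

lemma apartment_cycle:
  fixes W :: "nat set \<Rightarrow> 'p::order"
  assumes n: "2 \<le> n"
    and P: "\<And>S. S \<noteq> {} \<Longrightarrow> S \<subset> {..<n} \<Longrightarrow> W S \<in> P"
    and mono: "\<And>S T. S \<noteq> {} \<Longrightarrow> S \<subset> T \<Longrightarrow> T \<subset> {..<n} \<Longrightarrow> W S < W T"
  shows "(\<Sum>\<sigma> | \<sigma> permutes {..<n}. frag_cmul (sign \<sigma>) (frag_of (flag_simplex W n \<sigma>)))
    \<in> order_cycles P (n - 2)" (is "?z \<in> _")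
proof -
  have simplex: "flag_simplex W n \<sigma> \<in> order_simplices P (n - 2)" if \<sigma>: "\<sigma> permutes {..<n}" for \<sigma>
  proof -
    have proper: "\<sigma> ` {..k} \<subset> {..<n}" if "k < n - 1" for k
    proof -
      have "{..k} \<subseteq> {..<n}" "n - 1 \<in> {..<n} - {..k}" using that by auto
      then have "{..k} \<subset> {..<n}" by blast
      then have "\<sigma> ` {..k} \<subset> \<sigma> ` {..<n}"
        by (rule image_strict_mono[OF inj_on_subset[OF permutes_inj[OF \<sigma>] subset_UNIV]])
      then show ?thesis using permutes_image[OF \<sigma>] by simp
    qed
    have "sorted_wrt (<) (flag_simplex W n \<sigma>)"
      unfolding sorted_wrt_iff_nth_less
    proof (intro allI impI)
      fix i j assume ij: "i < j" "j < length (flag_simplex W n \<sigma>)"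
      have "{..i} \<subset> {..j}" using ij(1) by auto
      then have "\<sigma> ` {..i} \<subset> \<sigma> ` {..j}"
        by (rule image_strict_mono[OF inj_on_subset[OF permutes_inj[OF \<sigma>] subset_UNIV]])
      then show "flag_simplex W n \<sigma> ! i < flag_simplex W n \<sigma> ! j"
        using mono[OF _ _ proper, of "\<sigma> ` {..i}" j] ij by (auto simp: flag_simplex_def)
    qed
    moreover have "set (flag_simplex W n \<sigma>) \<subseteq> P"
      using P[OF _ proper] by (auto simp: flag_simplex_def)
    ultimately show ?thesis using n by (simp add: order_simplices_def flag_simplex_def)
  qed
  have "Poly_Mapping.keys ?z \<subseteq> order_simplices P (n - 2)"
  proof -
    have "Poly_Mapping.keys ?z \<subseteq>
        (\<Union>\<sigma>\<in>{\<sigma>. \<sigma> permutes {..<n}}. Poly_Mapping.keys (frag_cmul (sign \<sigma>) (frag_of (flag_simplex W n \<sigma>))))"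
      by (rule Poly_Mapping.keys_sum)
    also have "\<dots> \<subseteq> order_simplices P (n - 2)"
      using simplex keys_cmul by (fastforce simp: keys_frag_of)
    finally show ?thesis .
  qed
  moreover have "order_boundary ?z = 0"
  proof -
    define face where "face i xs = take i xs @ drop (Suc i) xs" for i and xs :: "'p list"
    have len: "length (flag_simplex W n \<sigma>) = n - 1" for \<sigma> by (simp add: flag_simplex_def)
    have fin: "finite {\<sigma>. \<sigma> permutes {..<n}}" by (simp add: finite_permutations)
    have "order_boundary ?z = (\<Sum>\<sigma> | \<sigma> permutes {..<n}. frag_cmul (sign \<sigma>)
        (\<Sum>i<n - 1. frag_cmul ((-1) ^ i) (frag_of (face i (flag_simplex W n \<sigma>)))))"
      unfolding order_boundary_def frag_extend_sum[OF fin] o_def frag_extend_cmul frag_extend_of len face_def ..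
    also have "\<dots> = (\<Sum>\<sigma> | \<sigma> permutes {..<n}. \<Sum>i<n - 1. frag_cmul ((-1) ^ i)
        (frag_cmul (sign \<sigma>) (frag_of (face i (flag_simplex W n \<sigma>)))))"
      by (simp add: frag_cmul_sum mult.commute)
    also have "\<dots> = (\<Sum>i<n - 1. \<Sum>\<sigma> | \<sigma> permutes {..<n}. frag_cmul ((-1) ^ i)
        (frag_cmul (sign \<sigma>) (frag_of (face i (flag_simplex W n \<sigma>)))))"
      by (rule sum.swap)
    also have "\<dots> = (\<Sum>i<n - 1. frag_cmul ((-1) ^ i) (\<Sum>\<sigma> | \<sigma> permutes {..<n}.
        frag_cmul (sign \<sigma>) (frag_of (face i (flag_simplex W n \<sigma>)))))"
      by (simp add: frag_cmul_sum)
    also have "\<dots> = (\<Sum>i<n - 1. 0)"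
    proof (rule sum.cong[OF refl])
      fix i assume "i \<in> {..<n - 1}"
      then have i: "i < n - 1" by simp
      have "(\<Sum>\<sigma> | \<sigma> permutes {..<n}. frag_cmul (sign \<sigma>) (frag_of (face i (flag_simplex W n \<sigma>)))) = 0"
      proof (rule sum_permutes_sign_eq_0[of _ i "Suc i"])
        fix \<sigma> :: "nat \<Rightarrow> nat"
        have eq: "(\<sigma> \<circ> transpose i (Suc i)) ` {..k} = \<sigma> ` {..k}" if "k \<noteq> i" for k
          unfolding image_comp[symmetric] transpose_Suc_image_atMost[OF that] ..
        have face_eq: "face i (flag_simplex W n \<sigma>) =
            map (\<lambda>k. W (\<sigma> ` {..k})) [0..<i] @ map (\<lambda>k. W (\<sigma> ` {..k})) [Suc i..<n - 1]" for \<sigma>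
          using i by (simp add: face_def flag_simplex_def take_map drop_map)
        have map_eq: "map (\<lambda>k. W ((\<sigma> \<circ> transpose i (Suc i)) ` {..k})) ks = map (\<lambda>k. W (\<sigma> ` {..k})) ks"
          if "i \<notin> set ks" for ks
          by (rule map_cong[OF refl], rule arg_cong[of _ _ W], rule eq) (use that in auto)
        have i_notin: "i \<notin> set [0..<i]" "i \<notin> set [Suc i..<n - 1]" by auto
        show "frag_of (face i (flag_simplex W n (\<sigma> \<circ> transpose i (Suc i)))) =
            frag_of (face i (flag_simplex W n \<sigma>))"
          by (simp only: face_eq i_notin[THEN map_eq])
      qed (use i in auto)
      then show "frag_cmul ((-1) ^ i) (\<Sum>\<sigma> | \<sigma> permutes {..<n}.
          frag_cmul (sign \<sigma>) (frag_of (face i (flag_simplex W n \<sigma>)))) = 0" by simp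
    qed
    finally show ?thesis by simp
  qed
  ultimately show ?thesis unfolding order_cycles_def by simp
qed

text \<open>Without boundaries each homology class consists of a single cycle, so \<phi> is defined
  on classes. Its kernel is a subgroup that contains S but not the class of z.\<close>

lemma not_generated_by_classes:
  fixes P :: "'p::order set" and \<phi> :: "('p list \<Rightarrow>\<^sub>0 int) \<Rightarrow> ('c \<Rightarrow>\<^sub>0 int)"
  assumes bd: "order_boundaries P p = {0}"
    and \<phi>: "\<And>c d. \<phi> (c + d) = \<phi> c + \<phi> d"
    and z: "z \<in> order_cycles P p" "\<phi> z \<noteq> 0"
    and S: "\<And>A. A \<in> S \<Longrightarrow> \<exists>c. A = order_homology_class P p c \<and> \<phi> c = 0"
  shows "generate (order_reduced_homology P p) S \<noteq> carrier (order_reduced_homology P p)"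
proof
  let ?Z = "order_cycle_group P p" and ?H = "order_reduced_homology P p"
  assume eq: "generate ?H S = carrier ?H"
  have Z: "group ?Z" unfolding order_cycle_group_def
    by (rule group.group_subgroup_generated[OF group_free_Abelian_group])
  have Z_simps: "monoid.mult ?Z = (+)" "one ?Z = 0"
    unfolding order_cycle_group_def by (auto simp: fun_eq_iff)
  have "order_boundaries P p \<lhd> ?Z" using group.one_is_normal[OF Z] by (simp add: bd Z_simps)
  then have H: "group ?H" unfolding order_reduced_homology_def by (rule normal.factorgroup_is_group)
  have cls: "order_homology_class P p c = {c}" for c
    unfolding order_homology_class_def r_coset_def bd by (simp add: Z_simps)
  have H_carrier: "carrier ?H = (\<lambda>c. {c}) ` carrier ?Z"
    unfolding order_reduced_homology_def FactGroup_def RCOSETS_def r_coset_def bd by (auto simp: Z_simps)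
  have H_mult: "{c} \<otimes>\<^bsub>?H\<^esub> {d} = {c + d}" for c d
    unfolding order_reduced_homology_def FactGroup_def set_mult_def by (auto simp: Z_simps)
  have H_one: "\<one>\<^bsub>?H\<^esub> = {0}" unfolding order_reduced_homology_def FactGroup_def by (simp add: bd)
  have \<phi>0: "\<phi> 0 = 0" using \<phi>[of 0 0] by simp
  have "\<exists>c. A = {c} \<and> \<phi> c = 0" if "A \<in> generate ?H S" for A
    using that
  proof (induction rule: generate.induct)
    case one
    then show ?case using \<phi>0 by (simp add: H_one)
  next
    case (incl A)
    then show ?case using S[of A] cls by auto
  next
    case (inv A)
    then obtain c where c: "A = {c}" "\<phi> c = 0" using S[of A] cls by auto
    \<comment> \<open>The inverse has its usual properties only on the carrier; membership comes
      from the equality that is being refuted.\<close>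
    have "A \<in> carrier ?H" using generate.incl[OF inv] eq by blast
    then have "inv\<^bsub>?H\<^esub> A \<in> carrier ?H" "inv\<^bsub>?H\<^esub> A \<otimes>\<^bsub>?H\<^esub> A = \<one>\<^bsub>?H\<^esub>"
      using H by (auto simp: group.inv_closed group.l_inv)
    then obtain d where d: "inv\<^bsub>?H\<^esub> A = {d}" "d + c = 0"
      unfolding H_carrier H_one c(1) by (auto simp: H_mult)
    then have "\<phi> d = 0" using \<phi>[of d c] \<phi>0 c(2) by simp
    then show ?case using d(1) by blast
  next
    case (eng A B)
    then show ?case using \<phi> H_mult by fastforce
  qed
  moreover have "z \<in> carrier ?Z"
    using z(1) unfolding order_cycle_group_def carrier_subgroup_generated
    by (intro generate.incl) (auto simp: order_cycles_def)
  then have "{z} \<in> generate ?H S" unfolding eq H_carrier by blast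
  ultimately show False using z(2) by blast
qed

section \<open>Lines and coordinate subspaces\<close>

context idom_module
begin

definition is_line :: "'m set \<Rightarrow> ('m \<Rightarrow> 'a fract) \<Rightarrow> bool" where
  "is_line I \<theta> \<longleftrightarrow> fract_hom I \<theta> \<and> (\<forall>x\<in>I. \<theta> x = 0 \<longrightarrow> x = 0) \<and> (\<exists>x\<in>I. \<theta> x \<noteq> 0)"

text \<open>Elements of a line are commensurable: for a fixed nonzero y, each x satisfies q x = p y
  with q \<noteq> 0. Hence the ratio of two functionals is constant.\<close>

lemma fract_hom_proportional:
  assumes I: "subspace I" "is_line I \<theta>" and \<eta>: "fract_hom I \<eta>"
  obtains c where "\<And>x. x \<in> I \<Longrightarrow> \<eta> x = c * \<theta> x"
proof -
  have \<theta>: "fract_hom I \<theta>" "\<And>x. x \<in> I \<Longrightarrow> \<theta> x = 0 \<Longrightarrow> x = 0"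
    using I(2) unfolding is_line_def by auto
  obtain y where y: "y \<in> I" "\<theta> y \<noteq> 0" using I(2) unfolding is_line_def by auto
  show ?thesis
  proof (rule that[of "\<eta> y / \<theta> y"])
    fix x assume x: "x \<in> I"
    obtain p q where pq: "\<theta> x / \<theta> y = to_fract p / to_fract q" "q \<noteq> 0" using fract_quotient .
    then have "to_fract q * \<theta> x = to_fract p * \<theta> y" using y(2) by (simp add: field_simps)
    then have "\<theta> (q *s x - p *s y) = 0"
      using x y(1) I(1) by (simp add: fract_hom_diff[OF \<theta>(1)] subspace_scale fract_hom_scale[OF \<theta>(1)])
    moreover have "q *s x - p *s y \<in> I"
      using x y(1) by (intro subspace_diff[OF I(1)] subspace_scale[OF I(1)])
    ultimately have "q *s x = p *s y" using \<theta>(2)[of "q *s x - p *s y"] by simp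
    then have "to_fract q * \<eta> x = to_fract p * \<eta> y"
      using fract_hom_scale[OF \<eta>] x y(1) by metis
    then have "\<eta> x = (to_fract p / to_fract q) * \<eta> y" using pq(2) by (simp add: field_simps)
    then show "\<eta> x = \<eta> y / \<theta> y * \<theta> x" unfolding pq(1)[symmetric] by simp
  qed
qed

text \<open>
  The \<open>\<O>\<close>-module generated by the \<open>2 \<times> 2\<close> minors of \<open>(\<theta>, \<eta>)\<close> on \<open>F\<close> depends only on \<open>F\<close>, while any
  decomposition of \<open>F\<close> into two lines computes it, up to a scalar, as the product of their ideals.
\<close>

definition minors :: "('m \<Rightarrow> 'a fract) \<Rightarrow> ('m \<Rightarrow> 'a fract) \<Rightarrow> 'm set \<Rightarrow> 'a fract set" where
  "minors \<theta> \<eta> F = fract.span {\<theta> u * \<eta> v - \<theta> v * \<eta> u | u v. u \<in> F \<and> v \<in> F}"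

text \<open>On I the functionals \<theta>, \<eta> are multiples of \<alpha>, on J they are multiples
  of \<beta>. The scalar d is the determinant of the four factors; it may be 0 here, which is
  excluded later by a nonzero minor.\<close>

lemma minors_eq_ideal_prod:
  assumes IJ: "subspace I" "subspace J" "is_line I \<alpha>" "is_line J \<beta>"
    and F: "F = {u + v | u v. u \<in> I \<and> v \<in> J}" and hom: "fract_hom F \<theta>" "fract_hom F \<eta>"
  obtains d where "minors \<theta> \<eta> F = (*) d ` (\<alpha> ` I \<star> \<beta> ` J)"
proof -
  have sub: "I \<subseteq> F" "J \<subseteq> F"
    unfolding F using subset_sums(1)[OF subspace_0[OF IJ(2)]] subset_sums(2)[OF subspace_0[OF IJ(1)]] by blast+
  obtain a where a: "\<And>x. x \<in> I \<Longrightarrow> \<theta> x = a * \<alpha> x"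
    using fract_hom_proportional[OF IJ(1,3) fract_hom_subset[OF hom(1) sub(1)]] by blast
  obtain a' where a': "\<And>x. x \<in> I \<Longrightarrow> \<eta> x = a' * \<alpha> x"
    using fract_hom_proportional[OF IJ(1,3) fract_hom_subset[OF hom(2) sub(1)]] by blast
  obtain b where b: "\<And>x. x \<in> J \<Longrightarrow> \<theta> x = b * \<beta> x"
    using fract_hom_proportional[OF IJ(2,4) fract_hom_subset[OF hom(1) sub(2)]] by blast
  obtain b' where b': "\<And>x. x \<in> J \<Longrightarrow> \<eta> x = b' * \<beta> x"
    using fract_hom_proportional[OF IJ(2,4) fract_hom_subset[OF hom(2) sub(2)]] by blast
  define d where "d = a * b' - b * a'"
  let ?P = "\<alpha> ` I \<star> \<beta> ` J"
  have P: "fract.subspace ?P" by (rule subspace_ideal_prod)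
  have "minors \<theta> \<eta> F \<subseteq> (*) d ` ?P" unfolding minors_def
  proof (rule fract.span_minimal)
    show "fract.subspace ((*) d ` ?P)" by (rule subspace_image_mult[OF P])
    show "{\<theta> u * \<eta> v - \<theta> v * \<eta> u | u v. u \<in> F \<and> v \<in> F} \<subseteq> (*) d ` ?P"
    proof clarify
      fix x y assume "x \<in> F" "y \<in> F"
      then obtain u v u' v' where uv: "u \<in> I" "v \<in> J" "x = u + v" "u' \<in> I" "v' \<in> J" "y = u' + v'"
        unfolding F by blast
      have "\<theta> x = a * \<alpha> u + b * \<beta> v" "\<theta> y = a * \<alpha> u' + b * \<beta> v'"
        "\<eta> x = a' * \<alpha> u + b' * \<beta> v" "\<eta> y = a' * \<alpha> u' + b' * \<beta> v'"
        using uv sub a b a' b' fract_hom_add[OF hom(1)] fract_hom_add[OF hom(2)] by (auto simp: subset_iff)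
      then have "\<theta> x * \<eta> y - \<theta> y * \<eta> x = d * (\<alpha> u * \<beta> v' - \<alpha> u' * \<beta> v)"
        by (simp add: d_def algebra_simps)
      moreover have "\<alpha> u * \<beta> v' - \<alpha> u' * \<beta> v \<in> ?P"
        using uv by (intro fract.subspace_diff[OF P] ideal_prod_memI) auto
      ultimately show "\<theta> x * \<eta> y - \<theta> y * \<eta> x \<in> (*) d ` ?P" by blast
    qed
  qed
  moreover have "?P \<subseteq> {x. x * d \<in> minors \<theta> \<eta> F}"
  proof (rule ideal_prod_subset)
    show "fract.subspace {x. x * d \<in> minors \<theta> \<eta> F}"
      unfolding minors_def by (intro subspace_vimage_mult fract.subspace_span)
    fix x y assume "x \<in> \<alpha> ` I" "y \<in> \<beta> ` J"
    then obtain u v where uv: "u \<in> I" "v \<in> J" "x = \<alpha> u" "y = \<beta> v" by auto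
    then have "x * y * d = \<theta> u * \<eta> v - \<theta> v * \<eta> u" by (simp add: a a' b b' d_def algebra_simps)
    moreover have "\<theta> u * \<eta> v - \<theta> v * \<eta> u \<in> minors \<theta> \<eta> F"
      unfolding minors_def using uv sub by (intro fract.span_base) auto
    ultimately show "x * y \<in> {x. x * d \<in> minors \<theta> \<eta> F}" by simp
  qed
  then have "(*) d ` ?P \<subseteq> minors \<theta> \<eta> F" by (auto simp: mult.commute)
  ultimately show ?thesis using that[of d] by blast
qed

end

section \<open>Coordinate subspaces and changes of coordinates\<close>

context idom_module
begin

definition coord_subspace :: "(nat \<Rightarrow> 'm \<Rightarrow> 'a fract) \<Rightarrow> nat \<Rightarrow> nat set \<Rightarrow> 'm set" where
  "coord_subspace \<theta> n S = {x. \<forall>j<n. j \<notin> S \<longrightarrow> \<theta> j x = 0}"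

context
  fixes \<theta> n
  assumes \<theta>: "split_coords UNIV n \<theta>"
begin

lemma coord_hom: "j < n \<Longrightarrow> fract_hom UNIV (\<theta> j)"
  using split_coordsD(1)[OF \<theta>] .

lemma coord_simps:
  assumes "j < n"
  shows "\<theta> j (x + y) = \<theta> j x + \<theta> j y" "\<theta> j (a *s x) = to_fract a * \<theta> j x" "\<theta> j 0 = 0"
    "\<theta> j (x - y) = \<theta> j x - \<theta> j y"
  using fract_hom_add[OF coord_hom[OF assms]] fract_hom_scale[OF coord_hom[OF assms]]
    fract_hom_zero[OF coord_hom[OF assms]] fract_hom_diff[OF coord_hom[OF assms] subspace_UNIV] by auto

lemma coord_component:
  assumes "i < n"
  obtains y where "\<theta> i y = \<theta> i x" "\<And>j. j < n \<Longrightarrow> j \<noteq> i \<Longrightarrow> \<theta> j y = 0"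
  using split_coordsD(3)[OF \<theta> assms, of x] by auto

lemma coord_vector:
  assumes "i < n"
  obtains y where "\<theta> i y \<noteq> 0" "\<And>j. j < n \<Longrightarrow> j \<noteq> i \<Longrightarrow> \<theta> j y = 0"
  using split_coordsD(4)[OF \<theta> assms] coord_component[OF assms] by metis

lemma subspace_coord_subspace: "subspace (coord_subspace \<theta> n S)"
  by (auto simp: subspace_def coord_subspace_def coord_simps)

lemma coord_subspace_sum:
  "{x + y | x y. x \<in> coord_subspace \<theta> n S \<and> y \<in> coord_subspace \<theta> n T} = coord_subspace \<theta> n (S \<union> T)"
proof
  show "{x + y | x y. x \<in> coord_subspace \<theta> n S \<and> y \<in> coord_subspace \<theta> n T} \<subseteq> coord_subspace \<theta> n (S \<union> T)"
    by (auto simp: coord_subspace_def coord_simps)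
  \<comment> \<open>Splitting coordinates only allow a single coordinate to be isolated, so the
    projection to a set of coordinates is assembled one by one.\<close>
  have proj: "\<exists>y. \<forall>j<n. \<theta> j y = (if j \<in> S then \<theta> j x else 0)" if "finite S" "S \<subseteq> {..<n}" for S x
    using that
  proof (induction S rule: finite_induct)
    case empty
    then show ?case by (intro exI[of _ 0]) (simp add: coord_simps)
  next
    case (insert i S)
    then obtain y where y: "\<forall>j<n. \<theta> j y = (if j \<in> S then \<theta> j x else 0)" by auto
    obtain w where w: "\<theta> i w = \<theta> i x" "\<And>j. j < n \<Longrightarrow> j \<noteq> i \<Longrightarrow> \<theta> j w = 0"
      using coord_component[of i x] insert.prems by auto
    have "\<theta> j (y + w) = (if j \<in> insert i S then \<theta> j x else 0)" if "j < n" for j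
      using y w that insert.hyps(2) by (cases "j = i") (auto simp: coord_simps)
    then show ?case by blast
  qed
  show "coord_subspace \<theta> n (S \<union> T) \<subseteq> {x + y | x y. x \<in> coord_subspace \<theta> n S \<and> y \<in> coord_subspace \<theta> n T}"
  proof
    fix x assume x: "x \<in> coord_subspace \<theta> n (S \<union> T)"
    obtain y where y: "\<And>j. j < n \<Longrightarrow> \<theta> j y = (if j \<in> S \<inter> {..<n} then \<theta> j x else 0)"
      using proj[of "S \<inter> {..<n}" x] by auto
    have "y \<in> coord_subspace \<theta> n S" using y by (auto simp: coord_subspace_def)
    moreover have "x - y \<in> coord_subspace \<theta> n T" using x y by (auto simp: coord_subspace_def coord_simps)
    ultimately show "x \<in> {x + y | x y. x \<in> coord_subspace \<theta> n S \<and> y \<in> coord_subspace \<theta> n T}"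
      by (intro sums_memI[of y _ "x - y"]) auto
  qed
qed

lemma coord_subspace_empty: "coord_subspace \<theta> n {} = {0}"
  using split_coordsD(2)[OF \<theta>] by (auto simp: coord_subspace_def coord_simps)

lemma coord_subspace_full: "{..<n} \<subseteq> S \<Longrightarrow> coord_subspace \<theta> n S = UNIV"
  by (auto simp: coord_subspace_def)

lemma coord_subspace_mono: "S \<subseteq> T \<Longrightarrow> coord_subspace \<theta> n S \<subseteq> coord_subspace \<theta> n T"
  by (auto simp: coord_subspace_def)

lemma coord_subspace_strict_mono:
  assumes "S \<subset> T" "T \<subseteq> {..<n}"
  shows "coord_subspace \<theta> n S \<subset> coord_subspace \<theta> n T"
proof -
  obtain i where i: "i \<in> T" "i \<notin> S" "i < n" using assms by auto
  obtain y where "\<theta> i y \<noteq> 0" "\<And>j. j < n \<Longrightarrow> j \<noteq> i \<Longrightarrow> \<theta> j y = 0" using coord_vector[OF i(3)] by blast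
  then have "y \<in> coord_subspace \<theta> n T" "y \<notin> coord_subspace \<theta> n S"
    using i by (auto simp: coord_subspace_def)
  then show ?thesis using coord_subspace_mono[of S T] assms by blast
qed

lemma coord_subspace_summand:
  assumes "S \<noteq> {}" "S \<subset> {..<n}"
  shows "coord_subspace \<theta> n S \<in> summand_poset scale"
proof -
  have "direct_summand scale (coord_subspace \<theta> n S)" unfolding direct_summand_def
  \<comment> \<open>Only indices below n count, so the complement of S may be taken in all natural
    numbers.\<close>
  proof (intro conjI exI[of _ "coord_subspace \<theta> n (- S)"] subspace_coord_subspace)
    have "coord_subspace \<theta> n S \<inter> coord_subspace \<theta> n (- S) \<subseteq> coord_subspace \<theta> n {}"
      by (auto simp: coord_subspace_def)
    moreover have "0 \<in> coord_subspace \<theta> n S \<inter> coord_subspace \<theta> n (- S)"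
      using subspace_0[OF subspace_coord_subspace] by auto
    ultimately show "coord_subspace \<theta> n S \<inter> coord_subspace \<theta> n (- S) = {0}"
      unfolding coord_subspace_empty by auto
    show "{x + y | x y. x \<in> coord_subspace \<theta> n S \<and> y \<in> coord_subspace \<theta> n (- S)} = UNIV"
      unfolding coord_subspace_sum by (rule coord_subspace_full) auto
  qed
  moreover have "coord_subspace \<theta> n S \<noteq> {0}"
    using coord_subspace_strict_mono[of "{}" S] assms unfolding coord_subspace_empty by auto
  moreover have "coord_subspace \<theta> n S \<noteq> UNIV"
    using coord_subspace_strict_mono[of S "{..<n}"] assms unfolding coord_subspace_full[OF order_refl] by auto
  ultimately show ?thesis by (simp add: summand_poset_def)
qed

lemma coord_line:
  assumes "i < n"
  shows "is_line (coord_subspace \<theta> n {i}) (\<theta> i)" "\<theta> i ` coord_subspace \<theta> n {i} = range (\<theta> i)"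
proof -
  have "x = 0" if "x \<in> coord_subspace \<theta> n {i}" "\<theta> i x = 0" for x
    using that split_coordsD(2)[OF \<theta>, of x] by (auto simp: coord_subspace_def)
  moreover obtain y where "\<theta> i y \<noteq> 0" "\<And>j. j < n \<Longrightarrow> j \<noteq> i \<Longrightarrow> \<theta> j y = 0"
    using coord_vector[OF assms] by blast
  then have "\<exists>x\<in>coord_subspace \<theta> n {i}. \<theta> i x \<noteq> 0" by (intro bexI[of _ y]) (auto simp: coord_subspace_def)
  ultimately show "is_line (coord_subspace \<theta> n {i}) (\<theta> i)"
    unfolding is_line_def using fract_hom_subset[OF coord_hom[OF assms]] by auto
  show "\<theta> i ` coord_subspace \<theta> n {i} = range (\<theta> i)"
  proof
    show "range (\<theta> i) \<subseteq> \<theta> i ` coord_subspace \<theta> n {i}"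
    proof clarify
      fix x
      obtain y where "\<theta> i y = \<theta> i x" "\<And>j. j < n \<Longrightarrow> j \<noteq> i \<Longrightarrow> \<theta> j y = 0"
        using coord_component[OF assms] by blast
      then show "\<theta> i x \<in> \<theta> i ` coord_subspace \<theta> n {i}"
        by (intro image_eqI[of _ _ y]) (auto simp: coord_subspace_def)
    qed
  qed auto
qed

text \<open>This serves to move two similar ideals to the positions 0 and 1.\<close>

lemma split_coords_permute:
  assumes \<pi>: "\<pi> permutes {..<n}"
  shows "split_coords UNIV n (\<lambda>k. \<theta> (\<pi> k))"
proof -
  have lt: "\<pi> k < n \<longleftrightarrow> k < n" for k using permutes_in_image[OF \<pi>, of k] by simp
  have inj: "\<pi> j = \<pi> k \<longleftrightarrow> j = k" for j k using permutes_inj[OF \<pi>] by (simp add: inj_eq)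
  have all: "(\<forall>j<n. P (\<pi> j)) \<longleftrightarrow> (\<forall>j<n. P j)" for P
    using permutes_image[OF \<pi>] lt by (metis image_iff lessThan_iff)
  show ?thesis unfolding split_coords_def
  proof (intro conjI ballI allI impI)
    fix x assume "\<forall>i<n. \<theta> (\<pi> i) x = 0"
    then show "x = 0" using split_coordsD(2)[OF \<theta>, of x] all[of "\<lambda>i. \<theta> i x = 0"] by auto
  next
    fix i x assume "i < n"
    then obtain y where y: "\<theta> (\<pi> i) y = \<theta> (\<pi> i) x" "\<And>j. j < n \<Longrightarrow> j \<noteq> \<pi> i \<Longrightarrow> \<theta> j y = 0"
      using coord_component[of "\<pi> i" x] lt by auto
    then show "\<exists>y\<in>UNIV. \<theta> (\<pi> i) y = \<theta> (\<pi> i) x \<and> (\<forall>j<n. j \<noteq> i \<longrightarrow> \<theta> (\<pi> j) y = 0)"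
      using lt inj by (intro bexI[of _ y]) auto
  qed (use lt split_coordsD(4)[OF \<theta>] coord_hom in auto)
qed

end

text \<open>
  The new first coordinate is the minor of \<open>(\<theta>\<^sub>0, \<theta>\<^sub>1)\<close> against a nonzero vector of a complement of the
  kernel of the new second coordinate \<open>\<theta>\<^sub>0 + t \<theta>\<^sub>1\<close>, so it vanishes on that complement.
\<close>

lemma second_coords:
  assumes \<theta>: "split_coords UNIV n \<theta>" and n: "2 \<le> n"
    and D: "invertible_ideal D" "D = {x + t * y | x y. x \<in> range (\<theta> 0) \<and> y \<in> range (\<theta> 1)}"
  obtains \<eta> where "split_coords UNIV n \<eta>" "range (\<eta> 1) = D" "\<And>j. 2 \<le> j \<Longrightarrow> \<eta> j = \<theta> j"
    "\<And>x. \<eta> 0 x = 0 \<and> \<eta> 1 x = 0 \<longleftrightarrow> \<theta> 0 x = 0 \<and> \<theta> 1 x = 0"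
proof -
  have n01: "0 < n" "1 < n" using n by auto
  note simps = coord_simps[OF \<theta>]
  define \<psi> where "\<psi> x = \<theta> 0 x + t * \<theta> 1 x" for x
  have \<psi>_hom: "fract_hom UNIV \<psi>"
    using fract_hom_lincomb[OF coord_hom[OF \<theta> n01(1)] coord_hom[OF \<theta> n01(2)], of 1 t]
    unfolding \<psi>_def by simp
  note \<psi>_simps = fract_hom_add[OF \<psi>_hom UNIV_I UNIV_I] fract_hom_diff[OF \<psi>_hom subspace_UNIV UNIV_I UNIV_I]
    fract_hom_scale[OF \<psi>_hom UNIV_I]
  define F where "F = coord_subspace \<theta> n {0, 1}"
  have F: "subspace F" unfolding F_def by (rule subspace_coord_subspace[OF \<theta>])
  have F_iff: "x \<in> F \<longleftrightarrow> (\<forall>j. 2 \<le> j \<longrightarrow> j < n \<longrightarrow> \<theta> j x = 0)" for x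
    unfolding F_def coord_subspace_def by (auto simp: not_less_eq_eq numeral_2_eq_2 elim!: not0_implies_Suc)
  have \<psi>F: "\<psi> ` F = D"
  proof
    show "\<psi> ` F \<subseteq> D" unfolding D(2) \<psi>_def by auto
    show "D \<subseteq> \<psi> ` F"
    proof
      fix d assume "d \<in> D"
      then obtain x y where d: "d = \<theta> 0 x + t * \<theta> 1 y" unfolding D(2) by auto
      obtain u where u: "\<theta> 0 u = \<theta> 0 x" "\<And>j. j < n \<Longrightarrow> j \<noteq> 0 \<Longrightarrow> \<theta> j u = 0"
        using coord_component[OF \<theta> n01(1)] by blast
      obtain v where v: "\<theta> 1 v = \<theta> 1 y" "\<And>j. j < n \<Longrightarrow> j \<noteq> 1 \<Longrightarrow> \<theta> j v = 0"
        using coord_component[OF \<theta> n01(2)] by blast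
      have "\<psi> (u + v) = d" using u v n01 by (simp add: \<psi>_def simps d)
      moreover have "u + v \<in> F" unfolding F_iff using u v by (simp add: simps)
      ultimately show "d \<in> \<psi> ` F" by blast
    qed
  qed
  have \<psi>F_hom: "fract_hom F \<psi>" using fract_hom_subset[OF \<psi>_hom] by auto
  obtain L where L: "subspace L" "L \<subseteq> F" "\<And>x. x \<in> L \<Longrightarrow> \<psi> x = 0 \<Longrightarrow> x = 0" "\<psi> ` L = \<psi> ` F"
    using split_off_invertible[OF F \<psi>F_hom] D(1) \<psi>F by blast
  have "D \<noteq> {0}" using invertible_ideal_nonzero[OF D(1)] .
  moreover have "fract.subspace D" using D(1) unfolding invertible_ideal_def by auto
  ultimately obtain l where l: "l \<in> L" "\<psi> l \<noteq> 0"
    using L(4) \<psi>F subspace_nonzero by (metis imageE)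
  have line: "is_line L \<psi>" unfolding is_line_def
    using l L fract_hom_subset[OF \<psi>_hom] by auto
  define \<kappa> where "\<kappa> x = \<theta> 1 l * \<theta> 0 x + - \<theta> 0 l * \<theta> 1 x" for x
  have \<kappa>_hom: "fract_hom UNIV \<kappa>"
    unfolding \<kappa>_def by (rule fract_hom_lincomb[OF coord_hom[OF \<theta> n01(1)] coord_hom[OF \<theta> n01(2)]])
  note \<kappa>_simps = fract_hom_add[OF \<kappa>_hom UNIV_I UNIV_I] fract_hom_diff[OF \<kappa>_hom subspace_UNIV UNIV_I UNIV_I]
    fract_hom_scale[OF \<kappa>_hom UNIV_I]
  \<comment> \<open>On the line L, \<kappa> is proportional to \<psi>; as it vanishes at l, where
    \<psi> does not, it vanishes on all of L.\<close>
  obtain c where "\<And>x. x \<in> L \<Longrightarrow> \<kappa> x = c * \<psi> x"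
    using fract_hom_proportional[OF L(1) line fract_hom_subset[OF \<kappa>_hom subset_UNIV]] by blast
  moreover from this[OF l(1)] have "c = 0" using l(2) by (simp add: \<kappa>_def)
  ultimately have \<kappa>L: "\<And>x. x \<in> L \<Longrightarrow> \<kappa> x = 0" by simp
  have zero_iff: "\<kappa> x = 0 \<and> \<psi> x = 0 \<longleftrightarrow> \<theta> 0 x = 0 \<and> \<theta> 1 x = 0" for x
  proof
    assume x: "\<kappa> x = 0 \<and> \<psi> x = 0"
    \<comment> \<open>Cramer's rule: the matrix that expresses (\<kappa>, \<psi>) by the first two
      coordinates has determinant \<psi> l.\<close>
    have "\<psi> l * \<theta> 0 x = \<theta> 0 l * \<psi> x + t * \<kappa> x" "\<psi> l * \<theta> 1 x = \<theta> 1 l * \<psi> x - \<kappa> x"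
      by (simp_all add: \<psi>_def \<kappa>_def algebra_simps)
    then show "\<theta> 0 x = 0 \<and> \<theta> 1 x = 0" using x l(2) by simp
  qed (simp add: \<psi>_def \<kappa>_def)
  define \<eta> where "\<eta> j = (if j = 0 then \<kappa> else if j = 1 then \<psi> else \<theta> j)" for j
  have \<eta>: "\<eta> 0 = \<kappa>" "\<eta> 1 = \<psi>" "\<And>j. 2 \<le> j \<Longrightarrow> \<eta> j = \<theta> j" by (auto simp: \<eta>_def)
  have cases: "j = 0 \<or> j = 1 \<or> 2 \<le> j" for j :: nat by auto
  have F_part: "\<exists>y\<in>F. \<psi> y = \<psi> x \<and> \<kappa> y = \<kappa> x" for x
  proof -
    obtain u where u: "\<theta> 0 u = \<theta> 0 x" "\<And>j. j < n \<Longrightarrow> j \<noteq> 0 \<Longrightarrow> \<theta> j u = 0"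
      using coord_component[OF \<theta> n01(1)] by blast
    obtain v where v: "\<theta> 1 v = \<theta> 1 x" "\<And>j. j < n \<Longrightarrow> j \<noteq> 1 \<Longrightarrow> \<theta> j v = 0"
      using coord_component[OF \<theta> n01(2)] by blast
    have "\<theta> 0 (u + v) = \<theta> 0 x" "\<theta> 1 (u + v) = \<theta> 1 x" using u v n01 by (simp_all add: simps)
    then have "\<psi> (u + v) = \<psi> x" "\<kappa> (u + v) = \<kappa> x" by (simp_all add: \<psi>_def \<kappa>_def)
    moreover have "u + v \<in> F" unfolding F_iff using u v by (simp add: simps)
    ultimately show ?thesis by blast
  qed
  have "split_coords UNIV n \<eta>" unfolding split_coords_def
  proof (intro conjI ballI allI impI)
    show "fract_hom UNIV (\<eta> i)" if "i < n" for i
      using that coord_hom[OF \<theta>] \<kappa>_hom \<psi>_hom by (auto simp: \<eta>_def)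
    show "x = 0" if x: "\<forall>i<n. \<eta> i x = 0" for x
    proof (rule split_coordsD(2)[OF \<theta> UNIV_I])
      fix i assume i: "i < n"
      have "\<kappa> x = 0 \<and> \<psi> x = 0" using x n01 \<eta>(1,2) by metis
      then show "\<theta> i x = 0" using cases[of i] x i \<eta>(3)[of i] zero_iff[of x] by auto
    qed
    show "\<exists>y\<in>UNIV. \<eta> i y = \<eta> i x \<and> (\<forall>j<n. j \<noteq> i \<longrightarrow> \<eta> j y = 0)" if i: "i < n" for i x
    proof -
      \<comment> \<open>Decompose y as (y - w) + w: the first part is killed by \<psi>, the second
        lies in L and is killed by \<kappa>. These parts isolate the new coordinates 0 and
        1.\<close>
      obtain y where y: "y \<in> F" "\<psi> y = \<psi> x" "\<kappa> y = \<kappa> x" using F_part by auto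
      obtain w where w: "w \<in> L" "\<psi> w = \<psi> y" using L(4) y(1) by (metis imageE image_eqI)
      have wF: "\<And>j. 2 \<le> j \<Longrightarrow> j < n \<Longrightarrow> \<theta> j w = 0" using w(1) L(2) F_iff by auto
      have yF: "\<And>j. 2 \<le> j \<Longrightarrow> j < n \<Longrightarrow> \<theta> j y = 0" using y(1) F_iff by auto
      consider "i = 0" | "i = 1" | "2 \<le> i" using cases[of i] by auto
      then show ?thesis
      proof cases
        case 1
        have \<psi>0: "\<psi> (y - w) = 0" using w(2) by (simp add: \<psi>_simps)
        have "\<eta> j (y - w) = 0" if "j < n" "j \<noteq> 0" for j
        proof (cases "j = 1")
          case True
          then show ?thesis using \<psi>0 \<eta>(2) by simp
        next
          case False
          then have "2 \<le> j" using that(2) by simp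
          then show ?thesis using \<eta>(3)[of j] wF[of j] yF[of j] that(1) by (simp add: simps)
        qed
        moreover have "\<eta> 0 (y - w) = \<eta> 0 x" using \<kappa>L[OF w(1)] y(3) by (simp add: \<eta>(1) \<kappa>_simps)
        ultimately show ?thesis using 1 by auto
      next
        case 2
        have "\<eta> j w = 0" if "j < n" "j \<noteq> 1" for j
          using cases[of j] that \<eta>(1) \<eta>(3)[of j] wF[of j] \<kappa>L[OF w(1)] by auto
        moreover have "\<eta> 1 w = \<eta> 1 x" using w(2) y(2) \<eta>(2) by simp
        ultimately show ?thesis using 2 by auto
      next
        case 3
        obtain v where v: "\<theta> i v = \<theta> i x" "\<And>j. j < n \<Longrightarrow> j \<noteq> i \<Longrightarrow> \<theta> j v = 0"
          using coord_component[OF \<theta> i] by blast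
        then have "\<theta> 0 v = 0" "\<theta> 1 v = 0" using 3 n01 by auto
        then have v01: "\<kappa> v = 0 \<and> \<psi> v = 0" using zero_iff by simp
        have "\<eta> j v = 0" if "j < n" "j \<noteq> i" for j
          using cases[of j] that \<eta>(1,2) \<eta>(3)[of j] v01 v(2)[of j] by auto
        moreover have "\<eta> i v = \<eta> i x" using v(1) \<eta>(3)[OF 3] by simp
        ultimately show ?thesis by auto
      qed
    qed
    show "\<exists>x\<in>UNIV. \<eta> i x \<noteq> 0" if i: "i < n" for i
    proof -
      consider "i = 0" | "i = 1" | "2 \<le> i" using cases[of i] by auto
      then show ?thesis
      proof cases
        case 1
        have "\<theta> 0 l \<noteq> 0 \<or> \<theta> 1 l \<noteq> 0" using l(2) by (auto simp: \<psi>_def)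
        moreover obtain u where u: "\<theta> 0 u \<noteq> 0" "\<And>j. j < n \<Longrightarrow> j \<noteq> 0 \<Longrightarrow> \<theta> j u = 0"
          using coord_vector[OF \<theta> n01(1)] by blast
        moreover obtain v where v: "\<theta> 1 v \<noteq> 0" "\<And>j. j < n \<Longrightarrow> j \<noteq> 1 \<Longrightarrow> \<theta> j v = 0"
          using coord_vector[OF \<theta> n01(2)] by blast
        ultimately have "\<kappa> u \<noteq> 0 \<or> \<kappa> v \<noteq> 0" using n01 by (auto simp: \<kappa>_def)
        then show ?thesis using 1 \<eta>(1) by auto
      next
        case 2
        then show ?thesis using l(2) \<eta>(2) by auto
      next
        case 3
        then show ?thesis using split_coordsD(4)[OF \<theta> i] \<eta>(3) by auto
      qed
    qed
  qed
  moreover have "range (\<eta> 1) = D"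
  proof
    show "range (\<eta> 1) \<subseteq> D" unfolding \<eta>(2) D(2) \<psi>_def by auto
    show "D \<subseteq> range (\<eta> 1)" unfolding \<eta>(2) \<psi>F[symmetric] by auto
  qed
  ultimately show ?thesis using that[of \<eta>] \<eta> zero_iff by simp
qed

end

section \<open>Decompositions of M that leave room for another ideal class\<close>

context fg_projective
begin

lemma line_of_rank_1:
  assumes "subspace I" "rank I = 1"
  obtains \<alpha> where "is_line I \<alpha>" "\<alpha> ` I \<subseteq> \<O>"
proof -
  obtain \<theta> where \<theta>: "split_coords I 1 \<theta>" "\<And>i. i < 1 \<Longrightarrow> \<theta> i ` I \<subseteq> \<O>"
    using subspace_coords[OF assms(1)] assms(2) by metis
  have "is_line I (\<theta> 0)" unfolding is_line_def
    using split_coordsD[OF \<theta>(1)] by (auto simp: less_Suc_eq)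
  then show ?thesis using that \<theta>(2) by auto
qed

lemma is_line_image:
  assumes "subspace I" "is_line I \<alpha>"
  shows "fract.subspace (\<alpha> ` I)" "\<alpha> ` I \<noteq> {0}"
proof -
  show "fract.subspace (\<alpha> ` I)"
    using subspace_fract_hom_image[OF assms(1)] assms(2) unfolding is_line_def by auto
  obtain x where "x \<in> I" "\<alpha> x \<noteq> 0" using assms(2) unfolding is_line_def by auto
  then show "\<alpha> ` I \<noteq> {0}" by auto
qed

lemma coord_range:
  assumes "split_coords UNIV n \<theta>" "i < n"
  shows "fract.subspace (range (\<theta> i))" "range (\<theta> i) \<noteq> {0}"
  using is_line_image[OF subspace_coord_subspace[OF assms(1)] coord_line(1)[OF assms]]
  unfolding coord_line(2)[OF assms] .

lemma integral_ideal_fractional: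
  assumes "fract.subspace A" "A \<noteq> {0}" "A \<subseteq> (\<O> :: 'a fract set)"
  shows "A \<in> fractional_ideals"
proof -
  have "fract_scale 1 ` A \<subseteq> \<O>" using assms(3) by (auto simp: fract_scale_def)
  then show ?thesis unfolding fractional_ideals_def using assms by (auto intro!: exI[of _ 1])
qed

text \<open>The coordinates are those of a basis. It is finite because each basis element occurs in
  one of finitely many generators.\<close>

lemma free_coords:
  assumes "free_module scale"
  obtains \<theta> where "split_coords UNIV (rank UNIV) \<theta>" "\<And>i. i < rank UNIV \<Longrightarrow> range (\<theta> i) = \<O>"
proof -
  obtain B where B: "independent B" "span B = UNIV" using assms unfolding free_module_def by auto
  obtain G where G: "finite G" "span G = UNIV" using fg unfolding finitely_generated_module_def by auto
  let ?R = "representation B"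
  have R_simps: "?R (x + y) b = ?R x b + ?R y b" "?R (a *s x) b = a * ?R x b" "?R 0 b = 0" for x y a b
    using representation_add[OF B(1), of y x] representation_scale[OF B(1), of x a] representation_zero[of B] B(2)
    by auto
  have R_basis: "?R b c = (if c = b then 1 else 0)" if "b \<in> B" for b c
    using representation_basis[OF B(1) that] by simp
  have "B \<subseteq> (\<Union>g\<in>G. {b. ?R g b \<noteq> 0})"
  proof
    fix b assume b: "b \<in> B"
    have "\<exists>g\<in>G. ?R g b \<noteq> 0"
    proof (rule ccontr)
      assume "\<not> ?thesis"
      then have "G \<subseteq> {x. ?R x b = 0}" by auto
      moreover have "subspace {x. ?R x b = 0}" by (auto simp: subspace_def R_simps)
      ultimately have "span G \<subseteq> {x. ?R x b = 0}" by (rule span_minimal)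
      then have "?R b b = 0" unfolding G(2) by auto
      then show False using R_basis[OF b] by simp
    qed
    then show "b \<in> (\<Union>g\<in>G. {b. ?R g b \<noteq> 0})" by auto
  qed
  then have "finite B" using finite_subset G(1) finite_representation by blast
  then obtain bs where bs: "set bs = B" "distinct bs" using finite_distinct_list by auto
  define \<theta> where "\<theta> i x = to_fract (?R x (bs ! i))" for i x
  have nth_B: "bs ! i \<in> B" if "i < length bs" for i using that bs(1) by auto
  have \<theta>_basis: "\<theta> i (a *s bs ! j) = (if i = j then to_fract a else 0)"
    if "i < length bs" "j < length bs" for i j a
    using that bs(2) R_basis[OF nth_B[OF that(2)]] by (auto simp: \<theta>_def R_simps nth_eq_iff_index_eq)
  have coords: "split_coords UNIV (length bs) \<theta>" unfolding split_coords_def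
  proof (intro conjI ballI allI impI)
    show "fract_hom UNIV (\<theta> i)" for i by (simp add: fract_hom_def \<theta>_def R_simps)
    show "x = 0" if x: "\<forall>i<length bs. \<theta> i x = 0" for x
    proof -
      have "?R x b = 0" if "b \<in> B" for b
        using x that bs(1) by (auto simp: \<theta>_def in_set_conv_nth)
      then have "(\<Sum>b\<in>B. ?R x b *s b) = 0" by simp
      then show ?thesis using sum_representation_eq[OF B(1) _ \<open>finite B\<close> order_refl, of x] B(2) by simp
    qed
    show "\<exists>y\<in>UNIV. \<theta> i y = \<theta> i x \<and> (\<forall>j<length bs. j \<noteq> i \<longrightarrow> \<theta> j y = 0)" if i: "i < length bs" for i x
      by (intro bexI[of _ "?R x (bs ! i) *s bs ! i"]) (use i in \<open>auto simp: \<theta>_basis\<close>, simp add: \<theta>_def)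
    show "\<exists>x\<in>UNIV. \<theta> i x \<noteq> 0" if i: "i < length bs" for i
      using \<theta>_basis[OF i i, of 1] by (intro bexI[of _ "1 *s bs ! i"]) auto
  qed
  have "rank UNIV = length bs" by (rule module_rank_split_coords[OF subspace_UNIV coords])
  moreover have "range (\<theta> i) = \<O>" if i: "i < length bs" for i
  proof
    show "range (\<theta> i) \<subseteq> \<O>" by (auto simp: \<theta>_def)
    show "\<O> \<subseteq> range (\<theta> i)" using \<theta>_basis[OF i i] by (metis image_subsetI rangeI)
  qed
  ultimately show ?thesis using that[of \<theta>] coords by simp
qed

lemma coords_with_dissimilar_ideal:
  assumes h: "1 < card (carrier (class_group :: 'a fract set set monoid))"
    and n: "2 \<le> rank UNIV"
    and except: "card (carrier (class_group :: 'a fract set set monoid)) = 2 \<Longrightarrow>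
      \<not> (rank UNIV = 2 \<and> \<not> free_module scale)"
  obtains \<theta> D where "split_coords UNIV (rank UNIV) \<theta>" "range (\<theta> 0) \<subseteq> \<O>" "range (\<theta> 1) \<subseteq> \<O>"
    "D \<in> fractional_ideals" "\<not> similar_ideals (range (\<theta> 0)) D" "\<not> similar_ideals (range (\<theta> 1)) D"
proof -
  obtain \<theta> where \<theta>: "split_coords UNIV (rank UNIV) \<theta>" "\<And>i. i < rank UNIV \<Longrightarrow> range (\<theta> i) \<subseteq> \<O>"
    using subspace_coords[OF subspace_UNIV] by metis
  consider "2 < card (carrier (class_group :: 'a fract set set monoid))"
    | "card (carrier (class_group :: 'a fract set set monoid)) = 2" "free_module scale"
    | "card (carrier (class_group :: 'a fract set set monoid)) = 2" "3 \<le> rank UNIV"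
    using h n except by linarith
  then show ?thesis
  proof cases
    case 1
    obtain D where "D \<in> fractional_ideals" "\<not> similar_ideals (range (\<theta> 0)) D" "\<not> similar_ideals (range (\<theta> 1)) D"
      using exists_dissimilar_ideal[of "range (\<theta> 0)" "range (\<theta> 1)"] 1 by blast
    then show ?thesis using that[OF \<theta>(1)] \<theta>(2) n by auto
  next
    case 2
    obtain \<eta> where \<eta>: "split_coords UNIV (rank UNIV) \<eta>" "\<And>i. i < rank UNIV \<Longrightarrow> range (\<eta> i) = \<O>"
      using free_coords[OF 2(2)] by blast
    obtain D where "D \<in> fractional_ideals" "\<not> similar_ideals (\<O> :: 'a fract set) D"
      using exists_dissimilar_ideal[of "\<O> :: 'a fract set" \<O>] h similar_ideals_refl by blast
    moreover have "range (\<eta> 0) = \<O>" "range (\<eta> 1) = \<O>" using \<eta>(2) n by auto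
    ultimately show ?thesis using that[OF \<eta>(1)] by auto
  next
    case 3
    have "range (\<theta> i) \<in> fractional_ideals" if "i < 3" for i
      using that 3(2) by (intro integral_ideal_fractional coord_range[OF \<theta>(1)] \<theta>(2)) auto
    then have "similar_ideals (range (\<theta> 0)) (range (\<theta> 1)) \<or> similar_ideals (range (\<theta> 0)) (range (\<theta> 2)) \<or>
        similar_ideals (range (\<theta> 1)) (range (\<theta> 2))"
      by (intro similar_pair[OF 3(1)]) auto
    then obtain i j where ij: "i < 3" "j < 3" "i \<noteq> j" "similar_ideals (range (\<theta> i)) (range (\<theta> j))"
    proof (elim disjE)
      assume "similar_ideals (range (\<theta> 0)) (range (\<theta> 1))"
      then show thesis by (intro that[of 0 1]) auto
    next
      assume "similar_ideals (range (\<theta> 0)) (range (\<theta> 2))"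
      then show thesis by (intro that[of 0 2]) auto
    next
      assume "similar_ideals (range (\<theta> 1)) (range (\<theta> 2))"
      then show thesis by (intro that[of 1 2]) auto
    qed
    \<comment> \<open>Since m is the preimage of j under the first transposition, \<pi> sends 1 to
      j. It sends 0 to i because m \<noteq> 0, which holds as i \<noteq> j.\<close>
    define m where "m = transpose 0 i j"
    define \<pi> where "\<pi> = transpose 0 i \<circ> transpose 1 m"
    have m: "m < rank UNIV" "m \<noteq> 0" using ij 3(2) by (auto simp: m_def transpose_def)
    have "\<pi> permutes {..<rank UNIV}"
      unfolding \<pi>_def using ij m 3(2) by (intro permutes_compose permutes_swap_id) auto
    then have "split_coords UNIV (rank UNIV) (\<lambda>k. \<theta> (\<pi> k))" by (rule split_coords_permute[OF \<theta>(1)])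
    moreover have "\<pi> 0 = i" "\<pi> 1 = j"
      using m(2) by (auto simp: \<pi>_def m_def transpose_def split: if_splits)
    moreover obtain D where "D \<in> fractional_ideals" "\<not> similar_ideals (range (\<theta> i)) D" "\<not> similar_ideals (range (\<theta> j)) D"
      using exists_dissimilar_ideal[of "range (\<theta> i)" "range (\<theta> j)"] h ij(4) by blast
    ultimately show ?thesis using that[of "\<lambda>k. \<theta> (\<pi> k)" D] \<theta>(2) ij 3(2) by auto
  qed
qed

end

section \<open>Integral apartments\<close>

context fg_projective
begin

text \<open>Both decompositions of F compute the same nonzero module of minors. The products of
  their ideals are therefore proportional, and cancelling the similar first factors leaves similar
  second ones.\<close>

lemma line_class_complement:
  assumes F: "fract_hom F \<theta>" "fract_hom F \<eta>" "minors \<theta> \<eta> F \<noteq> {0}"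
    and AB: "subspace U" "subspace V" "is_line U \<alpha>" "is_line V \<beta>" "F = {u + v | u v. u \<in> U \<and> v \<in> V}"
    and IJ: "subspace I" "subspace J" "is_line I \<gamma>" "is_line J \<delta>" "F = {u + v | u v. u \<in> I \<and> v \<in> J}"
    and inv: "invertible_ideal (\<alpha> ` U)" and sim: "similar_ideals (\<alpha> ` U) (\<gamma> ` I)"
  shows "similar_ideals (\<beta> ` V) (\<delta> ` J)"
proof -
  obtain c where c: "minors \<theta> \<eta> F = (*) c ` (\<alpha> ` U \<star> \<beta> ` V)"
    using minors_eq_ideal_prod[OF AB F(1,2)] by blast
  obtain d where d: "minors \<theta> \<eta> F = (*) d ` (\<gamma> ` I \<star> \<delta> ` J)"
    using minors_eq_ideal_prod[OF IJ F(1,2)] by blast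
  have zero: "(*) 0 ` (X \<star> Y) = {0}" for X Y :: "'a fract set"
    using fract.subspace_0[OF subspace_ideal_prod[of X Y]] by auto
  have "c \<noteq> 0" using F(3) c zero by metis
  moreover have "d \<noteq> 0" using F(3) d zero by metis
  ultimately show ?thesis
    using similar_ideals_cofactor[OF inv is_line_image(1)[OF AB(2,4)] is_line_image(1)[OF IJ(2,4)] _ _ _ sim]
      c d by metis
qed

lemma frame_span:
  assumes F: "internal_direct_sum F"
  shows "span (\<Union> F) = UNIV"
proof -
  have "x \<in> span (\<Union> F)" for x
  proof -
    obtain f where f: "f \<in> (\<Pi>\<^sub>E I\<in>F. I)" "x = (\<Sum>I\<in>F. f I)"
      using F unfolding internal_direct_sum_def by blast
    show ?thesis unfolding f(2)
      by (rule span_sum, rule span_base) (use f(1) in auto)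
  qed
  then show ?thesis by auto
qed

lemma steinberg_not_generated:
  assumes h: "1 < card (carrier (class_group :: 'a fract set set monoid))"
    and n2: "2 \<le> rank UNIV"
    and except: "card (carrier (class_group :: 'a fract set set monoid)) = 2 \<Longrightarrow>
      \<not> (rank UNIV = 2 \<and> \<not> free_module scale)"
  shows "generate (steinberg scale) (integral_apartment_classes scale) \<noteq> carrier (steinberg scale)"
proof -
  define n where "n = rank UNIV"
  have n: "2 \<le> n" "0 < n" "1 < n" using n2 by (auto simp: n_def)
  obtain \<theta> D0 where \<theta>: "split_coords UNIV n \<theta>" and int: "range (\<theta> 0) \<subseteq> \<O>" "range (\<theta> 1) \<subseteq> \<O>"
    and D0: "D0 \<in> fractional_ideals" "\<not> similar_ideals (range (\<theta> 0)) D0" "\<not> similar_ideals (range (\<theta> 1)) D0"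
    using coords_with_dissimilar_ideal[OF h n2 except] unfolding n_def by blast
  define A where "A i = range (\<theta> i)" for i
  have A_inv: "invertible_ideal (A 0)" "invertible_ideal (A 1)"
    using integral_ideal_invertible[OF dedekind] coord_range[OF \<theta>] int n unfolding A_def by auto
  obtain D t where D: "similar_ideals D0 D" "invertible_ideal D" "D = {x + t * y | x y. x \<in> A 0 \<and> y \<in> A 1}"
    using exists_sum_in_class[OF dedekind A_inv(1) _ A_inv(2) fractional_ideal_invertible[OF dedekind D0(1)]]
      int(1) unfolding A_def by blast
  have D_sim: "\<not> similar_ideals (A 0) D" "\<not> similar_ideals (A 1) D"
    using D0(2,3) D(1) similar_ideals_sym similar_ideals_trans unfolding A_def by blast+
  obtain \<eta> where \<eta>: "split_coords UNIV n \<eta>" "range (\<eta> 1) = D" "\<And>j. 2 \<le> j \<Longrightarrow> \<eta> j = \<theta> j"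
    "\<And>x. \<eta> 0 x = 0 \<and> \<eta> 1 x = 0 \<longleftrightarrow> \<theta> 0 x = 0 \<and> \<theta> 1 x = 0"
    using second_coords[OF \<theta> n(1) D(2) D(3)[unfolded A_def]] by blast
  define V where "V = coord_subspace \<theta> n"
  define V' where "V' = coord_subspace \<eta> n"
  \<comment> \<open>The two coordinate systems differ only in the positions 0 and 1, and these two
    coordinates have the same common zeros in both.\<close>
  have V_eq: "V S = V' S" if S: "0 \<in> S \<longleftrightarrow> 1 \<in> S" for S
  proof -
    have "(\<forall>j<n. j \<notin> S \<longrightarrow> \<theta> j x = 0) \<longleftrightarrow> (\<forall>j<n. j \<notin> S \<longrightarrow> \<eta> j x = 0)" for x
    proof -
      have split: "(\<forall>j<n. j \<notin> S \<longrightarrow> \<zeta> j x = 0) \<longleftrightarrow>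
          (0 \<notin> S \<longrightarrow> \<zeta> 0 x = 0 \<and> \<zeta> 1 x = 0) \<and> (\<forall>j<n. 2 \<le> j \<longrightarrow> j \<notin> S \<longrightarrow> \<zeta> j x = 0)"
        for \<zeta> :: "nat \<Rightarrow> 'm \<Rightarrow> 'a fract"
      proof -
        have "j = 0 \<or> j = 1 \<or> 2 \<le> j" for j :: nat by auto
        then show ?thesis using S n by metis
      qed
      show ?thesis unfolding split[of \<theta>] split[of \<eta>] using \<eta>(3,4) by auto
    qed
    then show ?thesis unfolding V_def V'_def coord_subspace_def by simp
  qed
  \<comment> \<open>The vertices of the apartment with lines A_0, L, A_2, ...: the coordinates
    \<eta> are used for those that involve L but not A_0. For S containing 0 and 1,
    \<open>W S\<close> is the whole coordinate subspace and not just the sum of its lines.\<close>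
  define W where "W S = (if 1 \<in> S \<and> 0 \<notin> S then V' S else V S)" for S
  have W_poset: "W S \<in> summand_poset scale" if "S \<noteq> {}" "S \<subset> {..<n}" for S
    using coord_subspace_summand[OF \<theta> that] coord_subspace_summand[OF \<eta>(1) that]
    by (simp add: W_def V_def V'_def)
  have W_mono: "W S < W T" if ST: "S \<noteq> {}" "S \<subset> T" "T \<subset> {..<n}" for S T
  proof -
    have TS: "T \<subseteq> {..<n}" using ST by auto
    have "V S \<subset> V T" "V' S \<subset> V' T"
      using coord_subspace_strict_mono[OF \<theta> ST(2) TS] coord_subspace_strict_mono[OF \<eta>(1) ST(2) TS]
      by (auto simp: V_def V'_def)
    \<comment> \<open>When S and T use different coordinate systems, one of the two sets contains
      both or neither of 0 and 1, so both systems describe its vertex.\<close>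
    moreover have "1 \<in> S \<and> 0 \<notin> S \<Longrightarrow> \<not> (1 \<in> T \<and> 0 \<notin> T) \<Longrightarrow> V T = V' T"
      using V_eq[of T] ST(2) by auto
    moreover have "\<not> (1 \<in> S \<and> 0 \<notin> S) \<Longrightarrow> 1 \<in> T \<and> 0 \<notin> T \<Longrightarrow> V S = V' S"
      using V_eq[of S] ST(2) by auto
    ultimately show ?thesis unfolding W_def by auto
  qed
  define z where "z = (\<Sum>\<sigma> | \<sigma> permutes {..<n}. frag_cmul (sign \<sigma>) (frag_of (flag_simplex W n \<sigma>)))"
  have z: "z \<in> order_cycles (summand_poset scale) (n - 2)"
    unfolding z_def by (rule apartment_cycle[OF n(1) W_poset W_mono])
  define good where "good X \<longleftrightarrow>
    (\<exists>\<alpha>. is_line X \<alpha> \<and> (similar_ideals (A 0) (\<alpha> ` X) \<or> similar_ideals (A 1) (\<alpha> ` X)))" for X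
  \<comment> \<open>Position k of a flag holds the summand of rank k + 1, so position 0 is the line
    and the positions from 1 on are prescribed. For n = 2 nothing is prescribed.\<close>
  define Q where "Q xs \<longleftrightarrow> (\<forall>k. 1 \<le> k \<and> k < n - 1 \<longrightarrow> xs ! k = V {..k}) \<and> good (xs ! 0)" for xs
  \<comment> \<open>The integers are represented by the free abelian group on one generator, so that
    the cancellation lemma for signed sums applies to values of \<phi>.\<close>
  define \<phi> where "\<phi> = frag_extend (\<lambda>xs. if Q xs then frag_of () else 0)"
  have \<phi>_sum: "\<phi> (\<Sum>\<sigma> | \<sigma> permutes {..<n}. frag_cmul (sign \<sigma>) (frag_of (g \<sigma>))) =
      (\<Sum>\<sigma> | \<sigma> permutes {..<n}. frag_cmul (sign \<sigma>) (if Q (g \<sigma>) then frag_of () else 0))" for g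
    unfolding \<phi>_def by (simp add: frag_extend_sum finite_permutations frag_extend_cmul o_def)
  have good_W0: "good (W {0})"
  proof -
    have "is_line (V {0}) (\<theta> 0)" "\<theta> 0 ` V {0} = A 0"
      using coord_line[OF \<theta> n(2)] by (auto simp: V_def A_def)
    then show ?thesis unfolding good_def W_def using similar_ideals_refl
      by (intro exI[of _ "\<theta> 0"]) auto
  qed
  have bad_W1: "\<not> good (W {1})"
  proof
    assume "good (W {1})"
    then obtain \<alpha> where \<alpha>: "is_line (V' {1}) \<alpha>"
      "similar_ideals (A 0) (\<alpha> ` V' {1}) \<or> similar_ideals (A 1) (\<alpha> ` V' {1})"
      unfolding good_def W_def by auto
    have line: "is_line (V' {1}) (\<eta> 1)" "\<eta> 1 ` V' {1} = D" and sub: "subspace (V' {1})"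
      using coord_line[OF \<eta>(1) n(3)] \<eta>(2) subspace_coord_subspace[OF \<eta>(1)] by (auto simp: V'_def)
    obtain c where c: "\<And>x. x \<in> V' {1} \<Longrightarrow> \<alpha> x = c * \<eta> 1 x"
      using fract_hom_proportional[OF sub line(1)] \<alpha>(1) unfolding is_line_def by blast
    have "\<alpha> ` V' {1} = (*) c ` D" unfolding line(2)[symmetric] image_image using c by (rule image_cong[OF refl])
    moreover have "c \<noteq> 0" using \<alpha>(1) c unfolding is_line_def by auto
    ultimately have "similar_ideals D (\<alpha> ` V' {1})" unfolding similar_ideals_def by blast
    then show False using \<alpha>(2) D_sim similar_ideals_sym similar_ideals_trans by blast
  qed
  have W_inj: "\<sigma> ` {..k} = {..k}" if \<sigma>: "\<sigma> permutes {..<n}" and k: "1 \<le> k" "k < n - 1"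
    and eq: "W (\<sigma> ` {..k}) = V {..k}" for \<sigma> k
  proof (rule ccontr)
    assume neq: "\<sigma> ` {..k} \<noteq> {..k}"
    have card: "card (\<sigma> ` {..k}) = card {..k}"
      by (rule card_image[OF inj_on_subset[OF permutes_inj[OF \<sigma>] subset_UNIV]])
    then have "\<not> \<sigma> ` {..k} \<subseteq> {..k}" using card_subset_eq[of "{..k}" "\<sigma> ` {..k}"] neq by auto
    then obtain i where i: "i \<in> \<sigma> ` {..k}" "i \<notin> {..k}" by auto
    then obtain m where m: "m \<le> k" "i = \<sigma> m" by auto
    then have "i < n" using permutes_in_image[OF \<sigma>, of m] k by simp
    have "2 \<le> i" using i(2) k by simp
    obtain y where y: "\<theta> i y \<noteq> 0" "\<And>j. j < n \<Longrightarrow> j \<noteq> i \<Longrightarrow> \<theta> j y = 0"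
      using coord_vector[OF \<theta> \<open>i < n\<close>] by blast
    have "\<theta> 0 y = 0 \<and> \<theta> 1 y = 0" using y(2) n \<open>2 \<le> i\<close> by auto
    then have y01: "\<eta> 0 y = 0 \<and> \<eta> 1 y = 0" using \<eta>(4) by blast
    have "\<eta> j y = 0" if "j < n" "j \<noteq> i" for j
    proof -
      have "j = 0 \<or> j = 1 \<or> 2 \<le> j" by auto
      then show ?thesis using y01 y(2)[OF that] \<eta>(3)[of j] by auto
    qed
    then have "y \<in> W (\<sigma> ` {..k})"
      using y(2) i(1) unfolding W_def V_def V'_def coord_subspace_def by auto
    moreover have "y \<notin> V {..k}"
      using y(1) i(2) \<open>i < n\<close> unfolding V_def coord_subspace_def by auto
    ultimately show False using eq by simp
  qed
  \<comment> \<open>Only one flag of the apartment is counted. The prescribed vertices leave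
    \<sigma> 0 = 0 or \<sigma> 0 = 1, and the second choice puts L first, whose class is neither
    that of A_0 nor that of A_1.\<close>
  have Q_iff: "Q (flag_simplex W n \<sigma>) \<longleftrightarrow> \<sigma> = id" if \<sigma>: "\<sigma> permutes {..<n}" for \<sigma>
  proof
    have nth: "flag_simplex W n \<tau> ! k = W (\<tau> ` {..k})" if "k < n - 1" for \<tau> k
      using that by (simp add: flag_simplex_def)
    {
      assume "\<sigma> = id"
      moreover have "W {..k} = V {..k}" for k by (simp add: W_def)
      ultimately show "Q (flag_simplex W n \<sigma>)" unfolding Q_def using good_W0 n by (simp add: nth)
    }
    assume "Q (flag_simplex W n \<sigma>)"
    then have Q1: "\<And>k. 1 \<le> k \<Longrightarrow> k < n - 1 \<Longrightarrow> \<sigma> ` {..k} = {..k}" and Q2: "good (W {\<sigma> 0})"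
      unfolding Q_def using W_inj[OF \<sigma>] n by (auto simp: nth)
    have "\<sigma> 0 \<in> {0, 1}"
    proof (cases "n = 2")
      case True
      then show ?thesis using permutes_in_image[OF \<sigma>, of 0] by auto
    next
      case False
      then have "\<sigma> ` {..1} = {..1}" using Q1[of 1] n by auto
      then have "\<sigma> 0 \<in> {..1}" by blast
      then show ?thesis by auto
    qed
    then have \<sigma>0: "\<sigma> 0 = 0" using Q2 bad_W1 by auto
    have im: "\<sigma> ` {..k} = {..k}" if kn: "k < n" for k
    proof -
      consider "k = 0" | "1 \<le> k" "k < n - 1" | "k = n - 1" using kn by linarith
      then show ?thesis
      proof cases
        case 3
        then have "{..k} = {..<n}" using n by auto
        then show ?thesis using permutes_image[OF \<sigma>] by simp
      qed (use \<sigma>0 Q1 in auto)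
    qed
    have "\<sigma> k = k" for k
    proof (cases "k < n")
      case True
      have le: "\<sigma> k \<le> k" using im[OF True] by auto
      show ?thesis
      proof (cases k)
        case (Suc m)
        have "\<sigma> k \<notin> \<sigma> ` {..m}" using permutes_inj[OF \<sigma>] Suc by (auto simp: inj_eq)
        then have "\<sigma> k \<notin> {..m}" using im[of m] True Suc by auto
        then show ?thesis using le Suc by auto
      qed (use \<sigma>0 in simp)
    next
      case False
      then show ?thesis using permutes_not_in[OF \<sigma>] by simp
    qed
    then show "\<sigma> = id" by auto
  qed
  have "\<phi> z = (\<Sum>\<sigma>\<in>{id}. frag_cmul (sign \<sigma>) (if Q (flag_simplex W n \<sigma>) then frag_of () else 0))"
    unfolding z_def \<phi>_sum
    by (rule sum.mono_neutral_right) (auto simp: finite_permutations permutes_id Q_iff)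
  then have \<phi>z: "\<phi> z \<noteq> 0" using Q_iff[OF permutes_id] by (simp add: sign_id)
  \<comment> \<open>Exchanging the first two lines changes only the first vertex of the flag, from I
    to J. What has to be shown is that J is good if I is.\<close>
  have swap: "Q (apartment_simplex scale Is (\<sigma> \<circ> transpose 0 1))"
    if Is: "distinct Is" "integral_frame scale (set Is)" and \<sigma>: "\<sigma> permutes {..<n}"
      and Q: "Q (apartment_simplex scale Is \<sigma>)" for Is \<sigma>
  proof -
    have len: "length Is = n"
      using Is distinct_card[of Is] unfolding integral_frame_def n_def by simp
    have nth: "apartment_simplex scale Is \<tau> ! k = span (\<Union>j\<le>k. Is ! \<tau> j)" if "k < n - 1" for \<tau> k
      using that by (simp add: apartment_simplex_def len)
    have line: "subspace (Is ! i) \<and> rank (Is ! i) = 1" if "i < n" for i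
      using that Is(2) nth_mem[of i Is] unfolding len integral_frame_def direct_summand_def by auto
    define I where "I = Is ! \<sigma> 0"
    define J where "J = Is ! \<sigma> 1"
    have "\<sigma> 0 < n" "\<sigma> 1 < n"
      using permutes_in_image[OF \<sigma>, of 0] permutes_in_image[OF \<sigma>, of 1] n by simp_all
    then have IJ: "subspace I" "subspace J" "rank I = 1" "rank J = 1" using line by (auto simp: I_def J_def)
    have im: "(\<Union>j\<le>k. Is ! (\<sigma> \<circ> transpose 0 1) j) = (\<Union>j\<le>k. Is ! \<sigma> j)" if "1 \<le> k" for k
    proof -
      have "(\<Union>j\<le>k. Is ! (\<sigma> \<circ> transpose 0 1) j) = (\<Union>j\<in>transpose 0 1 ` {..k}. Is ! \<sigma> j)" by auto
      also have "transpose 0 1 ` {..k} = {..k}"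
        using transpose_Suc_image_atMost[of k 0] that by simp
      finally show ?thesis .
    qed
    have span_IJ: "span (\<Union>j\<le>1. Is ! \<sigma> j) = {u + v | u v. u \<in> I \<and> v \<in> J}"
    proof -
      have "{..1} = {0, 1::nat}" by auto
      then have "(\<Union>j\<le>1. Is ! \<sigma> j) = I \<union> J" by (auto simp: I_def J_def)
      then show ?thesis using IJ by (simp add: span_Un span_eq_iff[THEN iffD2])
    qed
    \<comment> \<open>For n = 2 the flag has no vertex of rank 2, and the two lines of the frame
      span M itself. Otherwise Q prescribes this vertex.\<close>
    have F: "V {..1} = {u + v | u v. u \<in> I \<and> v \<in> J}"
    proof (cases "n = 2")
      case True
      then have "{..1} = {..<n}" by auto
      then have "(\<Union>j\<le>1. Is ! \<sigma> j) = (\<Union>i\<in>\<sigma> ` {..<n}. Is ! i)" by simp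
      also have "\<dots> = \<Union> (set Is)" unfolding permutes_image[OF \<sigma>] using len by (auto simp: set_conv_nth)
      finally have "span (\<Union>j\<le>1. Is ! \<sigma> j) = UNIV"
        using frame_span Is(2) unfolding integral_frame_def by simp
      moreover have "V {..1} = UNIV"
        unfolding V_def by (rule coord_subspace_full[OF \<theta>]) (use True in auto)
      ultimately show ?thesis using span_IJ by simp
    next
      case False
      then have "1 < n - 1" using n by simp
      then show ?thesis using Q nth[of 1 \<sigma>] span_IJ unfolding Q_def by auto
    qed
    have "good J"
    proof -
      have first: "span (\<Union>j\<le>0. Is ! \<sigma> j) = I" using IJ(1) by (simp add: I_def span_eq_iff[THEN iffD2])
      then obtain \<gamma> where \<gamma>: "is_line I \<gamma>" "similar_ideals (A 0) (\<gamma> ` I) \<or> similar_ideals (A 1) (\<gamma> ` I)"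
        using Q nth[of 0 \<sigma>] n unfolding Q_def good_def by auto
      obtain \<delta> where \<delta>: "is_line J \<delta>" using line_of_rank_1[OF IJ(2,4)] by blast
      have hom: "fract_hom (V {..1}) (\<theta> 0)" "fract_hom (V {..1}) (\<theta> 1)"
        using fract_hom_subset[OF coord_hom[OF \<theta>]] n by auto
      have lines: "subspace (V {0})" "subspace (V {1})" "is_line (V {0}) (\<theta> 0)" "is_line (V {1}) (\<theta> 1)"
        and images: "\<theta> 0 ` V {0} = A 0" "\<theta> 1 ` V {1} = A 1"
        using coord_line[OF \<theta> n(2)] coord_line[OF \<theta> n(3)] subspace_coord_subspace[OF \<theta>]
        by (auto simp: V_def A_def)
      have V01: "V {..1} = {u + v | u v. u \<in> V {0} \<and> v \<in> V {1}}"
      proof -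
        have "{..1} = {0} \<union> {1::nat}" by auto
        then show ?thesis unfolding V_def coord_subspace_sum[OF \<theta>] by simp
      qed
      \<comment> \<open>Both orders are needed, since the summand whose ideal is similar to that of
        I has to come first.\<close>
      have V10: "V {..1} = {u + v | u v. u \<in> V {1} \<and> v \<in> V {0}}"
      proof -
        have "{..1} = {1} \<union> {0::nat}" by auto
        then show ?thesis unfolding V_def coord_subspace_sum[OF \<theta>] by simp
      qed
      have "minors (\<theta> 0) (\<theta> 1) (V {..1}) \<noteq> {0}"
      proof -
        obtain u where u: "\<theta> 0 u \<noteq> 0" "\<And>j. j < n \<Longrightarrow> j \<noteq> 0 \<Longrightarrow> \<theta> j u = 0"
          using coord_vector[OF \<theta> n(2)] by blast
        obtain v where v: "\<theta> 1 v \<noteq> 0" "\<And>j. j < n \<Longrightarrow> j \<noteq> 1 \<Longrightarrow> \<theta> j v = 0"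
          using coord_vector[OF \<theta> n(3)] by blast
        have "u \<in> V {..1}" "v \<in> V {..1}" using u v by (auto simp: V_def coord_subspace_def)
        then have "\<theta> 0 u * \<theta> 1 v - \<theta> 0 v * \<theta> 1 u \<in> minors (\<theta> 0) (\<theta> 1) (V {..1})"
          unfolding minors_def by (intro fract.span_base) blast
        moreover have "\<theta> 0 u * \<theta> 1 v - \<theta> 0 v * \<theta> 1 u \<noteq> 0" using u v n by simp
        ultimately show ?thesis by blast
      qed
      note complement = line_class_complement[OF hom this]
      from \<gamma>(2) show ?thesis
      proof
        assume "similar_ideals (A 0) (\<gamma> ` I)"
        then have "similar_ideals (A 1) (\<delta> ` J)"
          using complement[OF lines(1,2,3,4) V01 IJ(1,2) \<gamma>(1) \<delta> F] A_inv(1) unfolding images by blast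
        then show ?thesis unfolding good_def using \<delta> by blast
      next
        assume "similar_ideals (A 1) (\<gamma> ` I)"
        then have "similar_ideals (A 0) (\<delta> ` J)"
          using complement[OF lines(2,1,4,3) V10 IJ(1,2) \<gamma>(1) \<delta> F] A_inv(2) unfolding images by blast
        then show ?thesis unfolding good_def using \<delta> by blast
      qed
    qed
    moreover have "span (\<Union>j\<le>0. Is ! (\<sigma> \<circ> transpose 0 1) j) = J"
      using IJ(2) by (simp add: J_def span_eq_iff[THEN iffD2])
    ultimately have "good (apartment_simplex scale Is (\<sigma> \<circ> transpose 0 1) ! 0)"
      using nth[of 0 "\<sigma> \<circ> transpose 0 1"] n by (simp only:)
    moreover have "apartment_simplex scale Is (\<sigma> \<circ> transpose 0 1) ! k = V {..k}" if "1 \<le> k" "k < n - 1" for k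
    proof -
      have "apartment_simplex scale Is \<sigma> ! k = V {..k}" using Q that unfolding Q_def by blast
      then show ?thesis unfolding nth[OF that(2)] im[OF that(1)] .
    qed
    ultimately show ?thesis unfolding Q_def by blast
  qed
  have "generate (order_reduced_homology (summand_poset scale) (n - 2)) (integral_apartment_classes scale)
      \<noteq> carrier (order_reduced_homology (summand_poset scale) (n - 2))"
  proof (rule not_generated_by_classes[where \<phi> = \<phi>, OF _ _ z \<phi>z])
    show "order_boundaries (summand_poset scale) (n - 2) = {0}"
      unfolding n_def by (rule order_boundaries_summand_poset[OF n2])
    show "\<phi> (c + d) = \<phi> c + \<phi> d" for c d unfolding \<phi>_def by (rule frag_extend_add)
    fix X assume "X \<in> integral_apartment_classes scale"
    then obtain Is where Is: "X = apartment_class scale Is" "distinct Is" "integral_frame scale (set Is)"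
      unfolding integral_apartment_classes_def by auto
    have len: "length Is = n"
      using Is distinct_card[of Is] unfolding integral_frame_def n_def by simp
    let ?c = "\<Sum>\<sigma> | \<sigma> permutes {..<n}. frag_cmul (sign \<sigma>) (frag_of (apartment_simplex scale Is \<sigma>))"
    have "\<phi> ?c = 0" unfolding \<phi>_sum
    proof (rule sum_permutes_sign_eq_0[of _ 0 1])
      fix \<sigma> assume \<sigma>: "\<sigma> permutes {..<n}"
      have \<tau>: "\<sigma> \<circ> transpose 0 1 permutes {..<n}"
        using n by (intro permutes_compose[OF _ \<sigma>] permutes_swap_id) auto
      \<comment> \<open>The exchange is an involution, so the implication \<open>swap\<close>,
        applied twice, is an equivalence.\<close>
      have "\<sigma> \<circ> transpose 0 1 \<circ> transpose 0 1 = \<sigma>" by (simp add: comp_assoc)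
      then have "Q (apartment_simplex scale Is (\<sigma> \<circ> transpose 0 1)) \<longleftrightarrow> Q (apartment_simplex scale Is \<sigma>)"
        using swap[OF Is(2,3) \<sigma>] swap[OF Is(2,3) \<tau>] by auto
      then show "(if Q (apartment_simplex scale Is (\<sigma> \<circ> transpose 0 1)) then frag_of () else 0) =
          (if Q (apartment_simplex scale Is \<sigma>) then frag_of () else 0)" by simp
    qed (use n in auto)
    moreover have "X = order_homology_class (summand_poset scale) (n - 2) ?c"
      unfolding Is(1) apartment_class_def len n_def[symmetric] ..
    ultimately show "\<exists>c. X = order_homology_class (summand_poset scale) (n - 2) c \<and> \<phi> c = 0" by blast
  qed
  then show ?thesis unfolding steinberg_def n_def .
qed

end

theorem theoremB:
  fixes scale :: "'a::idom \<Rightarrow> 'm::ab_group_add \<Rightarrow> 'm" and n :: nat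
  assumes "dedekind_domain TYPE('a)"
    and "finite (carrier (class_group :: 'a fract set set monoid))"
    and "1 < card (carrier (class_group :: 'a fract set set monoid))"
    and "Modules.module scale"
    and "finitely_generated_module scale"
    and "projective_module scale"
    and "module_rank scale UNIV = n"
    and "2 \<le> n"
    and "card (carrier (class_group :: 'a fract set set monoid)) = 2 \<Longrightarrow>
           \<not> (n = 2 \<and> \<not> free_module scale)"
  shows "generate (steinberg scale) (integral_apartment_classes scale) \<noteq> carrier (steinberg scale)"
proof -
  interpret fg_projective scale
    by (intro fg_projective.intro idom_module.intro fg_projective_axioms.intro assms)
  show ?thesis using assms by (intro steinberg_not_generated) auto
qed

end
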